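(* Let $\Omega$ be the chair tiling space in its arrow version. Let $H_7$ be the 2-element group generated by reflection of $\mathbb{R}^2$ about the line $y=x$ and $H_8$ the 2-element group generated by reflection about the line $y=-x$. For a group $H$ let $\Omega_H=\{T\in\Omega: hT=T\text{ for all }h\in H\}$, with the subspace topology. Then $\Omega_{H_7}$ and $\Omega_{H_8}$ are homeomorphic, and $$\check H^0(\Omega_{H_7})\cong\mathbb{Z},\qquad \check H^1(\Omega_{H_7})\cong\mathbb{Z}[1/2]^2 .$$
   Context: Arrow version of the chair tiling: the tiles are closed unit squares with sides parallel to the coordinate axes, meeting full edge to full edge, each labeled by an arrow pointing NE, NW, SW or SE. The substitution $\sigma$ scales a tile linearly by 2 about the origin and replaces the resulting $2\times 2$ square by four labeled unit squares. For an NE tile the four labels are: top-left SE, top-right NE, bottom-left NE, bottom-right NW. The substitution of the other three tiles is obtained from this one by rotating or reflecting the whole picture (positions and arrows). $\sigma$ extends to patches and tilings tile by tile. $\Omega$ is the set of all such labeled tilings of $\mathbb{R}^2$ (the tile vertices need not lie in $\mathbb{Z}^2$) such that every finite patch is a translate of a subpatch of $\sigma^n(t)$ for some tile $t$ and some $n\ge 0$. The topology on $\Omega$ is the usual tiling topology: two tilings are $\epsilon$-close if, after translating each by a vector of length at most $\epsilon$, they agree on the ball of radius $1/\epsilon$ about the origin. The group $O(2,\mathbb{Z})$ acts on $\Omega$ by acting on the plane about the origin, moving the tiles and transforming their arrows accordingly (for example, the counterclockwise rotation by 90 degrees sends an NE arrow to an NW arrow, and reflection about the $x$ axis interchanges NE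 with SE and NW with SW). $\check H^*$ denotes Čech cohomology with integer coefficients, and $\mathbb{Z}[1/2]=\varinjlim(\mathbb{Z},\times 2)$ is the additive group of dyadic rationals. *)

theory Defs
  imports
    "HOL-Analysis.Analysis"
    "HOL-Algebra.Coset"
    "HOL-Algebra.Generated_Groups"
    "HOL-Algebra.Elementary_Groups"
    "HOL-Algebra.Product_Groups"
begin

section \<open>Direct limits of groups\<close>

text \<open>
  A system of groups \<open>G i\<close> indexed by a set \<open>I\<close> directed by \<open>leq\<close>, with transition
  homomorphisms \<open>\<phi> i j\<close> from \<open>G i\<close> to \<open>G j\<close> whenever \<open>leq i j\<close>.
\<close>

definition dlim_rel ::
  "'i set \<Rightarrow> ('i \<Rightarrow> 'i \<Rightarrow> bool) \<Rightarrow> ('i \<Rightarrow> ('g, 'm) monoid_scheme) \<Rightarrow> ('i \<Rightarrow> 'i \<Rightarrow> 'g \<Rightarrow> 'g)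
    \<Rightarrow> (('i \<times> 'g) \<times> ('i \<times> 'g)) set" where
  "dlim_rel I leq G \<phi> =
     {((i, x), (j, y)). i \<in> I \<and> j \<in> I \<and> x \<in> carrier (G i) \<and> y \<in> carrier (G j) \<and>
        (\<exists>k\<in>I. leq i k \<and> leq j k \<and> \<phi> i k x = \<phi> j k y)}"

text \<open>
  The unions below only avoid choosing representatives; for a directed system each of them is a
  union of copies of one equivalence class.
\<close>

definition direct_limit ::
  "'i set \<Rightarrow> ('i \<Rightarrow> 'i \<Rightarrow> bool) \<Rightarrow> ('i \<Rightarrow> ('g, 'm) monoid_scheme) \<Rightarrow> ('i \<Rightarrow> 'i \<Rightarrow> 'g \<Rightarrow> 'g)
    \<Rightarrow> ('i \<times> 'g) set monoid" where
  "direct_limit I leq G \<phi> =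
     \<lparr> carrier = (SIGMA i:I. carrier (G i)) // dlim_rel I leq G \<phi>,
       monoid.mult = (\<lambda>A B. \<Union> {dlim_rel I leq G \<phi> `` {(k, \<phi> i k x \<otimes>\<^bsub>G k\<^esub> \<phi> j k y)} | i x j y k.
                         (i, x) \<in> A \<and> (j, y) \<in> B \<and> k \<in> I \<and> leq i k \<and> leq j k}),
       one = (\<Union>i\<in>I. dlim_rel I leq G \<phi> `` {(i, \<one>\<^bsub>G i\<^esub>)}) \<rparr>"


section \<open>Cech cohomology with integer coefficients\<close>

definition open_covers :: "'a topology \<Rightarrow> 'a set set set" where
  "open_covers X = {\<U>. (\<forall>U\<in>\<U>. openin X U) \<and> \<Union>\<U> = topspace X}"

definition refined_by :: "'a set set \<Rightarrow> 'a set set \<Rightarrow> bool" where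
  "refined_by \<U> \<V> \<longleftrightarrow> (\<forall>V\<in>\<V>. \<exists>U\<in>\<U>. V \<subseteq> U)"

text \<open>Ordered \<open>n\<close>-simplices of the nerve; vertices may be repeated.\<close>

definition nerve :: "'a set set \<Rightarrow> nat \<Rightarrow> 'a set list set" where
  "nerve \<U> n = {us. length us = Suc n \<and> set us \<subseteq> \<U> \<and> \<Inter>(set us) \<noteq> {}}"

definition cochain_group :: "'a set set \<Rightarrow> nat \<Rightarrow> ('a set list \<Rightarrow> int) monoid" where
  "cochain_group \<U> n = product_group (nerve \<U> n) (\<lambda>_. integer_group)"

definition omit_nth :: "nat \<Rightarrow> 'b list \<Rightarrow> 'b list" where
  "omit_nth i us = take i us @ drop (Suc i) us"

definition coboundary :: "'a set set \<Rightarrow> nat \<Rightarrow> ('a set list \<Rightarrow> int) \<Rightarrow> ('a set list \<Rightarrow> int)" where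
  "coboundary \<U> n f = (\<lambda>us\<in>nerve \<U> (Suc n). \<Sum>i\<le>Suc n. (- 1) ^ i * f (omit_nth i us))"

definition cocycle_group :: "'a set set \<Rightarrow> nat \<Rightarrow> ('a set list \<Rightarrow> int) monoid" where
  "cocycle_group \<U> n =
     (cochain_group \<U> n)
       \<lparr>carrier := kernel (cochain_group \<U> n) (cochain_group \<U> (Suc n)) (coboundary \<U> n)\<rparr>"

definition coboundaries :: "'a set set \<Rightarrow> nat \<Rightarrow> ('a set list \<Rightarrow> int) set" where
  "coboundaries \<U> n =
     (case n of
        0 \<Rightarrow> {\<one>\<^bsub>cochain_group \<U> 0\<^esub>}
      | Suc m \<Rightarrow> coboundary \<U> m ` carrier (cochain_group \<U> m))"

definition nerve_cohomology :: "nat \<Rightarrow> 'a set set \<Rightarrow> ('a set list \<Rightarrow> int) set monoid" where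
  "nerve_cohomology n \<U> = cocycle_group \<U> n Mod coboundaries \<U> n"

text \<open>
  A refinement projection sends each member of the finer cover \<open>\<V>\<close> to a member of the coarser
  cover \<open>\<U>\<close> containing it.  Different projections induce contiguous maps of nerves, so the
  induced map on cohomology does not depend on the choice.
\<close>

definition refinement_projection :: "'a set set \<Rightarrow> 'a set set \<Rightarrow> 'a set \<Rightarrow> 'a set" where
  "refinement_projection \<U> \<V> = (SOME p. \<forall>V\<in>\<V>. p V \<in> \<U> \<and> V \<subseteq> p V)"

definition cochain_pullback ::
  "'a set set \<Rightarrow> 'a set set \<Rightarrow> nat \<Rightarrow> ('a set list \<Rightarrow> int) \<Rightarrow> ('a set list \<Rightarrow> int)" where
  "cochain_pullback \<U> \<V> n f =
     (\<lambda>vs\<in>nerve \<V> n. f (map (refinement_projection \<U> \<V>) vs))"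

text \<open>The coset \<open>c + B\<close> is sent to the coset \<open>p\<^sup>* c + B'\<close>.\<close>

definition refinement_map ::
  "nat \<Rightarrow> 'a set set \<Rightarrow> 'a set set \<Rightarrow> ('a set list \<Rightarrow> int) set \<Rightarrow> ('a set list \<Rightarrow> int) set" where
  "refinement_map n \<U> \<V> A =
     coboundaries \<V> n <#>\<^bsub>cocycle_group \<V> n\<^esub> (cochain_pullback \<U> \<V> n ` A)"

definition cech_cohomology ::
  "nat \<Rightarrow> 'a topology \<Rightarrow> ('a set set \<times> ('a set list \<Rightarrow> int) set) set monoid" where
  "cech_cohomology n X =
     direct_limit (open_covers X) refined_by (nerve_cohomology n) (refinement_map n)"


section \<open>Dyadic rationals\<close>

definition dyadic_group :: "rat monoid" where
  "dyadic_group = \<lparr> carrier = {of_int m / 2 ^ k | m k. True}, monoid.mult = (+), one = 0 \<rparr>"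


section \<open>Arrows and the group O(2,Z)\<close>

type_synonym plane = "real \<times> real"

datatype arrow = NE | NW | SW | SE

fun arrow_vec :: "arrow \<Rightarrow> plane" where
  "arrow_vec NE = (1, 1)"
| "arrow_vec NW = (-1, 1)"
| "arrow_vec SW = (-1, -1)"
| "arrow_vec SE = (1, -1)"

lemma inj_arrow_vec: "inj arrow_vec"
proof (rule injI)
  fix a b show "arrow_vec a = arrow_vec b \<Longrightarrow> a = b"
    by (cases a; cases b) auto
qed

definition arrow_act :: "(plane \<Rightarrow> plane) \<Rightarrow> arrow \<Rightarrow> arrow" where
  "arrow_act g a = inv_into UNIV arrow_vec (g (arrow_vec a))"

lemma arrow_act_eqI: "g (arrow_vec a) = arrow_vec b \<Longrightarrow> arrow_act g a = b"
  by (simp add: arrow_act_def inv_f_f[OF inj_arrow_vec])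

definition integer_lattice :: "plane set" where
  "integer_lattice = {(of_int m, of_int n) | m n. True}"

definition O2Z :: "(plane \<Rightarrow> plane) monoid" where
  "O2Z = \<lparr> carrier = {g. orthogonal_transformation g \<and> g ` integer_lattice = integer_lattice},
           monoid.mult = (\<circ>), one = id \<rparr>"

definition reflect_diag :: "plane \<Rightarrow> plane" where
  "reflect_diag p = (snd p, fst p)"

definition reflect_antidiag :: "plane \<Rightarrow> plane" where
  "reflect_antidiag p = (- snd p, - fst p)"

definition H7 :: "(plane \<Rightarrow> plane) set" where
  "H7 = generate O2Z {reflect_diag}"

definition H8 :: "(plane \<Rightarrow> plane) set" where
  "H8 = generate O2Z {reflect_antidiag}"


section \<open>The arrow version of the chair tiling\<close>

text \<open>A tile is encoded by the centre of its square together with its arrow.\<close>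

type_synonym tile = "plane \<times> arrow"

fun square :: "tile \<Rightarrow> plane set" where
  "square (c, a) = cbox (c - (1/2, 1/2)) (c + (1/2, 1/2))"

definition translate :: "plane \<Rightarrow> tile set \<Rightarrow> tile set" where
  "translate v P = (\<lambda>(c, a). (c + v, a)) ` P"

definition act :: "(plane \<Rightarrow> plane) \<Rightarrow> tile set \<Rightarrow> tile set" where
  "act g P = (\<lambda>(c, a). (g c, arrow_act g a)) ` P"

text \<open>The four unit squares of the doubled NE tile, by offset from the centre of the doubled square.\<close>

definition subst_NE :: "tile set" where
  "subst_NE = {((-1/2,  1/2), SE), ((1/2,  1/2), NE),
               ((-1/2, -1/2), NE), ((1/2, -1/2), NW)}"

text \<open>
  The picture for the arrow \<open>a\<close> is the image of the NE picture under an element of O(2,Z) taking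
  NE to \<open>a\<close>.  There are two such elements; they give the same picture (\<open>subst_tile_simps\<close> below).
\<close>

fun subst_tile :: "tile \<Rightarrow> tile set" where
  "subst_tile (c, a) =
     translate (2 *\<^sub>R c) (\<Union>g \<in> {g \<in> carrier O2Z. arrow_act g NE = a}. act g subst_NE)"

definition chair_subst :: "tile set \<Rightarrow> tile set" where
  "chair_subst P = (\<Union>t\<in>P. subst_tile t)"

definition is_tiling :: "tile set \<Rightarrow> bool" where
  "is_tiling T \<longleftrightarrow>
     (\<Union>t\<in>T. square t) = UNIV \<and>
     (\<forall>t\<in>T. \<forall>t'\<in>T. t \<noteq> t' \<longrightarrow>
        interior (square t) \<inter> interior (square t') = {} \<and>
        (square t \<inter> square t') face_of square t)"

definition chair_tilings :: "tile set set" where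
  "chair_tilings =
     {T. is_tiling T \<and>
         (\<forall>P. finite P \<and> P \<subseteq> T \<longrightarrow> (\<exists>v t n. P \<subseteq> translate v ((chair_subst ^^ n) {t})))}"

definition agree_on :: "plane set \<Rightarrow> tile set \<Rightarrow> tile set \<Rightarrow> bool" where
  "agree_on B T T' \<longleftrightarrow> {t\<in>T. square t \<inter> B \<noteq> {}} = {t\<in>T'. square t \<inter> B \<noteq> {}}"

definition tilings_close :: "real \<Rightarrow> tile set \<Rightarrow> tile set \<Rightarrow> bool" where
  "tilings_close \<epsilon> T T' \<longleftrightarrow>
     (\<exists>v w. norm v \<le> \<epsilon> \<and> norm w \<le> \<epsilon> \<and>
        agree_on (cball 0 (1 / \<epsilon>)) (translate v T) (translate w T'))"

definition chair_space :: "tile set topology" where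
  "chair_space = topology (\<lambda>W. W \<subseteq> chair_tilings \<and>
     (\<forall>T\<in>W. \<exists>\<epsilon>>0. \<forall>T'\<in>chair_tilings. tilings_close \<epsilon> T T' \<longrightarrow> T' \<in> W))"

definition fixed_space :: "(plane \<Rightarrow> plane) set \<Rightarrow> tile set topology" where
  "fixed_space H = subtopology chair_space {T \<in> chair_tilings. \<forall>h\<in>H. act h T = T}"


section \<open>Consistency checks\<close>

lemma tilings_close_mono:
  assumes "tilings_close \<delta> T T'" "0 < \<delta>" "\<delta> \<le> \<epsilon>"
  shows "tilings_close \<epsilon> T T'"
proof -
  obtain v w where vw: "norm v \<le> \<delta>" "norm w \<le> \<delta>"
    "agree_on (cball 0 (1 / \<delta>)) (translate v T) (translate w T')"
    using assms(1) unfolding tilings_close_def by blast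
  have "1 / \<epsilon> \<le> 1 / \<delta>"
    using assms(2,3) by (simp add: frac_le)
  then have sub: "cball (0::plane) (1 / \<epsilon>) \<subseteq> cball 0 (1 / \<delta>)"
    by (rule subset_cball)
  have "agree_on (cball 0 (1 / \<epsilon>)) (translate v T) (translate w T')"
    using vw(3) sub unfolding agree_on_def set_eq_iff mem_Collect_eq by blast
  then show ?thesis
    unfolding tilings_close_def using vw(1,2) assms(3) by (meson order_trans)
qed

lemma openin_chair_space:
  "openin chair_space W \<longleftrightarrow> W \<subseteq> chair_tilings \<and>
     (\<forall>T\<in>W. \<exists>\<epsilon>>0. \<forall>T'\<in>chair_tilings. tilings_close \<epsilon> T T' \<longrightarrow> T' \<in> W)"
proof -
  have "istopology (\<lambda>W. W \<subseteq> chair_tilings \<and>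
     (\<forall>T\<in>W. \<exists>\<epsilon>>0. \<forall>T'\<in>chair_tilings. tilings_close \<epsilon> T T' \<longrightarrow> T' \<in> W))"
    (is "istopology ?L")
    unfolding istopology_def
  proof (intro conjI allI impI)
    fix S R assume S: "?L S" and R: "?L R"
    show "S \<inter> R \<subseteq> chair_tilings" using S by blast
    show "\<forall>T\<in>S \<inter> R. \<exists>\<epsilon>>0. \<forall>T'\<in>chair_tilings. tilings_close \<epsilon> T T' \<longrightarrow> T' \<in> S \<inter> R"
    proof
      fix T assume T: "T \<in> S \<inter> R"
      obtain d where d: "d > 0" "\<forall>T'\<in>chair_tilings. tilings_close d T T' \<longrightarrow> T' \<in> S"
        using S T by blast
      obtain e where e: "e > 0" "\<forall>T'\<in>chair_tilings. tilings_close e T T' \<longrightarrow> T' \<in> R"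
        using R T by blast
      have "min d e > 0" using d e by simp
      moreover have "\<forall>T'\<in>chair_tilings. tilings_close (min d e) T T' \<longrightarrow> T' \<in> S \<inter> R"
        using d e tilings_close_mono[of "min d e" T _ d] tilings_close_mono[of "min d e" T _ e]
        by auto
      ultimately show "\<exists>\<epsilon>>0. \<forall>T'\<in>chair_tilings. tilings_close \<epsilon> T T' \<longrightarrow> T' \<in> S \<inter> R"
        by blast
    qed
  next
    fix \<K> assume K: "\<forall>K\<in>\<K>. ?L K"
    show "\<Union>\<K> \<subseteq> chair_tilings" using K by blast
    show "\<forall>T\<in>\<Union>\<K>. \<exists>\<epsilon>>0. \<forall>T'\<in>chair_tilings. tilings_close \<epsilon> T T' \<longrightarrow> T' \<in> \<Union>\<K>"
    proof
      fix T assume "T \<in> \<Union>\<K>"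
      then obtain K where "K \<in> \<K>" "T \<in> K" by blast
      then obtain e where "e > 0" "\<forall>T'\<in>chair_tilings. tilings_close e T T' \<longrightarrow> T' \<in> K"
        using K by blast
      then show "\<exists>\<epsilon>>0. \<forall>T'\<in>chair_tilings. tilings_close \<epsilon> T T' \<longrightarrow> T' \<in> \<Union>\<K>"
        using \<open>K \<in> \<K>\<close> by blast
    qed
  qed
  then show ?thesis
    by (simp add: chair_space_def)
qed

lemma topspace_chair_space: "topspace chair_space = chair_tilings"
proof -
  have "openin chair_space chair_tilings"
    unfolding openin_chair_space using zero_less_one by blast
  then show ?thesis
    by (meson openin_chair_space openin_subset openin_topspace subset_antisym)
qed

lemma arrow_act_rotation:
  "map (arrow_act (\<lambda>p. (- snd p, fst p))) [NE, NW, SW, SE] = [NW, SW, SE, NE]"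
  by (auto intro!: arrow_act_eqI)

lemma arrow_act_reflection_x_axis:
  "map (arrow_act (\<lambda>p. (fst p, - snd p))) [NE, NW, SW, SE] = [SE, SW, NW, NE]"
  by (auto intro!: arrow_act_eqI)

lemma O2Z_carrier:
  "carrier O2Z = {\<lambda>p. (fst p, snd p), \<lambda>p. (- fst p, snd p), \<lambda>p. (fst p, - snd p),
     \<lambda>p. (- fst p, - snd p), \<lambda>p. (snd p, fst p), \<lambda>p. (- snd p, fst p), \<lambda>p. (snd p, - fst p),
     \<lambda>p. (- snd p, - fst p)}" (is "_ = ?R")
proof
  show "carrier O2Z \<subseteq> ?R"
  proof
    fix g assume "g \<in> carrier O2Z"
    then have ot: "orthogonal_transformation g" and im: "g ` integer_lattice = integer_lattice"
      by (auto simp: O2Z_def)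
    have lin: "linear g" and nrm: "\<And>v. norm (g v) = norm v"
      using ot orthogonal_transformation by auto
    have lat: "(1, 0) \<in> integer_lattice" "(0, 1) \<in> integer_lattice"
      unfolding integer_lattice_def
      by (auto intro: exI[of _ "1::int"] exI[of _ "0::int"])
    obtain a b where ab: "g (1, 0) = (of_int a, of_int b)"
      using im lat unfolding integer_lattice_def by blast
    obtain c d where cd: "g (0, 1) = (of_int c, of_int d)"
      using im lat unfolding integer_lattice_def by blast
    have sq: "x\<^sup>2 + y\<^sup>2 = 1 \<Longrightarrow> (x = 0 \<and> (y = 1 \<or> y = -1)) \<or> (y = 0 \<and> (x = 1 \<or> x = -1))"
      for x y :: int
    proof -
      assume h: "x\<^sup>2 + y\<^sup>2 = 1"
      show ?thesis
      proof (cases "x = 0")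
        case True then show ?thesis using h by (simp add: power2_eq_1_iff)
      next
        case False
        then have "x\<^sup>2 \<ge> 1" by (metis int_one_le_iff_zero_less zero_less_power2)
        then have "y\<^sup>2 \<le> 0" using h by linarith
        then have "y = 0" by simp
        then show ?thesis using h by (simp add: power2_eq_1_iff)
      qed
    qed
    have "a\<^sup>2 + b\<^sup>2 = 1"
    proof -
      have "sqrt ((real_of_int a)\<^sup>2 + (real_of_int b)\<^sup>2) = 1"
        using nrm[of "(1, 0)"] ab by (simp add: norm_Pair)
      then have "real_of_int (a\<^sup>2 + b\<^sup>2) = real_of_int 1" by (simp add: real_sqrt_eq_1_iff)
      then show ?thesis by (simp only: of_int_eq_iff)
    qed
    note A = sq[OF this]
    have "c\<^sup>2 + d\<^sup>2 = 1"
    proof -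
      have "sqrt ((real_of_int c)\<^sup>2 + (real_of_int d)\<^sup>2) = 1"
        using nrm[of "(0, 1)"] cd by (simp add: norm_Pair)
      then have "real_of_int (c\<^sup>2 + d\<^sup>2) = real_of_int 1" by (simp add: real_sqrt_eq_1_iff)
      then show ?thesis by (simp only: of_int_eq_iff)
    qed
    note C = sq[OF this]
    have "g (1, 0) \<bullet> g (0, 1) = (1, 0) \<bullet> ((0, 1)::plane)"
      using ot unfolding orthogonal_transformation_def by blast
    then have "real_of_int (a * c + b * d) = real_of_int 0"
      by (simp add: ab cd)
    then have orth: "a * c + b * d = 0" by (simp only: of_int_eq_iff)
    have gp: "g p = (fst p * real_of_int a + snd p * real_of_int c,
        fst p * real_of_int b + snd p * real_of_int d)" for p
    proof -
      have "g p = g (fst p *\<^sub>R (1, 0) + snd p *\<^sub>R (0, 1))" by simp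
      also have "\<dots> = fst p *\<^sub>R g (1, 0) + snd p *\<^sub>R g (0, 1)"
        by (simp only: linear_add[OF lin] linear_scale[OF lin])
      finally show ?thesis by (simp add: ab cd)
    qed
    then have geq: "g = (\<lambda>p. (fst p * real_of_int a + snd p * real_of_int c,
        fst p * real_of_int b + snd p * real_of_int d))" by blast
    from A C orth show "g \<in> ?R" unfolding geq
      by (elim disjE conjE) simp_all
  qed
next
  have sub: "g p \<in> integer_lattice" if gR: "g \<in> ?R" and pL: "p \<in> integer_lattice" for g p
  proof -
    have mem: "(of_int m, of_int n) \<in> integer_lattice" for m n
      unfolding integer_lattice_def by blast
    obtain m n where p: "p = (of_int m, of_int n)"
      using pL unfolding integer_lattice_def by blast
    show ?thesis
      using gR mem[of m n] mem[of "-m" n] mem[of m "-n"] mem[of "-m" "-n"]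
        mem[of n m] mem[of "-n" m] mem[of n "-m"] mem[of "-n" "-m"]
      unfolding p by auto
  qed
  have inv: "\<exists>h\<in>?R. \<forall>p. g (h p) = p" if "g \<in> ?R" for g
    using that by (elim insertE emptyE) simp_all
  have lin: "linear g" if "g \<in> ?R" for g
    using that by (elim insertE emptyE) (auto intro!: linearI)
  have nrm: "norm (g v) = norm v" if "g \<in> ?R" for g v
    using that by (elim insertE emptyE) (simp_all add: norm_prod_def add.commute)
  show "?R \<subseteq> carrier O2Z"
  proof
    fix g assume g: "g \<in> ?R"
    obtain h where h: "h \<in> ?R" "\<And>p. g (h p) = p" using inv[OF g] by blast
    have "g ` integer_lattice = integer_lattice"
    proof
      show "g ` integer_lattice \<subseteq> integer_lattice" using sub[OF g] by blast
      show "integer_lattice \<subseteq> g ` integer_lattice"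
      proof
        fix q assume "q \<in> integer_lattice"
        then have "h q \<in> integer_lattice" by (rule sub[OF h(1)])
        then show "q \<in> g ` integer_lattice" using h(2)[of q] by (metis imageI)
      qed
    qed
    then show "g \<in> carrier O2Z"
      using lin[OF g] nrm[OF g] by (simp add: O2Z_def orthogonal_transformation)
  qed
qed

lemma group_O2Z: "group O2Z"
proof (rule groupI)
  fix x y assume "x \<in> carrier O2Z" "y \<in> carrier O2Z"
  then have "orthogonal_transformation (x \<circ> y)"
    and "(x \<circ> y) ` integer_lattice = integer_lattice"
    unfolding image_comp [symmetric]
    by (auto simp: O2Z_def intro: orthogonal_transformation_compose)
  then show "x \<otimes>\<^bsub>O2Z\<^esub> y \<in> carrier O2Z"
    by (simp add: O2Z_def del: o_apply)
next
  show "\<one>\<^bsub>O2Z\<^esub> \<in> carrier O2Z"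
    by (simp add: O2Z_def orthogonal_transformation_id id_def)
next
  fix x assume x: "x \<in> carrier O2Z"
  show "\<exists>y\<in>carrier O2Z. y \<otimes>\<^bsub>O2Z\<^esub> x = \<one>\<^bsub>O2Z\<^esub>"
  proof
    have ot: "orthogonal_transformation x" and im: "x ` integer_lattice = integer_lattice"
      using x by (auto simp: O2Z_def)
    have inj: "inj x" using ot by (rule orthogonal_transformation_inj)
    have "inv_into UNIV x ` integer_lattice = integer_lattice"
      by (metis im image_inv_f_f inj)
    then show "inv_into UNIV x \<in> carrier O2Z"
      using ot by (simp add: O2Z_def orthogonal_transformation_inv)
    show "inv_into UNIV x \<otimes>\<^bsub>O2Z\<^esub> x = \<one>\<^bsub>O2Z\<^esub>"
      using inj by (simp add: O2Z_def)
  qed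
qed (auto simp: O2Z_def)

lemma generate_involution:
  assumes r: "r \<in> carrier O2Z" and inv: "r \<circ> r = id"
  shows "generate O2Z {r} = {id, r}"
proof -
  interpret group O2Z by (rule group_O2Z)
  have one: "\<one>\<^bsub>O2Z\<^esub> = id" and mult: "x \<otimes>\<^bsub>O2Z\<^esub> y = x \<circ> y" for x y
    by (simp_all add: O2Z_def)
  have r1: "r \<otimes>\<^bsub>O2Z\<^esub> r = \<one>\<^bsub>O2Z\<^esub>" using inv by (simp only: one mult)
  have i: "inv\<^bsub>O2Z\<^esub> r = r" using inv_equality[OF r1 r r] .
  show ?thesis
  proof
    show "generate O2Z {r} \<subseteq> {id, r}"
    proof
      fix x assume "x \<in> generate O2Z {r}"
      then show "x \<in> {id, r}"
        by induction (auto simp only: i inv one mult insert_iff empty_iff id_comp comp_id)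
    qed
    show "{id, r} \<subseteq> generate O2Z {r}"
      using generate.one[of O2Z "{r}"] generate.incl[of r "{r}" O2Z] by (simp add: O2Z_def)
  qed
qed

lemma H7_eq: "H7 = {id, reflect_diag}"
  unfolding H7_def
  by (rule generate_involution) (auto simp: O2Z_carrier reflect_diag_def fun_eq_iff)

lemma H8_eq: "H8 = {id, reflect_antidiag}"
  unfolding H8_def
  by (rule generate_involution) (auto simp: O2Z_carrier reflect_antidiag_def fun_eq_iff)

lemma subst_tile_simps:
  "subst_tile (c, NE) = translate (2 *\<^sub>R c)
     {((-1/2, 1/2), SE), ((1/2, 1/2), NE), ((-1/2, -1/2), NE), ((1/2, -1/2), NW)}"
  "subst_tile (c, NW) = translate (2 *\<^sub>R c)
     {((-1/2, 1/2), NW), ((1/2, 1/2), SW), ((-1/2, -1/2), NE), ((1/2, -1/2), NW)}"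
  "subst_tile (c, SW) = translate (2 *\<^sub>R c)
     {((-1/2, 1/2), SE), ((1/2, 1/2), SW), ((-1/2, -1/2), SW), ((1/2, -1/2), NW)}"
  "subst_tile (c, SE) = translate (2 *\<^sub>R c)
     {((-1/2, 1/2), SE), ((1/2, 1/2), SW), ((-1/2, -1/2), NE), ((1/2, -1/2), SE)}"
proof -
  have act_inv: "inv_into UNIV arrow_vec (1, 1) = NE" "inv_into UNIV arrow_vec (-1, 1) = NW"
    "inv_into UNIV arrow_vec (-1, -1) = SW" "inv_into UNIV arrow_vec (1, -1) = SE"
    by (simp_all add: inv_f_eq[OF inj_arrow_vec])
  have Un: "(\<Union>g \<in> {g \<in> insert x A. P g}. F g) =
      (if P x then F x else {}) \<union> (\<Union>g \<in> {g \<in> A. P g}. F g)"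
    for x A P and F :: "(plane \<Rightarrow> plane) \<Rightarrow> tile set" by auto
  show "subst_tile (c, NE) = translate (2 *\<^sub>R c)
     {((-1/2, 1/2), SE), ((1/2, 1/2), NE), ((-1/2, -1/2), NE), ((1/2, -1/2), NW)}"
    "subst_tile (c, NW) = translate (2 *\<^sub>R c)
     {((-1/2, 1/2), NW), ((1/2, 1/2), SW), ((-1/2, -1/2), NE), ((1/2, -1/2), NW)}"
    "subst_tile (c, SW) = translate (2 *\<^sub>R c)
     {((-1/2, 1/2), SE), ((1/2, 1/2), SW), ((-1/2, -1/2), SW), ((1/2, -1/2), NW)}"
    "subst_tile (c, SE) = translate (2 *\<^sub>R c)
     {((-1/2, 1/2), SE), ((1/2, 1/2), SW), ((-1/2, -1/2), NE), ((1/2, -1/2), SE)}"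
    unfolding subst_tile.simps O2Z_carrier Un
    by (simp_all add: arrow_act_def act_inv act_def subst_NE_def insert_commute)
qed

text \<open>The dyadic rationals are the direct limit of multiplication by 2 on the integers.\<close>

lemma dyadic_direct_limit:
  "direct_limit (UNIV :: nat set) (\<le>) (\<lambda>_. integer_group) (\<lambda>i j x. 2 ^ (j - i) * x)
     \<cong> dyadic_group"
proof -
  define \<phi> :: "nat \<Rightarrow> nat \<Rightarrow> int \<Rightarrow> int" where "\<phi> = (\<lambda>i j x. 2 ^ (j - i) * x)"
  define val :: "nat \<times> int \<Rightarrow> rat" where "val = (\<lambda>(i, x). of_int x / 2 ^ i)"
  define R where "R = dlim_rel (UNIV :: nat set) (\<le>) (\<lambda>_. integer_group) \<phi>"
  define D where "D = direct_limit (UNIV :: nat set) (\<le>) (\<lambda>_. integer_group) \<phi>"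
  have val_phi: "val (k, \<phi> i k x) = val (i, x)" if "i \<le> k" for i k x
  proof -
    have "(2::rat) ^ k = 2 ^ (k - i) * 2 ^ i" using that by (simp flip: power_add)
    then show ?thesis by (simp add: val_def \<phi>_def)
  qed
  have val_inj: "x = y" if "val (k, x) = val (k, y)" for k x y
    using that by (simp add: val_def)
  have R_iff: "(p, q) \<in> R \<longleftrightarrow> val p = val q" for p q
  proof -
    obtain i x j y where p: "p = (i, x)" and q: "q = (j, y)" by (cases p; cases q) auto
    have "(p, q) \<in> R \<longleftrightarrow> (\<exists>k. i \<le> k \<and> j \<le> k \<and> \<phi> i k x = \<phi> j k y)"
      by (simp add: R_def dlim_rel_def p q integer_group_def)
    also have "\<dots> \<longleftrightarrow> val p = val q"
    proof
      assume "\<exists>k. i \<le> k \<and> j \<le> k \<and> \<phi> i k x = \<phi> j k y"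
      then show "val p = val q" using val_phi p q by metis
    next
      assume "val p = val q"
      then have "\<phi> i (max i j) x = \<phi> j (max i j) y"
        using val_phi[of i "max i j" x] val_phi[of j "max i j" y]
          val_inj[of "max i j" "\<phi> i (max i j) x" "\<phi> j (max i j) y"] p q by simp
      then show "\<exists>k. i \<le> k \<and> j \<le> k \<and> \<phi> i k x = \<phi> j k y"
        by (intro exI[of _ "max i j"]) simp
    qed
    finally show ?thesis .
  qed
  have cls: "R `` {p} = {q. val q = val p}" for p
    by (auto simp: R_iff)
  have carr: "carrier D = range (\<lambda>p. {q. val q = val p})"
    by (auto simp: D_def direct_limit_def quotient_def R_def [symmetric] cls)
  have multD: "A \<otimes>\<^bsub>D\<^esub> B = \<Union> {R `` {(k, \<phi> i k x + \<phi> j k y)} | i x j y k.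
                  (i, x) \<in> A \<and> (j, y) \<in> B \<and> i \<le> k \<and> j \<le> k}" for A B
    by (simp add: D_def direct_limit_def integer_group_def R_def)
  have val_add: "val (k, x + y) = val (k, x) + val (k, y)" for k x y
    by (simp add: val_def add_divide_distrib)
  have mult: "{q. val q = val a} \<otimes>\<^bsub>D\<^esub> {q. val q = val b} = {q. val q = val a + val b}" for a b
  proof -
    have eq: "R `` {(k, \<phi> i k x + \<phi> j k y)} = {q. val q = val a + val b}"
      if "val (i, x) = val a" "val (j, y) = val b" "i \<le> k" "j \<le> k" for i x j y k
      by (simp add: cls val_add val_phi that)
    obtain i x j y where ab: "a = (i, x)" "b = (j, y)" by (cases a; cases b) auto
    have "{R `` {(k, \<phi> i k x + \<phi> j k y)} | i x j y k.
        (i, x) \<in> {q. val q = val a} \<and> (j, y) \<in> {q. val q = val b} \<and> i \<le> k \<and> j \<le> k}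
        = {{q. val q = val a + val b}}" (is "?L = ?R")
    proof
      show "?L \<subseteq> ?R" by (clarsimp simp only: mem_Collect_eq singleton_iff eq)
      have "{q. val q = val a + val b} = R `` {(max i j, \<phi> i (max i j) x + \<phi> j (max i j) y)}"
        using eq[of i x j y "max i j"] ab by simp
      then show "?R \<subseteq> ?L" using ab by fastforce
    qed
    then show ?thesis by (simp add: multD)
  qed
  define h where "h = (\<lambda>A. THE r. \<forall>q\<in>A. val q = r)"
  have h: "h {q. val q = val p} = val p" for p
    unfolding h_def by (rule the_equality, simp, metis mem_Collect_eq)
  have range: "range val = carrier dyadic_group"
    by (auto simp: dyadic_group_def val_def)
  have "h \<in> iso D dyadic_group"
  proof (rule isoI)
    show "h \<in> hom D dyadic_group"
    proof (rule homI)
      fix A assume "A \<in> carrier D"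
      then show "h A \<in> carrier dyadic_group" using carr h range by auto
    next
      fix A B assume "A \<in> carrier D" "B \<in> carrier D"
      then obtain a b where A: "A = {q. val q = val a}" and B: "B = {q. val q = val b}"
        using carr by auto
      obtain i x j y where ab: "a = (i, x)" "b = (j, y)" by (cases a; cases b) auto
      define c where "c = (max i j, \<phi> i (max i j) x + \<phi> j (max i j) y)"
      have c: "val c = val a + val b" by (simp add: c_def val_add val_phi ab)
      have "h (A \<otimes>\<^bsub>D\<^esub> B) = val a + val b"
        unfolding A B mult c [symmetric] by (rule h)
      then show "h (A \<otimes>\<^bsub>D\<^esub> B) = h A \<otimes>\<^bsub>dyadic_group\<^esub> h B"
        by (simp add: A B h dyadic_group_def)
    qed
    show "bij_betw h (carrier D) (carrier dyadic_group)"
      unfolding bij_betw_def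
    proof
      show "inj_on h (carrier D)" by (auto simp: inj_on_def carr h)
      show "h ` carrier D = carrier dyadic_group"
        unfolding carr image_image h range ..
    qed
  qed
  then show ?thesis
    unfolding D_def \<phi>_def by (rule is_isoI)
qed

end

theory Submission
  imports Defs
begin

text \<open>
  Along the diagonal the substitution doubles an NE or SW tile into two tiles with the same arrow,
  and the arrows off the diagonal can be read from the binary digits of the position in the
  hierarchy. A tiling symmetric about the diagonal is therefore determined by a 2-adic position along
  the diagonal and the arrows on it. Legality allows only: all NE, all SW, or a single change from SW
  to NE at a vertex from which four infinite-order supertiles point away. The translates of the last tiling form a line whose two ends wind around the two
  dyadic solenoids of the first two kinds. Hence the space is the inverse limit of a dumbbell, two
  circles joined by an arc, under a map that doubles both circles. The inverse images of open vertex
  stars of ever finer dumbbells are a cofinal sequence of covers; a 1-cocycle on such a cover is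
  classified by its sums around the two circles, which double under refinement.
\<close>

section \<open>Direct limits of quotient systems\<close>

text \<open>The Cech definition runs over all open covers, with refinement projections picked by
  \<open>SOME\<close>, so pullbacks compose only up to coboundaries. Each cocycle on any cover is
  therefore evaluated directly in the target group, after pulling it back to some dumbbell cover;
  cofinality makes this possible. Legality is freed from the substitution: a finite patch is legal
  iff it occurs in one self-similar labelling of the plane, so the combinatorics concerns the
  integer function \<open>chair\<close> alone. Level n uses circles of length 2^n and mesh 2^-n,
  hence 4^n vertices on each circle. The next level halves the mesh and doubles the circles at once:
  label a at level n + 1 refines label a div 2 at level n, and one turn of the finer circle covers
  two turns of the coarser one. Windings divided by 2^n are thus compatible, one dyadic factor for
  each circle, while the arc contributes no loop and keeps the nerve connected. Cofinality is a
  Lebesgue number argument in which compactness is that of bounded representatives of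
  threads.\<close>

lemma in_rcos_iff:
  assumes "comm_group G" "subgroup B G" "z \<in> carrier G" "w \<in> carrier G"
  shows "w \<in> B #>\<^bsub>G\<^esub> z \<longleftrightarrow> w \<otimes>\<^bsub>G\<^esub> inv\<^bsub>G\<^esub> z \<in> B"
proof -
  interpret comm_group G by fact
  interpret subgroup B G by fact
  show ?thesis
    using rcos_module[OF is_group assms(3,4)] .
qed

locale quotient_system =
  fixes I :: "'i set" and leq :: "'i \<Rightarrow> 'i \<Rightarrow> bool" and Z :: "'i \<Rightarrow> ('g, 'm) monoid_scheme"
    and B :: "'i \<Rightarrow> 'g set" and p :: "'i \<Rightarrow> 'i \<Rightarrow> 'g \<Rightarrow> 'g"
    and J :: "nat \<Rightarrow> 'i" and K :: "('k, 'n) monoid_scheme" and E :: "nat \<Rightarrow> 'g \<Rightarrow> 'k"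
  assumes Z_group: "i \<in> I \<Longrightarrow> comm_group (Z i)"
    and B_subgroup: "i \<in> I \<Longrightarrow> subgroup (B i) (Z i)"
    and leq_trans: "leq i j \<Longrightarrow> leq j k \<Longrightarrow> leq i k"
    and p_hom: "i \<in> I \<Longrightarrow> j \<in> I \<Longrightarrow> leq i j \<Longrightarrow> p i j \<in> hom (Z i) (Z j)"
    and p_B: "i \<in> I \<Longrightarrow> j \<in> I \<Longrightarrow> leq i j \<Longrightarrow> b \<in> B i \<Longrightarrow> p i j b \<in> B j"
    and p_comp: "i \<in> I \<Longrightarrow> j \<in> I \<Longrightarrow> k \<in> I \<Longrightarrow> leq i j \<Longrightarrow> leq j k \<Longrightarrow> z \<in> carrier (Z i)
                  \<Longrightarrow> p j k (p i j z) \<in> B k #>\<^bsub>Z k\<^esub> p i k z"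
    and J_in: "J n \<in> I"
    and J_cofinal: "i \<in> I \<Longrightarrow> \<exists>n. leq i (J n)"
    and J_step: "leq (J n) (J (Suc n))"
    and K_group: "group K"
    and E_hom: "E n \<in> hom (Z (J n)) K"
    and E_kernel: "z \<in> carrier (Z (J n)) \<Longrightarrow> E n z = \<one>\<^bsub>K\<^esub> \<longleftrightarrow> z \<in> B (J n)"
    and E_step: "z \<in> carrier (Z (J n)) \<Longrightarrow> E (Suc n) (p (J n) (J (Suc n)) z) = E n z"
    and E_surj: "y \<in> carrier K \<Longrightarrow> \<exists>n. \<exists>z\<in>carrier (Z (J n)). E n z = y"
begin

lemma p_closed:
  "i \<in> I \<Longrightarrow> j \<in> I \<Longrightarrow> leq i j \<Longrightarrow> z \<in> carrier (Z i) \<Longrightarrow> p i j z \<in> carrier (Z j)"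
  using p_hom[of i j] by (auto simp: hom_def)

lemma E_eq_iff:
  assumes "z \<in> carrier (Z (J n))" "w \<in> carrier (Z (J n))"
  shows "E n w = E n z \<longleftrightarrow> w \<in> B (J n) #>\<^bsub>Z (J n)\<^esub> z"
proof -
  interpret Z: comm_group "Z (J n)" by (rule Z_group[OF J_in])
  interpret K: group K by (rule K_group)
  interpret h: group_hom "Z (J n)" K "E n"
    by unfold_locales (rule E_hom)
  have "E n w = E n z \<longleftrightarrow> E n (w \<otimes>\<^bsub>Z (J n)\<^esub> inv\<^bsub>Z (J n)\<^esub> z) = \<one>\<^bsub>K\<^esub>"
    using assms by (simp add: K.right_cancel K.inv_solve_right')
  also have "\<dots> \<longleftrightarrow> w \<in> B (J n) #>\<^bsub>Z (J n)\<^esub> z"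
    using assms E_kernel in_rcos_iff[OF Z_group[OF J_in] B_subgroup[OF J_in]] by (metis Z.inv_closed Z.m_closed)
  finally show ?thesis .
qed

section \<open>Evaluation at an arbitrary index through the cofinal sequence\<close>

definition level :: "'i \<Rightarrow> nat" where
  "level i = (LEAST n. leq i (J n))"

definition ev :: "'i \<Rightarrow> 'g \<Rightarrow> 'k" where
  "ev i z = E (level i) (p i (J (level i)) z)"

lemma leq_J_mono:
  assumes "leq i (J n)" "n \<le> m" shows "leq i (J m)"
  using assms(2,1) by (induction rule: dec_induct) (auto intro: leq_trans J_step)

lemma leq_level: "i \<in> I \<Longrightarrow> leq i (J (level i))"
  unfolding level_def using J_cofinal[of i] by (auto intro: LeastI)

text \<open>Pulling back one step further alters the cocycle by an element of \<open>B\<close>,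
  which \<open>E\<close> does not see, and \<open>E_step\<close> absorbs the step; so every level of
  the sequence gives the same value.\<close>

lemma ev_eq:
  assumes i: "i \<in> I" and n: "leq i (J n)" and z: "z \<in> carrier (Z i)"
  shows "ev i z = E n (p i (J n) z)"
proof -
  have le: "level i \<le> n" unfolding level_def by (rule Least_le) (rule n)
  then show ?thesis
  proof (induction rule: dec_induct)
    case base then show ?case by (simp add: ev_def)
  next
    case (step m)
    have lm: "leq i (J m)" using leq_J_mono[OF leq_level[OF i] step.hyps(1)] .
    have ls: "leq i (J (Suc m))" using leq_trans[OF lm J_step] .
    have c: "p (J m) (J (Suc m)) (p i (J m) z) \<in> B (J (Suc m)) #>\<^bsub>Z (J (Suc m))\<^esub> p i (J (Suc m)) z"
      by (rule p_comp[OF i J_in J_in lm J_step z])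
    have "E (Suc m) (p (J m) (J (Suc m)) (p i (J m) z)) = E (Suc m) (p i (J (Suc m)) z)"
      using c E_eq_iff p_closed i J_in lm ls J_step z by metis
    then show ?case
      using step.IH E_step p_closed[OF i J_in lm z] by simp
  qed
qed

lemma ev_hom:
  assumes i: "i \<in> I" and z: "z \<in> carrier (Z i)" "w \<in> carrier (Z i)"
  shows "ev i (z \<otimes>\<^bsub>Z i\<^esub> w) = ev i z \<otimes>\<^bsub>K\<^esub> ev i w"
proof -
  have l: "leq i (J (level i))" by (rule leq_level[OF i])
  show ?thesis
    unfolding ev_def using p_hom[OF i J_in l] E_hom[of "level i"] z by (simp add: hom_def Pi_def)
qed

lemma ev_closed:
  assumes i: "i \<in> I" and z: "z \<in> carrier (Z i)"
  shows "ev i z \<in> carrier K"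
proof -
  have l: "leq i (J (level i))" by (rule leq_level[OF i])
  show ?thesis
    unfolding ev_def using p_closed[OF i J_in l z] E_hom[of "level i"] by (auto simp add: hom_def)
qed

lemma ev_B:
  assumes i: "i \<in> I" and b: "b \<in> B i"
  shows "ev i b = \<one>\<^bsub>K\<^esub>"
proof -
  have l: "leq i (J (level i))" by (rule leq_level[OF i])
  have "b \<in> carrier (Z i)" using B_subgroup[OF i] b by (rule subgroup.mem_carrier)
  then show ?thesis
    unfolding ev_def using p_B[OF i J_in l b] E_kernel p_closed[OF i J_in l] by blast
qed

lemma ev_p:
  assumes i: "i \<in> I" and j: "j \<in> I" and l: "leq i j" and z: "z \<in> carrier (Z i)"
  shows "ev j (p i j z) = ev i z"
proof -
  define n where "n = level j"
  have jn: "leq j (J n)" unfolding n_def by (rule leq_level[OF j])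
  have "in": "leq i (J n)" by (rule leq_trans[OF l jn])
  have "E n (p j (J n) (p i j z)) = E n (p i (J n) z)"
    using p_comp[OF i j J_in l jn z] E_eq_iff p_closed i j J_in l jn "in" z by metis
  then show ?thesis
    using ev_eq[OF i "in" z] ev_eq[OF j jn p_closed[OF i j l z]] by simp
qed

lemma ev_coset:
  assumes i: "i \<in> I" and z: "z \<in> carrier (Z i)" and w: "w \<in> B i #>\<^bsub>Z i\<^esub> z"
  shows "ev i w = ev i z"
proof -
  interpret K: group K by (rule K_group)
  obtain b where b: "b \<in> B i" "w = b \<otimes>\<^bsub>Z i\<^esub> z" using w by (auto simp: r_coset_def)
  have "b \<in> carrier (Z i)" using B_subgroup[OF i] b(1) by (rule subgroup.mem_carrier)
  then show ?thesis using ev_hom[OF i _ z] ev_B[OF i b(1)] ev_closed[OF i z] b by simp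
qed

abbreviation coset where "coset i z \<equiv> B i #>\<^bsub>Z i\<^esub> z"
abbreviation Q where "Q i \<equiv> Z i Mod B i"
abbreviation \<phi> where "\<phi> i j A \<equiv> B j <#>\<^bsub>Z j\<^esub> (p i j ` A)"

lemma carrier_Q: "carrier (Q i) = (\<lambda>z. coset i z) ` carrier (Z i)"
  by (auto simp: FactGroup_def RCOSETS_def)

lemma \<phi>_coset:
  assumes i: "i \<in> I" and j: "j \<in> I" and l: "leq i j" and z: "z \<in> carrier (Z i)"
  shows "\<phi> i j (coset i z) = coset j (p i j z)"
proof -
  interpret Zj: comm_group "Z j" by (rule Z_group[OF j])
  interpret Zi: comm_group "Z i" by (rule Z_group[OF i])
  interpret Bj: subgroup "B j" "Z j" by (rule B_subgroup[OF j])
  interpret Bi: subgroup "B i" "Z i" by (rule B_subgroup[OF i])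
  have pz: "p i j z \<in> carrier (Z j)" by (rule p_closed[OF i j l z])
  have mult: "p i j (b \<otimes>\<^bsub>Z i\<^esub> z) = p i j b \<otimes>\<^bsub>Z j\<^esub> p i j z" if "b \<in> B i" for b
    using p_hom[OF i j l] Bi.mem_carrier[OF that] z by (simp add: hom_def)
  show ?thesis
  proof
    show "\<phi> i j (coset i z) \<subseteq> coset j (p i j z)"
    proof
      fix y assume "y \<in> \<phi> i j (coset i z)"
      then obtain b b' where bb: "b \<in> B i" "b' \<in> B j" "y = b' \<otimes>\<^bsub>Z j\<^esub> p i j (b \<otimes>\<^bsub>Z i\<^esub> z)"
        by (auto simp: set_mult_def r_coset_def)
      have "y = (b' \<otimes>\<^bsub>Z j\<^esub> p i j b) \<otimes>\<^bsub>Z j\<^esub> p i j z"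
        using bb mult p_B[OF i j l bb(1)] pz by (simp add: Zj.m_assoc)
      moreover have "b' \<otimes>\<^bsub>Z j\<^esub> p i j b \<in> B j" using bb p_B[OF i j l bb(1)] by simp
      ultimately show "y \<in> coset j (p i j z)" by (auto simp: r_coset_def)
    qed
    have "z \<in> coset i z" using Zi.rcos_self[OF z] Bi.subgroup_axioms by blast
    then show "coset j (p i j z) \<subseteq> \<phi> i j (coset i z)"
      unfolding set_mult_def r_coset_def[of "Z j"] by blast
  qed
qed

lemma Q_mult:
  assumes i: "i \<in> I" and z: "z \<in> carrier (Z i)" "w \<in> carrier (Z i)"
  shows "(coset i z) \<otimes>\<^bsub>Q i\<^esub> (coset i w) = coset i (z \<otimes>\<^bsub>Z i\<^esub> w)"
proof -
  interpret Z: comm_group "Z i" by (rule Z_group[OF i])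
  interpret n: normal "B i" "Z i" using Z.normal_iff_subgroup B_subgroup[OF i] by simp
  show ?thesis using n.rcos_sum z by (simp add: FactGroup_def)
qed

section \<open>Classes of the limit and their values in \<open>K\<close>\<close>

definition val :: "'i \<times> 'g set \<Rightarrow> 'k" where
  "val q = ev (fst q) (SOME z. z \<in> snd q)"

abbreviation "R \<equiv> dlim_rel I leq Q \<phi>"
abbreviation "D \<equiv> direct_limit I leq Q \<phi>"
abbreviation "P \<equiv> SIGMA i:I. carrier (Q i)"

lemma val_coset:
  assumes i: "i \<in> I" and z: "z \<in> carrier (Z i)"
  shows "val (i, coset i z) = ev i z"
proof -
  interpret Z: comm_group "Z i" by (rule Z_group[OF i])
  have "z \<in> coset i z" using Z.rcos_self[OF z] B_subgroup[OF i] by blast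
  then have "(SOME w. w \<in> coset i z) \<in> coset i z" by (rule someI)
  then show ?thesis unfolding val_def using ev_coset[OF i z] by simp
qed

lemma P_cases:
  assumes "q \<in> P"
  shows "\<exists>i z. i \<in> I \<and> z \<in> carrier (Z i) \<and> q = (i, coset i z)"
  using assms by (auto simp: carrier_Q)

lemma coset_in_Q: "z \<in> carrier (Z i) \<Longrightarrow> coset i z \<in> carrier (Q i)"
  by (auto simp: carrier_Q)

text \<open>Two elements with equal value are moved to a common \<open>J n\<close>; there
  \<open>E n\<close> is injective modulo \<open>B\<close>, so their cosets already coincide.
  Conversely the value is invariant under \<open>p\<close>.\<close>

lemma R_iff: "(q, r) \<in> R \<longleftrightarrow> q \<in> P \<and> r \<in> P \<and> val q = val r"
proof
  assume "(q, r) \<in> R"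
  then obtain k where qr: "q \<in> P" "r \<in> P" and k: "k \<in> I" "leq (fst q) k" "leq (fst r) k"
    "\<phi> (fst q) k (snd q) = \<phi> (fst r) k (snd r)"
    by (auto simp: dlim_rel_def)
  from qr obtain i z j w where q: "i \<in> I" "z \<in> carrier (Z i)" "q = (i, coset i z)"
    and r: "j \<in> I" "w \<in> carrier (Z j)" "r = (j, coset j w)"
    using P_cases[of q] P_cases[of r] by blast
  have "coset k (p i k z) = coset k (p j k w)"
    using k q r \<phi>_coset by simp
  then have "val (k, coset k (p i k z)) = val (k, coset k (p j k w))" by simp
  then have "ev k (p i k z) = ev k (p j k w)"
    using k q r by (simp add: val_coset p_closed)
  then show "q \<in> P \<and> r \<in> P \<and> val q = val r"
    using qr q r k by (simp add: ev_p val_coset)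
next
  assume a: "q \<in> P \<and> r \<in> P \<and> val q = val r"
  then obtain i z j w where q: "i \<in> I" "z \<in> carrier (Z i)" "q = (i, coset i z)"
    and r: "j \<in> I" "w \<in> carrier (Z j)" "r = (j, coset j w)"
    using P_cases[of q] P_cases[of r] by blast
  define n where "n = max (level i) (level j)"
  have l: "leq i (J n)" "leq j (J n)"
    using leq_J_mono[OF leq_level[OF q(1)]] leq_J_mono[OF leq_level[OF r(1)]] by (simp_all add: n_def)
  interpret Z: comm_group "Z (J n)" by (rule Z_group[OF J_in])
  have "E n (p i (J n) z) = E n (p j (J n) w)"
    using a q r l by (simp add: val_coset ev_eq)
  then have "p i (J n) z \<in> coset (J n) (p j (J n) w)"
    using E_eq_iff p_closed q r l J_in by metis
  then have "coset (J n) (p i (J n) z) = coset (J n) (p j (J n) w)"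
    using Z.repr_independence p_closed[OF r(1) J_in l(2) r(2)] B_subgroup[OF J_in] by metis
  then show "(q, r) \<in> R"
    using q r l J_in[of n] \<phi>_coset coset_in_Q by (auto simp: dlim_rel_def intro!: bexI[of _ "J n"])
qed

lemma class_eq: "q \<in> P \<Longrightarrow> R `` {q} = {r \<in> P. val r = val q}"
  by (auto simp: R_iff)

lemma carrier_D: "carrier D = (\<lambda>q. {r \<in> P. val r = val q}) ` P"
proof -
  have "carrier D = (\<lambda>q. R `` {q}) ` P" by (auto simp: direct_limit_def quotient_def)
  then show ?thesis using class_eq by (simp cong: image_cong)
qed

lemma \<phi>_P:
  assumes q: "q \<in> P" and r: "r \<in> P" and k: "k \<in> I" "leq (fst q) k" "leq (fst r) k"
  shows "(k, \<phi> (fst q) k (snd q) \<otimes>\<^bsub>Q k\<^esub> \<phi> (fst r) k (snd r)) \<in> P \<and>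
    val (k, \<phi> (fst q) k (snd q) \<otimes>\<^bsub>Q k\<^esub> \<phi> (fst r) k (snd r)) = val q \<otimes>\<^bsub>K\<^esub> val r"
proof -
  obtain i z j w where q: "i \<in> I" "z \<in> carrier (Z i)" "q = (i, coset i z)"
    and r: "j \<in> I" "w \<in> carrier (Z j)" "r = (j, coset j w)"
    using P_cases[OF q] P_cases[OF r] by blast
  interpret Z: comm_group "Z k" by (rule Z_group[OF k(1)])
  have pz: "p i k z \<in> carrier (Z k)" "p j k w \<in> carrier (Z k)"
    using p_closed q r k by auto
  have eq: "\<phi> (fst q) k (snd q) \<otimes>\<^bsub>Q k\<^esub> \<phi> (fst r) k (snd r) = coset k (p i k z \<otimes>\<^bsub>Z k\<^esub> p j k w)"
    using q r k \<phi>_coset Q_mult[OF k(1) pz] by simp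
  show ?thesis
    unfolding eq using q r k pz by (simp add: val_coset ev_hom ev_p coset_in_Q)
qed

lemma mult_D:
  assumes q: "q \<in> P" and r: "r \<in> P"
  shows "{s \<in> P. val s = val q} \<otimes>\<^bsub>D\<^esub> {s \<in> P. val s = val r}
       = {s \<in> P. val s = val q \<otimes>\<^bsub>K\<^esub> val r}"
proof -
  have D: "A \<otimes>\<^bsub>D\<^esub> A' = \<Union> {R `` {(k, \<phi> i k x \<otimes>\<^bsub>Q k\<^esub> \<phi> j k y)} | i x j y k.
      (i, x) \<in> A \<and> (j, y) \<in> A' \<and> k \<in> I \<and> leq i k \<and> leq j k}" for A A'
    by (simp add: direct_limit_def)
  let ?T = "{s \<in> P. val s = val q \<otimes>\<^bsub>K\<^esub> val r}"
  have eq: "R `` {(k, \<phi> i k x \<otimes>\<^bsub>Q k\<^esub> \<phi> j k y)} = ?T"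
    if "(i, x) \<in> P" "val (i, x) = val q" "(j, y) \<in> P" "val (j, y) = val r" "k \<in> I" "leq i k" "leq j k"
    for i x j y k
    using \<phi>_P[OF that(1,3,5)] that by (simp add: class_eq del: mem_Sigma_iff)
  obtain i x j y where ij: "q = (i, x)" "r = (j, y)" by (cases q; cases r) auto
  \<comment> \<open>A common level for both factors: it shows that the family of classes whose union
    is the product is not empty.\<close>
  define n where "n = max (level i) (level j)"
  have l: "leq i (J n)" "leq j (J n)"
    using leq_J_mono[OF leq_level, of i n] leq_J_mono[OF leq_level, of j n] q r ij
    by (simp_all add: n_def)
  have "{R `` {(k, \<phi> i k x \<otimes>\<^bsub>Q k\<^esub> \<phi> j k y)} | i x j y k.
      (i, x) \<in> {s \<in> P. val s = val q} \<and> (j, y) \<in> {s \<in> P. val s = val r} \<and> k \<in> I \<and> leq i k \<and> leq j k}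
      = {?T}" (is "?L = _")
  proof
    show "?L \<subseteq> {?T}" using eq by blast
    have "?T = R `` {(J n, \<phi> i (J n) x \<otimes>\<^bsub>Q (J n)\<^esub> \<phi> j (J n) y)}"
      using eq[of i x j y "J n"] q r ij l J_in by simp
    then show "{?T} \<subseteq> ?L" using q r ij l J_in[of n] by blast
  qed
  then show ?thesis unfolding D by simp
qed

theorem direct_limit_iso: "D \<cong> K"
proof -
  define h where "h = (\<lambda>A. val (SOME q. q \<in> A))"
  have h: "h {r \<in> P. val r = val q} = val q" if "q \<in> P" for q
  proof -
    have "(SOME s. s \<in> {r \<in> P. val r = val q}) \<in> {r \<in> P. val r = val q}"
      by (rule someI[of _ q]) (use that in simp)
    then show ?thesis by (simp add: h_def)
  qed
  have val_P: "val ` P = carrier K"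
  proof
    have "val q \<in> carrier K" if "q \<in> P" for q
      using P_cases[OF that] val_coset ev_closed by fastforce
    then show "val ` P \<subseteq> carrier K" by blast
    show "carrier K \<subseteq> val ` P"
    proof
      fix y assume "y \<in> carrier K"
      then obtain n z where z: "z \<in> carrier (Z (J n))" "E n z = y" using E_surj by blast
      have "ev (J n) z = y"
        using ev_eq[OF J_in J_step z(1)] E_step[OF z(1)] z(2) by simp
      then have "val (J n, coset (J n) z) = y"
        using val_coset[OF J_in z(1)] by simp
      moreover have "(J n, coset (J n) z) \<in> P"
        using coset_in_Q[OF z(1)] J_in[of n] by simp
      ultimately show "y \<in> val ` P" by (rule image_eqI[OF sym])
    qed
  qed
  have "h \<in> iso D K"
  proof (rule isoI)
    show "h \<in> hom D K"
    proof (rule homI)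
      fix A assume "A \<in> carrier D"
      then obtain q where "q \<in> P" "A = {s \<in> P. val s = val q}"
        unfolding carrier_D by blast
      then show "h A \<in> carrier K" using h[of q] val_P by blast
    next
      fix A A' assume "A \<in> carrier D" "A' \<in> carrier D"
      then obtain q r where q: "q \<in> P" "A = {s \<in> P. val s = val q}"
        and r: "r \<in> P" "A' = {s \<in> P. val s = val r}"
        unfolding carrier_D by blast
      interpret K: group K by (rule K_group)
      have "val q \<in> carrier K" "val r \<in> carrier K" using val_P q(1) r(1) by blast+
      then have "val q \<otimes>\<^bsub>K\<^esub> val r \<in> val ` P" unfolding val_P by (rule K.m_closed)
      then obtain s where s: "s \<in> P" "val s = val q \<otimes>\<^bsub>K\<^esub> val r" by force
      show "h (A \<otimes>\<^bsub>D\<^esub> A') = h A \<otimes>\<^bsub>K\<^esub> h A'"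
        unfolding q(2) r(2) mult_D[OF q(1) r(1)] h[OF q(1)] h[OF r(1)]
        by (rule h[OF s(1), unfolded s(2)])
    qed
    show "bij_betw h (carrier D) (carrier K)"
      unfolding bij_betw_def
    proof
      show "inj_on h (carrier D)"
      proof (rule inj_onI)
        fix A A' assume "A \<in> carrier D" "A' \<in> carrier D" and eq: "h A = h A'"
        then obtain q r where q: "q \<in> P" "A = {s \<in> P. val s = val q}"
          and r: "r \<in> P" "A' = {s \<in> P. val s = val r}"
          unfolding carrier_D by blast
        have "val q = val r" using eq by (simp only: q(2) r(2) h[OF q(1)] h[OF r(1)])
        then show "A = A'" unfolding q(2) r(2) by (simp only:)
      qed
      have "h ` carrier D = val ` P"
        unfolding carrier_D image_image by (rule image_cong[OF refl h])
      then show "h ` carrier D = carrier K" using val_P by simp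
    qed
  qed
  then show ?thesis by (rule is_isoI)
qed

end

section \<open>Cohomology of nerves in degrees 0 and 1\<close>

lemma refinement_projection:
  assumes "refined_by \<U> \<V>" "V \<in> \<V>"
  shows "refinement_projection \<U> \<V> V \<in> \<U>" "V \<subseteq> refinement_projection \<U> \<V> V"
proof -
  have "\<exists>p. \<forall>V\<in>\<V>. p V \<in> \<U> \<and> V \<subseteq> p V"
    using assms(1) unfolding refined_by_def by (intro bchoice) blast
  then have "\<forall>V\<in>\<V>. refinement_projection \<U> \<V> V \<in> \<U> \<and> V \<subseteq> refinement_projection \<U> \<V> V"
    unfolding refinement_projection_def by (rule someI_ex)
  then show "refinement_projection \<U> \<V> V \<in> \<U>" "V \<subseteq> refinement_projection \<U> \<V> V"
    using assms(2) by auto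
qed

lemma refined_by_trans: "refined_by \<U> \<V> \<Longrightarrow> refined_by \<V> \<W> \<Longrightarrow> refined_by \<U> \<W>"
  unfolding refined_by_def by (meson subset_trans)

lemma nerve_1: "us \<in> nerve \<U> 1 \<longleftrightarrow> (\<exists>u v. us = [u, v] \<and> u \<in> \<U> \<and> v \<in> \<U> \<and> u \<inter> v \<noteq> {})"
  by (auto simp: nerve_def length_Suc_conv)

lemma nerve_0: "us \<in> nerve \<U> 0 \<longleftrightarrow> (\<exists>u. us = [u] \<and> u \<in> \<U> \<and> u \<noteq> {})"
  by (auto simp: nerve_def length_Suc_conv)

lemma nerve_2: "us \<in> nerve \<U> 2 \<longleftrightarrow>
    (\<exists>u v w. us = [u, v, w] \<and> u \<in> \<U> \<and> v \<in> \<U> \<and> w \<in> \<U> \<and> u \<inter> v \<inter> w \<noteq> {})"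
  by (auto simp: nerve_def length_Suc_conv numeral_2_eq_2 Int_assoc)

lemma ball_nerve_1: "(\<forall>us\<in>nerve \<U> 1. P us) \<longleftrightarrow> (\<forall>u v. u \<in> \<U> \<and> v \<in> \<U> \<and> u \<inter> v \<noteq> {} \<longrightarrow> P [u, v])"
  unfolding Ball_def nerve_1 by blast

lemma ball_nerve_2: "(\<forall>us\<in>nerve \<U> 2. P us) \<longleftrightarrow>
    (\<forall>u v w. u \<in> \<U> \<and> v \<in> \<U> \<and> w \<in> \<U> \<and> u \<inter> v \<inter> w \<noteq> {} \<longrightarrow> P [u, v, w])"
  unfolding Ball_def nerve_2 by blast

lemma length_omit_nth: "i < length us \<Longrightarrow> length (omit_nth i us) = length us - 1"
  by (auto simp: omit_nth_def)

lemma set_omit_nth: "set (omit_nth i us) \<subseteq> set us"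
  by (auto simp: omit_nth_def dest: in_set_takeD in_set_dropD)

lemma omit_nth_nerve:
  assumes "us \<in> nerve \<U> (Suc n)" "i \<le> Suc n" shows "omit_nth i us \<in> nerve \<U> n"
proof -
  have "\<Inter>(set us) \<subseteq> \<Inter>(set (omit_nth i us))" using set_omit_nth by (rule Inter_anti_mono)
  then show ?thesis
    using assms set_omit_nth[of i us] length_omit_nth[of i us] by (auto simp: nerve_def)
qed

lemma map_nerve:
  assumes "\<forall>V\<in>\<V>. p V \<in> \<U> \<and> V \<subseteq> p V" "vs \<in> nerve \<V> n" shows "map p vs \<in> nerve \<U> n"
proof -
  have "\<Inter>(set vs) \<subseteq> \<Inter>(set (map p vs))" using assms by (fastforce simp: nerve_def)
  then show ?thesis using assms by (auto simp: nerve_def)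
qed

lemma refinement_projection_nerve:
  assumes "refined_by \<U> \<V>" "vs \<in> nerve \<V> n"
  shows "map (refinement_projection \<U> \<V>) vs \<in> nerve \<U> n"
  using map_nerve[OF _ assms(2)] refinement_projection[OF assms(1)] by blast

lemma omit_nth_map: "omit_nth i (map p us) = map p (omit_nth i us)"
  by (simp add: omit_nth_def take_map drop_map)

section \<open>Cochains, cocycles and coboundaries in low degree\<close>

lemma carrier_cochain_group: "carrier (cochain_group \<U> n) = (\<Pi>\<^sub>E us\<in>nerve \<U> n. UNIV)"
  by (simp add: cochain_group_def)

lemma mult_cochain_group:
  "f \<otimes>\<^bsub>cochain_group \<U> n\<^esub> g = (\<lambda>us\<in>nerve \<U> n. f us + g us)"
  by (simp add: cochain_group_def)

lemma one_cochain_group: "\<one>\<^bsub>cochain_group \<U> n\<^esub> = (\<lambda>us\<in>nerve \<U> n. 0)"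
  by (simp add: cochain_group_def)

lemma comm_group_cochain_group: "comm_group (cochain_group \<U> n)"
proof (rule group.group_comm_groupI)
  show "group (cochain_group \<U> n)" unfolding cochain_group_def by simp
qed (simp add: mult_cochain_group add.commute)

lemma coboundary_hom: "coboundary \<U> n \<in> hom (cochain_group \<U> n) (cochain_group \<U> (Suc n))"
proof (rule homI)
  fix f assume "f \<in> carrier (cochain_group \<U> n)"
  show "coboundary \<U> n f \<in> carrier (cochain_group \<U> (Suc n))"
    by (simp add: carrier_cochain_group coboundary_def)
next
  fix f g
  show "coboundary \<U> n (f \<otimes>\<^bsub>cochain_group \<U> n\<^esub> g) =
      coboundary \<U> n f \<otimes>\<^bsub>cochain_group \<U> (Suc n)\<^esub> coboundary \<U> n g"
  proof
    fix us
    show "coboundary \<U> n (f \<otimes>\<^bsub>cochain_group \<U> n\<^esub> g) us =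
      (coboundary \<U> n f \<otimes>\<^bsub>cochain_group \<U> (Suc n)\<^esub> coboundary \<U> n g) us"
    proof (cases "us \<in> nerve \<U> (Suc n)")
      case True
      have "(\<Sum>i\<le>Suc n. (- 1) ^ i * (f \<otimes>\<^bsub>cochain_group \<U> n\<^esub> g) (omit_nth i us))
          = (\<Sum>i\<le>Suc n. (- 1) ^ i * f (omit_nth i us) + (- 1) ^ i * g (omit_nth i us))"
        using omit_nth_nerve[OF True]
        by (intro sum.cong) (simp_all add: mult_cochain_group algebra_simps)
      also have "\<dots> = (\<Sum>i\<le>Suc n. (- 1) ^ i * f (omit_nth i us)) + (\<Sum>i\<le>Suc n. (- 1) ^ i * g (omit_nth i us))"
        by (rule sum.distrib)
      finally show ?thesis using True by (simp add: coboundary_def mult_cochain_group)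
    qed (simp add: coboundary_def mult_cochain_group)
  qed
qed

lemma cocycle_subgroup:
  "subgroup (carrier (cocycle_group \<U> n)) (cochain_group \<U> n)"
proof -
  interpret G: comm_group "cochain_group \<U> n" by (rule comm_group_cochain_group)
  interpret H: comm_group "cochain_group \<U> (Suc n)" by (rule comm_group_cochain_group)
  interpret h: group_hom "cochain_group \<U> n" "cochain_group \<U> (Suc n)" "coboundary \<U> n"
    by unfold_locales (rule coboundary_hom)
  show ?thesis using h.subgroup_kernel by (simp add: cocycle_group_def)
qed

lemma cocycle_group_eq:
  "cocycle_group \<U> n = (cochain_group \<U> n)\<lparr>carrier := carrier (cocycle_group \<U> n)\<rparr>"
  by (simp add: cocycle_group_def)

lemma comm_group_cocycle_group: "comm_group (cocycle_group \<U> n)"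
proof -
  interpret G: comm_group "cochain_group \<U> n" by (rule comm_group_cochain_group)
  interpret S: subgroup "carrier (cocycle_group \<U> n)" "cochain_group \<U> n" by (rule cocycle_subgroup)
  have "group (cocycle_group \<U> n)"
    by (subst cocycle_group_eq) (rule S.subgroup_is_group[OF G.is_group])
  then show ?thesis
    by (rule group.group_comm_groupI) (simp add: cocycle_group_def mult_cochain_group add.commute)
qed

lemma mult_cocycle_group: "f \<otimes>\<^bsub>cocycle_group \<U> n\<^esub> g = (\<lambda>us\<in>nerve \<U> n. f us + g us)"
  by (simp add: cocycle_group_def mult_cochain_group)

lemma one_cocycle_group: "\<one>\<^bsub>cocycle_group \<U> n\<^esub> = (\<lambda>us\<in>nerve \<U> n. 0)"
  by (simp add: cocycle_group_def one_cochain_group)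

lemma cocycle_iff:
  "f \<in> carrier (cocycle_group \<U> n) \<longleftrightarrow> f \<in> (\<Pi>\<^sub>E us\<in>nerve \<U> n. UNIV) \<and>
     (\<forall>us\<in>nerve \<U> (Suc n). (\<Sum>i\<le>Suc n. (- 1) ^ i * f (omit_nth i us)) = 0)"
  by (auto simp: cocycle_group_def kernel_def carrier_cochain_group one_cochain_group
      coboundary_def fun_eq_iff restrict_def)

lemma cocycle_0_iff:
  "f \<in> carrier (cocycle_group \<U> 0) \<longleftrightarrow> f \<in> (\<Pi>\<^sub>E us\<in>nerve \<U> 0. UNIV) \<and>
     (\<forall>u v. u \<in> \<U> \<and> v \<in> \<U> \<and> u \<inter> v \<noteq> {} \<longrightarrow> f [u] = f [v])"
proof -
  have "(\<Sum>i\<le>Suc 0. (- 1) ^ i * f (omit_nth i [u, v])) = 0 \<longleftrightarrow> f [u] = f [v]" for u v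
    by (auto simp: omit_nth_def)
  then show ?thesis
    by (simp only: cocycle_iff ball_nerve_1[unfolded One_nat_def])
qed

lemma cocycle_1_iff:
  "c \<in> carrier (cocycle_group \<U> 1) \<longleftrightarrow> c \<in> (\<Pi>\<^sub>E us\<in>nerve \<U> 1. UNIV) \<and>
     (\<forall>u v w. u \<in> \<U> \<and> v \<in> \<U> \<and> w \<in> \<U> \<and> u \<inter> v \<inter> w \<noteq> {} \<longrightarrow> c [u, w] = c [u, v] + c [v, w])"
proof -
  have "(\<Sum>i\<le>Suc 1. (- 1) ^ i * c (omit_nth i [u, v, w])) = 0 \<longleftrightarrow> c [u, w] = c [u, v] + c [v, w]"
    for u v w by (auto simp: omit_nth_def)
  then show ?thesis
    by (simp only: cocycle_iff ball_nerve_2[unfolded numeral_2_eq_2, folded One_nat_def])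
qed

lemma coboundaries_1_iff:
  "b \<in> coboundaries \<U> 1 \<longleftrightarrow> b \<in> (\<Pi>\<^sub>E us\<in>nerve \<U> 1. UNIV) \<and>
     (\<exists>f. \<forall>u v. u \<in> \<U> \<and> v \<in> \<U> \<and> u \<inter> v \<noteq> {} \<longrightarrow> b [u, v] = f v - f u)" (is "?L \<longleftrightarrow> ?R")
proof -
  have d: "coboundary \<U> 0 f [u, v] = f [v] - f [u]"
    if "u \<in> \<U> \<and> v \<in> \<U> \<and> u \<inter> v \<noteq> {}" for f u v
    using that nerve_1[of "[u, v]" \<U>] by (simp add: coboundary_def omit_nth_def)
  have e: "coboundary \<U> 0 f \<in> (\<Pi>\<^sub>E us\<in>nerve \<U> 1. UNIV)" for f
    by (simp add: coboundary_def)
  have L: "?L \<longleftrightarrow> (\<exists>f\<in>carrier (cochain_group \<U> 0). b = coboundary \<U> 0 f)"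
    by (auto simp: coboundaries_def)
  show ?thesis
  proof
    assume ?L
    then obtain f where "b = coboundary \<U> 0 f" using L by blast
    then show ?R using d[of _ _ f] e[of f] by (intro conjI exI[of _ "\<lambda>u. f [u]"]) auto
  next
    assume ?R
    then obtain f where b: "b \<in> (\<Pi>\<^sub>E us\<in>nerve \<U> 1. UNIV)"
      and f: "\<And>u v. u \<in> \<U> \<and> v \<in> \<U> \<and> u \<inter> v \<noteq> {} \<Longrightarrow> b [u, v] = f v - f u" by blast
    \<comment> \<open>\<open>f\<close> is defined on cover members, cochains on one-element lists.
      The empty set is not a vertex of the nerve, so \<open>g\<close> copies \<open>f\<close> only
      on nonempty members; the ends of an edge are such.\<close>
    define g where "g = (\<lambda>us\<in>nerve \<U> 0. f (hd us))"
    have g: "g [u] = f u" if "u \<in> \<U>" "u \<noteq> {}" for u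
      using that nerve_0[of "[u]" \<U>] by (simp add: g_def)
    have "b = coboundary \<U> 0 g"
    proof (rule PiE_ext[OF b e])
      fix us assume "us \<in> nerve \<U> 1"
      then obtain u v where uv: "us = [u, v]" "u \<in> \<U> \<and> v \<in> \<U> \<and> u \<inter> v \<noteq> {}"
        unfolding nerve_1 by blast
      then have "u \<noteq> {}" "v \<noteq> {}" by auto
      then show "b us = coboundary \<U> 0 g us" using uv f d[of u v g] g by simp
    qed
    moreover have "g \<in> carrier (cochain_group \<U> 0)" by (simp add: g_def carrier_cochain_group)
    ultimately show ?L unfolding L by blast
  qed
qed

text \<open>The bound on \<open>n\<close> lets \<open>d d = 0\<close> be read off the formula
  \<open>b [u, v] = f v - f u\<close> instead of the alternating sum.\<close>

lemma coboundaries_subgroup: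
  assumes "n \<le> 1" shows "subgroup (coboundaries \<U> n) (cocycle_group \<U> n)"
proof -
  interpret Z: comm_group "cocycle_group \<U> n" by (rule comm_group_cocycle_group)
  consider "n = 0" | "n = 1" using assms by linarith
  then show ?thesis
  proof cases
    case 1
    have "coboundaries \<U> 0 = {\<one>\<^bsub>cocycle_group \<U> 0\<^esub>}"
      by (simp add: coboundaries_def one_cocycle_group one_cochain_group)
    then show ?thesis using Z.triv_subgroup 1 by simp
  next
    case 2
    interpret G: comm_group "cochain_group \<U> 0" by (rule comm_group_cochain_group)
    interpret H: comm_group "cochain_group \<U> 1" by (rule comm_group_cochain_group)
    interpret h: group_hom "cochain_group \<U> 0" "cochain_group \<U> 1" "coboundary \<U> 0"
      by unfold_locales (use coboundary_hom[of \<U> 0] in simp)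
    have "subgroup (coboundaries \<U> 1) (cochain_group \<U> 1)"
      using h.img_is_subgroup by (simp add: coboundaries_def)
    moreover have "coboundaries \<U> 1 \<subseteq> carrier (cocycle_group \<U> 1)"
    proof
      fix b assume b: "b \<in> coboundaries \<U> 1"
      then obtain f where f: "\<And>u v. u \<in> \<U> \<and> v \<in> \<U> \<and> u \<inter> v \<noteq> {} \<Longrightarrow> b [u, v] = f v - f u"
        unfolding coboundaries_1_iff by blast
      have "b [u, w] = b [u, v] + b [v, w]"
        if "u \<in> \<U> \<and> v \<in> \<U> \<and> w \<in> \<U> \<and> u \<inter> v \<inter> w \<noteq> {}" for u v w
      proof -
        have "u \<inter> w \<noteq> {}" "u \<inter> v \<noteq> {}" "v \<inter> w \<noteq> {}" using that by auto
        then show ?thesis using that f[of u w] f[of u v] f[of v w] by simp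
      qed
      then show "b \<in> carrier (cocycle_group \<U> 1)"
        using b by (simp only: cocycle_1_iff coboundaries_1_iff) simp
    qed
    ultimately show ?thesis
      unfolding 2 using H.subgroup_incl[OF _ cocycle_subgroup[of \<U> 1]] cocycle_group_eq[of \<U> 1] by simp
  qed
qed

section \<open>Pullback along refinements\<close>

lemma cochain_pullback_hom:
  assumes r: "refined_by \<U> \<V>"
  shows "cochain_pullback \<U> \<V> n \<in> hom (cocycle_group \<U> n) (cocycle_group \<V> n)"
proof (rule homI)
  fix f assume f: "f \<in> carrier (cocycle_group \<U> n)"
  let ?p = "refinement_projection \<U> \<V>"
  have "(\<Sum>i\<le>Suc n. (- 1) ^ i * cochain_pullback \<U> \<V> n f (omit_nth i vs)) = 0"
    if vs: "vs \<in> nerve \<V> (Suc n)" for vs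
  proof -
    have "(\<Sum>i\<le>Suc n. (- 1) ^ i * cochain_pullback \<U> \<V> n f (omit_nth i vs)) =
        (\<Sum>i\<le>Suc n. (- 1) ^ i * f (omit_nth i (map ?p vs)))"
      using omit_nth_nerve[OF vs] by (intro sum.cong) (simp_all add: cochain_pullback_def omit_nth_map)
    also have "\<dots> = 0"
      using f refinement_projection_nerve[OF r vs] unfolding cocycle_iff by blast
    finally show ?thesis .
  qed
  then show "cochain_pullback \<U> \<V> n f \<in> carrier (cocycle_group \<V> n)"
    by (simp add: cocycle_iff cochain_pullback_def)
next
  fix f g
  show "cochain_pullback \<U> \<V> n (f \<otimes>\<^bsub>cocycle_group \<U> n\<^esub> g) =
      cochain_pullback \<U> \<V> n f \<otimes>\<^bsub>cocycle_group \<V> n\<^esub> cochain_pullback \<U> \<V> n g"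
    using refinement_projection_nerve[OF r]
    by (auto simp: cochain_pullback_def mult_cocycle_group fun_eq_iff restrict_def)
qed

lemma cochain_pullback_coboundaries:
  assumes r: "refined_by \<U> \<V>" and b: "b \<in> coboundaries \<U> n" and n: "n \<le> 1"
  shows "cochain_pullback \<U> \<V> n b \<in> coboundaries \<V> n"
proof -
  let ?p = "refinement_projection \<U> \<V>"
  consider "n = 0" | "n = 1" using n by linarith
  then show ?thesis
  proof cases
    case 1
    then show ?thesis
      using b refinement_projection_nerve[OF r, of _ 0]
      by (auto simp: coboundaries_def one_cochain_group cochain_pullback_def fun_eq_iff restrict_def)
  next
    case 2
    then obtain f where f: "\<And>u v. u \<in> \<U> \<and> v \<in> \<U> \<and> u \<inter> v \<noteq> {} \<Longrightarrow> b [u, v] = f v - f u"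
      using b unfolding 2 coboundaries_1_iff by blast
    have "cochain_pullback \<U> \<V> 1 b [u, v] = f (?p v) - f (?p u)"
      if "u \<in> \<V> \<and> v \<in> \<V> \<and> u \<inter> v \<noteq> {}" for u v
    proof -
      have "?p u \<in> \<U> \<and> ?p v \<in> \<U> \<and> ?p u \<inter> ?p v \<noteq> {}"
        using refinement_projection[OF r] that by blast
      then show ?thesis using f that nerve_1[of "[u, v]" \<V>] by (simp add: cochain_pullback_def)
    qed
    moreover have "cochain_pullback \<U> \<V> 1 b \<in> (\<Pi>\<^sub>E us\<in>nerve \<V> 1. UNIV)"
      by (simp add: cochain_pullback_def)
    ultimately show ?thesis unfolding 2 coboundaries_1_iff by (intro conjI exI[of _ "\<lambda>u. f (?p u)"]) auto
  qed
qed

text \<open>In degree 1 the two projections are contiguous, and \<open>V \<mapsto> c [p V, q V]\<close> is the chain homotopy.\<close>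

lemma contiguous_pullback:
  assumes p: "\<And>V. V \<in> \<V> \<Longrightarrow> p V \<in> \<U> \<and> V \<subseteq> p V" and q: "\<And>V. V \<in> \<V> \<Longrightarrow> q V \<in> \<U> \<and> V \<subseteq> q V"
    and n: "n \<le> 1" and c: "c \<in> carrier (cocycle_group \<U> n)"
  shows "(\<lambda>vs\<in>nerve \<V> n. c (map q vs)) \<in>
    coboundaries \<V> n #>\<^bsub>cocycle_group \<V> n\<^esub> (\<lambda>vs\<in>nerve \<V> n. c (map p vs))"
proof -
  let ?b = "\<lambda>vs\<in>nerve \<V> n. c (map q vs) - c (map p vs)"
  have "?b \<in> coboundaries \<V> n"
  proof -
    consider "n = 0" | "n = 1" using n by linarith
    then show ?thesis
    proof cases
      case 1
      have "c [q v] = c [p v]" if "v \<in> \<V>" "x \<in> v" for v x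
      proof -
        have "q v \<inter> p v \<noteq> {}" using p[of v] q[of v] that by blast
        then show ?thesis using c p q that unfolding 1 cocycle_0_iff by simp
      qed
      then show ?thesis
        unfolding 1 by (auto simp: coboundaries_def one_cochain_group fun_eq_iff restrict_def nerve_0)
    next
      case 2
      have cc: "c [u, w] = c [u, v] + c [v, w]" if "u \<in> \<U>" "v \<in> \<U>" "w \<in> \<U>" "u \<inter> v \<inter> w \<noteq> {}" for u v w
        using c that unfolding 2 cocycle_1_iff by blast
      have "?b [v, w] = c [p w, q w] - c [p v, q v]" if vw: "v \<in> \<V> \<and> w \<in> \<V> \<and> v \<inter> w \<noteq> {}" for v w
      proof -
        \<comment> \<open>\<open>c [p v, q w]\<close> splits through \<open>p w\<close> and also
          through \<open>q v\<close>; comparing the two splittings gives the homotopy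
          identity.\<close>
        have "v \<inter> w \<subseteq> p v \<inter> p w \<inter> q w" "v \<inter> w \<subseteq> p v \<inter> q v \<inter> q w"
          using p[of v] p[of w] q[of v] q[of w] vw by auto
        then have "p v \<inter> p w \<inter> q w \<noteq> {}" "p v \<inter> q v \<inter> q w \<noteq> {}" using vw by auto
        then show ?thesis
          using cc[of "p v" "p w" "q w"] cc[of "p v" "q v" "q w"] p q vw nerve_1[of "[v, w]" \<V>]
          by (simp add: 2)
      qed
      then show ?thesis
        unfolding 2 coboundaries_1_iff by (intro conjI exI[of _ "\<lambda>v. c [p v, q v]"]) auto
    qed
  qed
  moreover have "(\<lambda>vs\<in>nerve \<V> n. c (map q vs)) = ?b \<otimes>\<^bsub>cocycle_group \<V> n\<^esub> (\<lambda>vs\<in>nerve \<V> n. c (map p vs))"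
    by (auto simp: mult_cocycle_group fun_eq_iff restrict_def)
  ultimately show ?thesis unfolding r_coset_def by blast
qed

text \<open>A composite of two chosen projections is a projection for the composite refinement, but
  need not be the chosen one. \<open>contiguous_pullback\<close> places the two pullbacks in one
  coset, which is the assumption \<open>p_comp\<close> of \<open>quotient_system\<close>.\<close>

lemma cech_cohomology_iso:
  fixes J :: "nat \<Rightarrow> 'a set set" and K :: "('k, 'm) monoid_scheme"
  assumes n: "n \<le> 1"
    and J_cover: "\<And>m. J m \<in> open_covers X"
    and J_cofinal: "\<And>\<U>. \<U> \<in> open_covers X \<Longrightarrow> \<exists>m. refined_by \<U> (J m)"
    and J_step: "\<And>m. refined_by (J m) (J (Suc m))"
    and K: "group K"
    and E_hom: "\<And>m. E m \<in> hom (cocycle_group (J m) n) K"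
    and E_kernel: "\<And>m z. z \<in> carrier (cocycle_group (J m) n) \<Longrightarrow> E m z = \<one>\<^bsub>K\<^esub> \<longleftrightarrow> z \<in> coboundaries (J m) n"
    and E_step: "\<And>m z. z \<in> carrier (cocycle_group (J m) n) \<Longrightarrow>
      E (Suc m) (cochain_pullback (J m) (J (Suc m)) n z) = E m z"
    and E_surj: "\<And>y. y \<in> carrier K \<Longrightarrow> \<exists>m. \<exists>z\<in>carrier (cocycle_group (J m) n). E m z = y"
  shows "cech_cohomology n X \<cong> K"
proof -
  have comp: "cochain_pullback \<V> \<W> n (cochain_pullback \<U> \<V> n z) \<in>
        coboundaries \<W> n #>\<^bsub>cocycle_group \<W> n\<^esub> cochain_pullback \<U> \<W> n z"
    if l: "refined_by \<U> \<V>" "refined_by \<V> \<W>" and z: "z \<in> carrier (cocycle_group \<U> n)"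
    for \<U> \<V> \<W> :: "'a set set" and z
  proof -
    have "cochain_pullback \<V> \<W> n (cochain_pullback \<U> \<V> n z) =
        (\<lambda>ws\<in>nerve \<W> n. z (map (refinement_projection \<U> \<V> \<circ> refinement_projection \<V> \<W>) ws))"
      using refinement_projection_nerve[OF l(2)]
      by (auto simp: cochain_pullback_def fun_eq_iff restrict_def)
    also have "\<dots> \<in> coboundaries \<W> n #>\<^bsub>cocycle_group \<W> n\<^esub>
        (\<lambda>ws\<in>nerve \<W> n. z (map (refinement_projection \<U> \<W>) ws))"
    proof (rule contiguous_pullback[OF _ _ n z])
      fix W assume W: "W \<in> \<W>"
      show "refinement_projection \<U> \<W> W \<in> \<U> \<and> W \<subseteq> refinement_projection \<U> \<W> W"
        using refinement_projection[OF refined_by_trans[OF l] W] by blast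
      show "(refinement_projection \<U> \<V> \<circ> refinement_projection \<V> \<W>) W \<in> \<U> \<and>
          W \<subseteq> (refinement_projection \<U> \<V> \<circ> refinement_projection \<V> \<W>) W"
        using refinement_projection[OF l(2) W] refinement_projection[OF l(1)] by fastforce
    qed
    finally show ?thesis
      by (simp add: cochain_pullback_def)
  qed
  interpret quotient_system "open_covers X" refined_by "\<lambda>\<U>. cocycle_group \<U> n"
    "\<lambda>\<U>. coboundaries \<U> n" "\<lambda>\<U> \<V>. cochain_pullback \<U> \<V> n" J K E
    by (rule quotient_system.intro)
      (assumption | rule comm_group_cocycle_group coboundaries_subgroup[OF n] cochain_pullback_hom
        cochain_pullback_coboundaries[OF _ _ n] comp J_cover J_cofinal J_step K E_hom E_kernel E_step E_surj
        refined_by_trans)+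
  show ?thesis
    using direct_limit_iso
    by (simp add: cech_cohomology_def nerve_cohomology_def[abs_def] refinement_map_def[abs_def])
qed

section \<open>Covers whose nerve is a dumbbell\<close>

text \<open>Two integers are glued when they label the same vertex of the graph obtained from the line by
  winding each of the two half-lines beyond \<open>\<plusminus>M\<close> around a circle of length \<open>M\<close>.\<close>

definition glued :: "int \<Rightarrow> int \<Rightarrow> int \<Rightarrow> bool" where
  "glued M a b \<longleftrightarrow> a = b \<or> (M dvd a - b \<and> (a \<ge> M \<and> b \<ge> M \<or> a \<le> - M \<and> b \<le> - M))"

lemma glued_refl [simp]: "glued M a a"
  by (simp add: glued_def)

lemma glued_sym: "glued M a b \<Longrightarrow> glued M b a"
  by (auto simp: glued_def dvd_diff_commute)

lemma glued_trans:
  assumes "glued M a b" "glued M b c" "M > 0" shows "glued M a c"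
proof (cases "a = b \<or> b = c")
  case False
  then have "M dvd (a - b) + (b - c)" using assms by (intro dvd_add) (auto simp: glued_def)
  moreover have "a \<ge> M \<and> c \<ge> M \<or> a \<le> - M \<and> c \<le> - M"
    using assms False unfolding glued_def by linarith
  ultimately show ?thesis by (simp add: glued_def)
qed (use assms in auto)

text \<open>A multiple of 4^(n+1) halves to an even multiple of 4^n: one turn at the finer level
  becomes two turns at the coarser one.\<close>

lemma glued_div_2:
  assumes "glued (4 ^ Suc n) a b" shows "glued (4 ^ n) (a div 2) (b div 2)"
proof (cases "a = b")
  case False
  then have d: "4 * 4 ^ n dvd a - b" and s: "a \<ge> 4 * 4 ^ n \<and> b \<ge> 4 * 4 ^ n \<or> a \<le> - (4 * 4 ^ n) \<and> b \<le> - (4 * 4 ^ n)"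
    using assms by (auto simp: glued_def)
  obtain k where k: "a = b + 2 * (4 ^ n * (2 * k))" using d by (auto simp: dvd_def algebra_simps)
  have "(b + 2 * m) div 2 = b div 2 + m" for m by simp
  then have "a div 2 = b div 2 + 4 ^ n * (2 * k)" unfolding k .
  then have "4 ^ n dvd a div 2 - b div 2" by simp
  moreover have "a div 2 \<ge> 4 ^ n \<and> b div 2 \<ge> 4 ^ n \<or> a div 2 \<le> - (4 ^ n) \<and> b div 2 \<le> - (4 ^ n)"
  proof -
    have "(0::int) \<le> 4 ^ n" by simp
    then show ?thesis using s by linarith
  qed
  ultimately show ?thesis by (simp add: glued_def)
qed simp

text \<open>The discrete primitive of \<open>g\<close> vanishing at 0; for each \<open>a\<close> at
  most one of the two sums is nonempty.\<close>

definition potential :: "(int \<Rightarrow> int) \<Rightarrow> int \<Rightarrow> int" where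
  "potential g a = sum g {0..<a} - sum g {a..<0}"

lemma potential_step: "potential g (a + 1) = potential g a + g a"
proof (cases "a \<ge> 0")
  case True
  then have "{0..<a + 1} = insert a {0..<a}" "{a + 1..<0} = {}" "{a..<0} = {}" by auto
  then show ?thesis by (simp add: potential_def)
next
  case False
  then have "{a..<0} = insert a {a + 1..<0}" "{0..<a + 1} = {}" "{0..<a} = {}" by auto
  then show ?thesis by (simp add: potential_def)
qed

text \<open>Beyond \<open>m\<close> the gain over one period is independent of the starting point,
  because moving the start by one exchanges equal values of \<open>g\<close>.\<close>

lemma potential_shift:
  assumes M: "M > 0" and per: "\<And>a. a \<ge> m \<Longrightarrow> g (a + M) = g a" and a: "a \<ge> m"
  shows "potential g (a + int k * M) = potential g a + int k * (potential g (m + M) - potential g m)"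
proof -
  have one: "potential g (a + M) - potential g a = potential g (m + M) - potential g m" if "a \<ge> m" for a
    using that
  proof (induction a rule: int_ge_induct)
    case (step i)
    have "potential g (i + 1 + M) = potential g (i + M) + g (i + M)"
      using potential_step[of g "i + M"] by (simp add: algebra_simps)
    then show ?case using step per[of i] potential_step[of g i] by simp
  qed simp
  show ?thesis
  proof (induction k)
    case (Suc k)
    have "a + int k * M \<ge> m" using a M by (simp add: add_increasing2)
    from one[OF this] Suc show ?case by (simp add: algebra_simps)
  qed simp
qed

text \<open>Steps are indexed by their left end, so the half-line ending at \<open>m\<close>
  consists of the steps with index below \<open>m\<close>; hence the strict bound in
  \<open>per\<close>.\<close>

lemma potential_shift_neg:
  assumes M: "M > 0" and per: "\<And>a. a < m \<Longrightarrow> g (a - M) = g a" and a: "a \<le> m"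
  shows "potential g (a - int k * M) = potential g a - int k * (potential g m - potential g (m - M))"
proof -
  have one: "potential g a - potential g (a - M) = potential g m - potential g (m - M)" if "a \<le> m" for a
    using that
  proof (induction a rule: int_le_induct)
    case (step i)
    have "potential g (i - M) = potential g (i - 1 - M) + g (i - 1 - M)"
      using potential_step[of g "i - 1 - M"] by (simp add: algebra_simps)
    then show ?case using step per[of "i - 1"] potential_step[of g "i - 1"] by simp
  qed simp
  show ?thesis
  proof (induction k)
    case (Suc k)
    have "a - int k * M \<le> m" using a M by (simp add: le_diff_eq add_increasing2 diff_le_eq)
    from one[OF this] Suc show ?case by (simp add: algebra_simps)
  qed simp
qed

lemma potential_diff:
  assumes "a \<le> b" shows "potential g b - potential g a = sum g {a..<b}"
  using assms
proof (induction b rule: int_ge_induct)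
  case (step i)
  then have "{a..<i + 1} = insert i {a..<i}" by auto
  then show ?case using step potential_step[of g i] by simp
qed simp

lemma dvd_small: "\<lbrakk>(M::int) dvd x; \<bar>x\<bar> < M\<rbrakk> \<Longrightarrow> x = 0"
  by (metis abs_dvd_iff dvd_abs_iff zdvd_not_zless abs_ge_zero order_le_less zero_less_abs_iff)

lemma dyadic_mem: "of_int m / 2 ^ k \<in> carrier dyadic_group"
  by (auto simp: dyadic_group_def)

lemma group_dyadic: "group dyadic_group"
proof (rule groupI)
  fix x y assume "x \<in> carrier dyadic_group" "y \<in> carrier dyadic_group"
  then obtain a k b l where x: "x = of_int a / 2 ^ k" and y: "y = of_int b / 2 ^ l"
    by (auto simp: dyadic_group_def)
  have "x + y = of_int (a * 2 ^ l + b * 2 ^ k) / 2 ^ (k + l)"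
    unfolding x y by (simp add: field_simps power_add)
  then have "x + y \<in> carrier dyadic_group" by (simp only: dyadic_mem)
  then show "x \<otimes>\<^bsub>dyadic_group\<^esub> y \<in> carrier dyadic_group" by (simp add: dyadic_group_def)
next
  show "\<one>\<^bsub>dyadic_group\<^esub> \<in> carrier dyadic_group"
    using dyadic_mem[of 0 0] by (simp add: dyadic_group_def)
next
  fix x assume "x \<in> carrier dyadic_group"
  then obtain a k where x: "x = of_int a / 2 ^ k" by (auto simp: dyadic_group_def)
  then show "\<exists>y\<in>carrier dyadic_group. y \<otimes>\<^bsub>dyadic_group\<^esub> x = \<one>\<^bsub>dyadic_group\<^esub>"
    using dyadic_mem[of "- a" k] by (intro bexI[of _ "of_int (- a) / 2 ^ k"]) (simp_all add: dyadic_group_def)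
qed (simp_all add: dyadic_group_def)

text \<open>By \<open>cover\<close> the members through a point are among two consecutive ones, so
  the nerve is a graph up to repeated vertices and every triangle condition degenerates.
  \<open>refine\<close> halves labels because labels count mesh steps and the mesh halves.\<close>

locale dumbbell_covers =
  fixes X :: "'a topology" and U :: "nat \<Rightarrow> int \<Rightarrow> 'a set"
  assumes open_U: "openin X (U n a)"
    and cover: "x \<in> topspace X \<Longrightarrow> \<exists>a. x \<in> U n a \<and> (\<forall>b. x \<in> U n b \<longrightarrow> U n b = U n a \<or> U n b = U n (a + 1))"
    and nonempty: "U n a \<inter> U n (a + 1) \<noteq> {}"
    and eq_iff: "U n a = U n b \<longleftrightarrow> glued (4 ^ n) a b"
    and refine: "U (Suc n) a \<subseteq> U n (a div 2)"
    and cofinal: "\<U> \<in> open_covers X \<Longrightarrow> \<exists>n. refined_by \<U> (range (U n))"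
begin

abbreviation J where "J n \<equiv> range (U n)"
abbreviation Z1 where "Z1 n \<equiv> carrier (cocycle_group (J n) 1)"
abbreviation refine1 where "refine1 n \<equiv> cochain_pullback (J n) (J (Suc n)) 1"

lemma J_cover: "J n \<in> open_covers X"
proof -
  have "topspace X \<subseteq> \<Union>(J n)" using cover[of _ n] by blast
  moreover have "\<Union>(J n) \<subseteq> topspace X" using openin_subset[OF open_U] by blast
  ultimately show ?thesis using open_U by (auto simp: open_covers_def)
qed

lemma J_step: "refined_by (J n) (J (Suc n))"
  using refine unfolding refined_by_def by blast

lemma nerve_elements:
  assumes "\<And>u. u \<in> S \<Longrightarrow> u \<in> J n" "x \<in> \<Inter>S" "S \<noteq> {}"
  shows "\<exists>a. S \<subseteq> {U n a, U n (a + 1)}"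
proof -
  obtain u where "u \<in> S" using assms(3) by blast
  then have "u \<in> J n" "x \<in> u" using assms(1,2) by auto
  then have "x \<in> topspace X" using openin_subset[OF open_U] by blast
  then obtain a where a: "\<And>b. x \<in> U n b \<Longrightarrow> U n b = U n a \<or> U n b = U n (a + 1)"
    using cover[of x n] by blast
  have "S \<subseteq> {U n a, U n (a + 1)}"
  proof
    fix v assume v: "v \<in> S"
    then obtain b where "v = U n b" using assms(1) by blast
    then show "v \<in> {U n a, U n (a + 1)}" using a[of b] v assms(2) by blast
  qed
  then show ?thesis ..
qed

lemma nonempty_U: "U n a \<noteq> {}"
  using nonempty by blast

section \<open>Windings of 1-cocycles around the two circles\<close>

definition jump :: "nat \<Rightarrow> ('a set list \<Rightarrow> int) \<Rightarrow> int \<Rightarrow> int" where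
  "jump n c a = c [U n a, U n (a + 1)]"

text \<open>The first full turn of the right half-line: the labels 4^n and 2 * 4^n name the same
  member, so the path closes up.\<close>

definition right_winding :: "nat \<Rightarrow> ('a set list \<Rightarrow> int) \<Rightarrow> int" where
  "right_winding n c = sum (jump n c) {4 ^ n..<2 * 4 ^ n}"

definition left_winding :: "nat \<Rightarrow> ('a set list \<Rightarrow> int) \<Rightarrow> int" where
  "left_winding n c = sum (jump n c) {- 2 * 4 ^ n..<- (4 ^ n)}"

lemma glued_shift:
  assumes "a \<ge> 4 ^ n" shows "U n (a + 4 ^ n) = U n a"
proof -
  have "(0::int) \<le> 4 ^ n" by simp
  then have "0 \<le> a" using assms by linarith
  then show ?thesis using assms unfolding eq_iff glued_def by simp
qed

lemma glued_shift_neg: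
  assumes "a \<le> - (4 ^ n)" shows "U n (a - 4 ^ n) = U n a"
proof -
  have "(0::int) \<le> 4 ^ n" by simp
  then have "a \<le> 0" using assms by linarith
  then show ?thesis using assms unfolding eq_iff glued_def by simp
qed

lemma jump_periodic:
  assumes "a \<ge> 4 ^ n" shows "jump n c (a + 4 ^ n) = jump n c a"
proof -
  have "U n (a + 4 ^ n + 1) = U n (a + 1)" using glued_shift[of n "a + 1"] assms by (simp add: algebra_simps)
  then show ?thesis using glued_shift[OF assms] by (simp add: jump_def)
qed

lemma jump_periodic_neg:
  assumes "a < - (4 ^ n)" shows "jump n c (a - 4 ^ n) = jump n c a"
proof -
  have "U n (a - 4 ^ n + 1) = U n (a + 1)" using glued_shift_neg[of "a + 1" n] assms by (simp add: algebra_simps)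
  then show ?thesis using glued_shift_neg[of a n] assms by (simp add: jump_def)
qed

lemma right_winding_potential:
  "right_winding n c = potential (jump n c) (4 ^ n + 4 ^ n) - potential (jump n c) (4 ^ n)"
  unfolding right_winding_def by (subst potential_diff) simp_all

lemma left_winding_potential:
  "left_winding n c = potential (jump n c) (- (4 ^ n)) - potential (jump n c) (- (4 ^ n) - 4 ^ n)"
  unfolding left_winding_def by (subst potential_diff) simp_all

lemma potential_right:
  assumes "a \<ge> 4 ^ n"
  shows "potential (jump n c) (a + int k * 4 ^ n) = potential (jump n c) a + int k * right_winding n c"
  unfolding right_winding_potential
  using potential_shift[where g = "jump n c" and M = "4 ^ n" and m = "4 ^ n", OF _ _ assms]
    jump_periodic by simp

lemma potential_left:
  assumes "a \<le> - (4 ^ n)"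
  shows "potential (jump n c) (a - int k * 4 ^ n) = potential (jump n c) a - int k * left_winding n c"
  unfolding left_winding_potential
  using potential_shift_neg[where g = "jump n c" and M = "4 ^ n" and m = "- (4 ^ n)", OF _ _ assms]
    jump_periodic_neg by simp

lemma cocycle_values:
  assumes c: "c \<in> Z1 n"
  shows "c [U n a, U n a] = 0" "c [U n (a + 1), U n a] = - jump n c a"
proof -
  have t: "c [u, w] = c [u, v] + c [v, w]" if "u \<in> J n" "v \<in> J n" "w \<in> J n" "u \<inter> v \<inter> w \<noteq> {}" for u v w
    using c that unfolding cocycle_1_iff by blast
  have z: "c [U n a, U n a] = 0" for a
    using t[of "U n a" "U n a" "U n a"] nonempty_U by simp
  show "c [U n a, U n a] = 0" by (rule z)
  have "U n (a + 1) \<inter> U n a \<inter> U n (a + 1) \<noteq> {}" using nonempty[of n a] by blast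
  then show "c [U n (a + 1), U n a] = - jump n c a"
    using t[of "U n (a + 1)" "U n a" "U n (a + 1)"] z[of "a + 1"] by (simp add: jump_def)
qed

text \<open>Summing \<open>c\<close> along the line yields a primitive \<open>F\<close>. Distinct
  glued labels differ by whole turns, each of which adds a winding, so vanishing windings let
  \<open>F\<close> descend to the vertices of the graph.\<close>

lemma windings_zero_imp_coboundary:
  assumes c: "c \<in> Z1 n"
    and zero: "right_winding n c = 0" "left_winding n c = 0"
  shows "c \<in> coboundaries (J n) 1"
proof -
  define F where "F = potential (jump n c)"
  have F: "F a = F b" if g: "glued (4 ^ n) a b" for a b
  proof -
    have aux: "F a = F b" if ab: "a \<le> b" "glued (4 ^ n) a b" for a b
    proof (cases "a = b")
      case False
      then have d: "4 ^ n dvd b - a" using ab by (simp add: glued_def dvd_diff_commute)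
      then obtain k where k: "b - a = 4 ^ n * k" by blast
      have "k \<ge> 0"
      proof (rule ccontr)
        assume "\<not> k \<ge> 0" then have "4 ^ n * k < 0" by (simp add: mult_pos_neg)
        then show False using k ab by simp
      qed
      then obtain m where m: "k = int m" using nonneg_int_cases by blast
      from False ab(2) consider "a \<ge> 4 ^ n" | "b \<le> - (4 ^ n)" by (auto simp: glued_def)
      then show ?thesis
      proof cases
        case 1
        then have "F (a + int m * 4 ^ n) = F a" unfolding F_def using potential_right[OF 1] zero by simp
        then show ?thesis using k m by (simp add: algebra_simps)
      next
        case 2
        then have "F (b - int m * 4 ^ n) = F b" unfolding F_def using potential_left[OF 2] zero by simp
        moreover have "b - int m * 4 ^ n = a" using k m by (simp add: algebra_simps)
        ultimately show ?thesis by simp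
      qed
    qed simp
    have "glued (4 ^ n) b a" using g by (auto simp: glued_def dvd_diff_commute)
    then show ?thesis using aux[of a b] aux[of b a] g by linarith
  qed
  define f where "f = (\<lambda>u. F (SOME a. U n a = u))"
  have f: "f (U n a) = F a" for a
  proof -
    have "U n (SOME b. U n b = U n a) = U n a" by (rule someI[of _ a]) simp
    then show ?thesis unfolding f_def eq_iff by (rule F)
  qed
  have "c [u, v] = f v - f u" if uv: "u \<in> J n \<and> v \<in> J n \<and> u \<inter> v \<noteq> {}" for u v
  proof -
    obtain x where x: "x \<in> u \<inter> v" using uv by blast
    obtain a where "{u, v} \<subseteq> {U n a, U n (a + 1)}"
      using nerve_elements[of "{u, v}" n x] uv x by auto
    then have "(u, v) \<in> {(U n a, U n a), (U n a, U n (a + 1)), (U n (a + 1), U n a), (U n (a + 1), U n (a + 1))}" by auto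
    moreover have "F (a + 1) = F a + jump n c a" unfolding F_def by (rule potential_step)
    ultimately show ?thesis
      using cocycle_values[OF c] f by (auto simp: jump_def)
  qed
  moreover have "c \<in> (\<Pi>\<^sub>E us\<in>nerve (J n) 1. UNIV)" using c unfolding cocycle_1_iff by blast
  ultimately show ?thesis unfolding coboundaries_1_iff by blast
qed

lemma coboundary_windings:
  assumes c: "c \<in> coboundaries (J n) 1"
  shows "right_winding n c = 0" "left_winding n c = 0"
proof -
  obtain f where f: "\<And>u v. u \<in> J n \<and> v \<in> J n \<and> u \<inter> v \<noteq> {} \<Longrightarrow> c [u, v] = f v - f u"
    using c unfolding coboundaries_1_iff by blast
  define g where "g = (\<lambda>a. f (U n a))"
  have s: "jump n c = (\<lambda>a. g (a + 1) - g a)"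
    unfolding jump_def g_def using f nonempty by auto
  have tel: "sum (\<lambda>a. g (a + 1) - g a) {a..<b} = g b - g a" if "a \<le> b" for a b
    using that
  proof (induction b rule: int_ge_induct)
    case (step i)
    then have "{a..<i + 1} = insert i {a..<i}" by auto
    then show ?case using step by simp
  qed simp
  have "g (4 ^ n + 4 ^ n) = g (4 ^ n)" "g (- (4 ^ n) - 4 ^ n) = g (- (4 ^ n))"
    unfolding g_def using glued_shift[of n "4 ^ n"] glued_shift_neg[of "- (4 ^ n)" n] by simp_all
  then show "right_winding n c = 0" "left_winding n c = 0"
    unfolding right_winding_def left_winding_def s by (simp_all add: tel)
qed

lemma winding_mult:
  "right_winding n (c \<otimes>\<^bsub>cocycle_group (J n) 1\<^esub> d) = right_winding n c + right_winding n d"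
  "left_winding n (c \<otimes>\<^bsub>cocycle_group (J n) 1\<^esub> d) = left_winding n c + left_winding n d"
proof -
  have "jump n (c \<otimes>\<^bsub>cocycle_group (J n) 1\<^esub> d) a = jump n c a + jump n d a" for a
    using nerve_1[of "[U n a, U n (a + 1)]" "J n"] nonempty[of n a]
    by (simp add: jump_def mult_cocycle_group)
  then show "right_winding n (c \<otimes>\<^bsub>cocycle_group (J n) 1\<^esub> d) = right_winding n c + right_winding n d"
    "left_winding n (c \<otimes>\<^bsub>cocycle_group (J n) 1\<^esub> d) = left_winding n c + left_winding n d"
    by (simp_all add: right_winding_def left_winding_def sum.distrib)
qed

lemma winding_coset:
  assumes c: "c \<in> coboundaries (J n) 1 #>\<^bsub>cocycle_group (J n) 1\<^esub> d"
  shows "right_winding n c = right_winding n d" "left_winding n c = left_winding n d"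
  using c coboundary_windings by (auto simp: r_coset_def winding_mult simp del: One_nat_def)

text \<open>The chosen projection is exchanged for the explicit \<open>q\<close> that halves labels,
  at the cost of a coboundary. Under \<open>q\<close> the steps with even label collapse and the odd
  ones become single steps; the finer turn from 4^(n+1) to 2 * 4^(n+1) then runs from 2 * 4^n to 4 *
  4^n, two coarse turns.\<close>

lemma winding_refine:
  assumes c: "c \<in> Z1 n"
  shows "right_winding (Suc n) (refine1 n c) = 2 * right_winding n c"
    "left_winding (Suc n) (refine1 n c) = 2 * left_winding n c"
proof -
  define q where "q = (\<lambda>V. U n ((SOME a. V = U (Suc n) a) div 2))"
  have q_U: "q (U (Suc n) a) = U n (a div 2)" for a
  proof -
    have "U (Suc n) a = U (Suc n) (SOME b. U (Suc n) a = U (Suc n) b)" by (rule someI[of _ a]) simp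
    then have g: "glued (4 ^ Suc n) a (SOME b. U (Suc n) a = U (Suc n) b)" unfolding eq_iff .
    from glued_div_2[OF g] show ?thesis unfolding q_def eq_iff[symmetric] by simp
  qed
  have q: "q V \<in> J n \<and> V \<subseteq> q V" if "V \<in> J (Suc n)" for V
  proof -
    obtain a where "V = U (Suc n) a" using \<open>V \<in> J (Suc n)\<close> by blast
    then show ?thesis using q_U[of a] refine[of n a] by simp
  qed
  define d where "d = (\<lambda>vs\<in>nerve (J (Suc n)) 1. c (map q vs))"
  have p: "refinement_projection (J n) (J (Suc n)) V \<in> J n \<and> V \<subseteq> refinement_projection (J n) (J (Suc n)) V"
    if "V \<in> J (Suc n)" for V
    using refinement_projection[OF J_step that] by blast
  have "refine1 n c \<in>
      coboundaries (J (Suc n)) 1 #>\<^bsub>cocycle_group (J (Suc n)) 1\<^esub> d"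
    unfolding cochain_pullback_def d_def by (rule contiguous_pullback[OF q p _ c]) auto
  note w = winding_coset[OF this]
  have sd: "jump (Suc n) d a = c [U n (a div 2), U n ((a + 1) div 2)]" for a
    using nerve_1[of "[U (Suc n) a, U (Suc n) (a + 1)]" "J (Suc n)"] nonempty[of "Suc n" a]
    by (simp add: jump_def d_def q_U)
  have even: "jump (Suc n) d (2 * b) = 0" for b
    using sd[of "2 * b"] cocycle_values(1)[OF c, of b] by simp
  have odd: "jump (Suc n) d (2 * b + 1) = jump n c b" for b
    using sd[of "2 * b + 1"] by (simp add: jump_def add.commute)
  have half: "sum (jump (Suc n) d) {2 * a..<2 * b} = sum (jump n c) {a..<b}" if "a \<le> b" for a b
    using that
  proof (induction b rule: int_ge_induct)
    case (step i)
    then have "{2 * a..<2 * (i + 1)} = insert (2 * i) (insert (2 * i + 1) {2 * a..<2 * i})" "{a..<i + 1} = insert i {a..<i}"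
      by auto
    then show ?case using step even[of i] odd[of i] by simp
  qed simp
  have F: "sum (jump n c) {a..<b} = potential (jump n c) b - potential (jump n c) a" if "a \<le> b" for a b
    using potential_diff[OF that] by simp
  have "right_winding (Suc n) d = sum (jump n c) {2 * 4 ^ n..<4 * 4 ^ n}"
    using half[of "2 * 4 ^ n" "4 * 4 ^ n"] by (simp add: right_winding_def)
  \<comment> \<open>Both ends are reached from 4^n, after 1 and after 3 turns.\<close>
  also have "\<dots> = 2 * right_winding n c"
    using potential_right[of n "4 ^ n" c 1] potential_right[of n "4 ^ n" c 3]
    by (subst F) (simp_all add: algebra_simps)
  finally show "right_winding (Suc n) (refine1 n c) = 2 * right_winding n c"
    using w by simp
  have "left_winding (Suc n) d = sum (jump n c) {- (4 * 4 ^ n)..<- (2 * 4 ^ n)}"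
    using half[of "- (4 * 4 ^ n)" "- (2 * 4 ^ n)"] by (simp add: left_winding_def)
  also have "\<dots> = 2 * left_winding n c"
    using potential_left[of "- (4 ^ n)" n c 1] potential_left[of "- (4 ^ n)" n c 3]
    by (subst F) (simp_all add: algebra_simps)
  finally show "left_winding (Suc n) (refine1 n c) = 2 * left_winding n c"
    using w by simp
qed

lemma winding_surj:
  assumes n: "n \<ge> 1"
  shows "\<exists>c\<in>Z1 n. right_winding n c = r \<and> left_winding n c = l"
proof -
  define M :: int where "M = 4 ^ n"
  have M: "M \<ge> 4"
  proof -
    have "(4::int) ^ 1 \<le> 4 ^ n" using n by (intro power_increasing) auto
    then show ?thesis by (simp add: M_def)
  qed
  \<comment> \<open>A step function that gains \<open>r\<close> per turn on the right and
    \<open>l\<close> per turn on the left. It is not invariant under gluing, but its differences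
    along edges are; this is \<open>wd\<close>.\<close>
  define F where "F = (\<lambda>a. if a \<ge> 0 then r * (a div M) else l * (a div M))"
  have F_right: "F (a + k * M) = F a + k * r" if "a \<ge> 0" "a + k * M \<ge> 0" for a k
    using that M by (simp add: F_def algebra_simps)
  have F_left: "F (a + k * M) = F a + k * l" if "a < 0" "a + k * M < 0" for a k
    using that M by (simp add: F_def algebra_simps)
  have wd: "F b' - F a' = F b - F a"
    if g: "glued M a a'" "glued M b b'" and near: "\<bar>b - a\<bar> \<le> 1" "\<bar>b' - a'\<bar> \<le> 1" for a b a' b'
  proof -
    have "M dvd a - a'" "M dvd b - b'" using g by (auto simp: glued_def)
    then have "M dvd (a - a') - (b - b')" by (rule dvd_diff)
    \<comment> \<open>The left side has absolute value at most 2, whereas \<open>M\<close> is at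
      least 4 because \<open>n \<ge> 1\<close>.\<close>
    then have e: "(a - a') - (b - b') = 0"
      by (rule dvd_small) (use near M in linarith)
    obtain k where k: "a' - a = M * k" using \<open>M dvd a - a'\<close> by (metis dvd_def dvd_diff_commute)
    have a': "a' = a + k * M" and b': "b' = b + k * M" using k e by (simp_all add: algebra_simps)
    show ?thesis
    proof (cases "a = a'")
      case True then show ?thesis using e by simp
    next
      case False
      then have "b \<noteq> b'" using e by simp
      then have "a \<ge> M \<and> a' \<ge> M \<and> b \<ge> 0 \<and> b' \<ge> 0 \<or> a \<le> - M \<and> a' \<le> - M \<and> b < 0 \<and> b' < 0"
        using g False near M unfolding glued_def by linarith
      then show ?thesis
      proof
        assume "a \<ge> M \<and> a' \<ge> M \<and> b \<ge> 0 \<and> b' \<ge> 0"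
        then show ?thesis using F_right[of a k] F_right[of b k] M unfolding a' b' by simp
      next
        assume "a \<le> - M \<and> a' \<le> - M \<and> b < 0 \<and> b' < 0"
        then show ?thesis using F_left[of a k] F_left[of b k] M unfolding a' b' by simp
      qed
    qed
  qed
  define D where "D = (\<lambda>u v. SOME m. \<exists>a b. u = U n a \<and> v = U n b \<and> \<bar>b - a\<bar> \<le> 1 \<and> m = F b - F a)"
  have D: "D (U n a) (U n b) = F b - F a" if near: "\<bar>b - a\<bar> \<le> 1" for a b
    unfolding D_def
  proof (rule some_equality)
    show "\<exists>a' b'. U n a = U n a' \<and> U n b = U n b' \<and> \<bar>b' - a'\<bar> \<le> 1 \<and> F b - F a = F b' - F a'"
      using near by blast
    fix m assume "\<exists>a' b'. U n a = U n a' \<and> U n b = U n b' \<and> \<bar>b' - a'\<bar> \<le> 1 \<and> m = F b' - F a'"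
    then show "m = F b - F a" using wd near unfolding eq_iff M_def by metis
  qed
  define c where "c = (\<lambda>us\<in>nerve (J n) 1. D (us ! 0) (us ! 1))"
  have c_eq: "c [u, v] = D u v" if "u \<in> J n" "v \<in> J n" "u \<inter> v \<noteq> {}" for u v
    using that nerve_1[of "[u, v]" "J n"] by (simp add: c_def)
  have "c \<in> Z1 n"
    unfolding cocycle_1_iff
  proof (intro conjI allI impI)
    show "c \<in> (\<Pi>\<^sub>E us\<in>nerve (J n) 1. UNIV)" by (simp add: c_def)
    fix u v w assume a: "u \<in> J n \<and> v \<in> J n \<and> w \<in> J n \<and> u \<inter> v \<inter> w \<noteq> {}"
    then obtain x where x: "x \<in> \<Inter>{u, v, w}" by auto
    obtain e where e: "{u, v, w} \<subseteq> {U n e, U n (e + 1)}"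
      using nerve_elements[of "{u, v, w}" n x] a x by auto
    define h where "h = (\<lambda>s. if s = U n e then e else e + 1)"
    have h: "s = U n (h s)" "h s = e \<or> h s = e + 1" if "s \<in> {u, v, w}" for s
      using that e by (auto simp: h_def)
    have D': "D s t = F (h t) - F (h s)" if "s \<in> {u, v, w}" "t \<in> {u, v, w}" for s t
      using D[of "h t" "h s"] h[OF that(1)] h[OF that(2)] by auto
    have "c [u, w] = D u w" "c [u, v] = D u v" "c [v, w] = D v w"
      using a by (auto intro!: c_eq)
    then show "c [u, w] = c [u, v] + c [v, w]" by (simp add: D')
  qed
  moreover have s: "jump n c a = F (a + 1) - F a" for a
    unfolding jump_def using c_eq[of "U n a" "U n (a + 1)"] nonempty[of n a] D[of "a + 1" a] by simp
  have tel: "sum (jump n c) {a..<b} = F b - F a" if "a \<le> b" for a b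
    using that
  proof (induction b rule: int_ge_induct)
    case (step i)
    then have "{a..<i + 1} = insert i {a..<i}" by auto
    then show ?case using step s by simp
  qed simp
  have "right_winding n c = r"
    using tel[of M "2 * M"] M by (simp add: right_winding_def F_def flip: M_def)
  moreover have "left_winding n c = l"
    using tel[of "- 2 * M" "- M"] nonzero_mult_div_cancel_right[of M "- 1"]
      nonzero_mult_div_cancel_right[of M "- 2"] M by (simp add: left_winding_def F_def flip: M_def)
  ultimately show ?thesis by blast
qed

text \<open>Windings double under each refinement, so it is their quotients by 2^n that are
  compatible with the pullbacks.\<close>

theorem cech_1: "cech_cohomology 1 X \<cong> dyadic_group \<times>\<times> dyadic_group"
proof -
  define E :: "nat \<Rightarrow> ('a set list \<Rightarrow> int) \<Rightarrow> rat \<times> rat" where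
    "E = (\<lambda>n c. (of_int (right_winding n c) / 2 ^ n, of_int (left_winding n c) / 2 ^ n))"
  show ?thesis
  proof (rule cech_cohomology_iso[where J = J and E = E])
    show "group (dyadic_group \<times>\<times> dyadic_group)"
      by (rule DirProd_group[OF group_dyadic group_dyadic])
    show "E m \<in> hom (cocycle_group (J m) 1) (dyadic_group \<times>\<times> dyadic_group)" for m
      by (rule homI)
        (simp_all add: E_def dyadic_mem winding_mult del: One_nat_def,
         simp add: dyadic_group_def add_divide_distrib)
    show "E m z = \<one>\<^bsub>dyadic_group \<times>\<times> dyadic_group\<^esub> \<longleftrightarrow> z \<in> coboundaries (J m) 1"
      if "z \<in> Z1 m" for m z
      using coboundary_windings[of z m] windings_zero_imp_coboundary[OF that]
      by (auto simp: E_def dyadic_group_def)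
    show "E (Suc m) (refine1 m z) = E m z"
      if "z \<in> Z1 m" for m z
      using winding_refine[OF that] by (simp add: E_def)
    show "\<exists>m. \<exists>z\<in>Z1 m. E m z = y"
      if y: "y \<in> carrier (dyadic_group \<times>\<times> dyadic_group)" for y
    proof -
      obtain a k b l where y: "y = (of_int a / 2 ^ k, of_int b / 2 ^ l)"
        using y by (auto simp: dyadic_group_def)
      \<comment> \<open>A common denominator for both coordinates; the successor secures
        \<open>n \<ge> 1\<close> for \<open>winding_surj\<close>.\<close>
      define n where "n = Suc (k + l)"
      obtain z where z: "z \<in> Z1 n"
        "right_winding n z = a * 2 ^ Suc l" "left_winding n z = b * 2 ^ Suc k"
        using winding_surj[of n "a * 2 ^ Suc l" "b * 2 ^ Suc k"] by (auto simp: n_def)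
      then have "E n z = y"
        unfolding y E_def by (simp add: n_def power_add field_simps)
      then show ?thesis using z(1) by blast
    qed
  qed (simp_all add: J_cover J_step cofinal)
qed

text \<open>Consecutive members meet, so a 0-cocycle is constant along the chain of all labels and
  is determined by its value at label 0.\<close>

theorem cech_0: "cech_cohomology 0 X \<cong> integer_group"
proof -
  have const: "f [U n a] = f [U n 0]" if f: "f \<in> carrier (cocycle_group (J n) 0)" for f n a
  proof (induction a rule: int_induct[where k = 0])
    case (step1 i)
    have "f [U n i] = f [U n (i + 1)]" using f nonempty[of n i] unfolding cocycle_0_iff by blast
    then show ?case using step1 by simp
  next
    case (step2 i)
    have "f [U n (i - 1)] = f [U n (i - 1 + 1)]" using f nonempty[of n "i - 1"] unfolding cocycle_0_iff by blast
    then show ?case using step2 by simp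
  qed simp
  have n0: "[U n a] \<in> nerve (J n) 0" for n a using nonempty_U by (auto simp: nerve_0)
  show ?thesis
  proof (rule cech_cohomology_iso[where J = J and E = "\<lambda>n f. f [U n 0]"])
    show "(\<lambda>f. f [U m 0]) \<in> hom (cocycle_group (J m) 0) integer_group" for m
      using n0 by (intro homI) (simp_all add: mult_cocycle_group)
    show "z [U m 0] = \<one>\<^bsub>integer_group\<^esub> \<longleftrightarrow> z \<in> coboundaries (J m) 0"
      if z: "z \<in> carrier (cocycle_group (J m) 0)" for m z
    proof -
      have "z us = 0" if zero: "z [U m 0] = 0" and us: "us \<in> nerve (J m) 0" for us
      proof -
        obtain a where "us = [U m a]" using us unfolding nerve_0 by blast
        then show ?thesis using const[OF z, of a] zero by simp
      qed
      moreover have "z us = undefined" if "us \<notin> nerve (J m) 0" for us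
        using z that unfolding cocycle_0_iff by (blast intro: PiE_arb)
      ultimately show ?thesis
        using n0[of m 0] by (auto simp: coboundaries_def one_cochain_group fun_eq_iff restrict_def)
    qed
    show "cochain_pullback (J m) (J (Suc m)) 0 z [U (Suc m) 0] = z [U m 0]"
      if z: "z \<in> carrier (cocycle_group (J m) 0)" for m z
    proof -
      have "refinement_projection (J m) (J (Suc m)) (U (Suc m) 0) \<in> J m"
        using refinement_projection[OF J_step] by blast
      then obtain b where "refinement_projection (J m) (J (Suc m)) (U (Suc m) 0) = U m b" by blast
      then show ?thesis using n0[of "Suc m" 0] const[OF z, of b] by (simp add: cochain_pullback_def)
    qed
    show "\<exists>m. \<exists>z\<in>carrier (cocycle_group (J m) 0). z [U m 0] = y" for y :: int
    proof (intro exI bexI)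
      show "(\<lambda>us\<in>nerve (J 0) 0. y) [U 0 0] = y" using n0 by simp
      show "(\<lambda>us\<in>nerve (J 0) 0. y) \<in> carrier (cocycle_group (J 0) 0)"
        unfolding cocycle_0_iff by (auto simp: nerve_0 restrict_def)
    qed
  qed (simp_all add: J_cover J_step cofinal)
qed

end

section \<open>The fixed point of the substitution\<close>

text \<open>\<open>child b x y\<close> is the arrow at position \<open>(x, y)\<close> of the doubled tile \<open>b\<close>, where \<open>(0, 0)\<close> is the
  bottom-left square.\<close>

definition child :: "arrow \<Rightarrow> int \<Rightarrow> int \<Rightarrow> arrow" where
  "child b x y =
     (if x = y then (if x = 1 then (if b = NE then NE else SW) else (if b = SW then SW else NE))
      else if x = 0 then (if b = NW then NW else SE) else (if b = SE then SE else NW))"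

text \<open>The effect of \<open>reflect_diag\<close> on arrows, as
  \<open>arrow_act_reflect_diag\<close> confirms.\<close>

fun swp :: "arrow \<Rightarrow> arrow" where
  "swp NE = NE" | "swp NW = SE" | "swp SW = SW" | "swp SE = NW"

lemma swp_swp [simp]: "swp (swp a) = a"
  by (cases a) auto

lemma swp_child: "x \<in> {0, 1} \<Longrightarrow> y \<in> {0, 1} \<Longrightarrow> swp (child b x y) = child (swp b) y x"
  by (cases b) (auto simp: child_def)

text \<open>This lets symmetry pass from tiles to their parents, once the alignment of the parents
  is known.\<close>

lemma child_inj:
  assumes "\<And>x y. x \<in> {0, 1} \<Longrightarrow> y \<in> {0, 1} \<Longrightarrow> child a x y = child b x y"
  shows "a = b"
  using assms[of 0 0] assms[of 0 1] assms[of 1 0] assms[of 1 1]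
  by (cases a; cases b) (auto simp: child_def)

text \<open>Halving has the two fixed points 0 and -1, one on each side of an axis.
  \<open>height\<close> vanishes exactly there and drops under halving everywhere else, so it serves
  as the termination measure of \<open>chair\<close>.\<close>

definition height :: "int \<Rightarrow> int" where
  "height i = (if i \<ge> 0 then i else - 1 - i)"

lemma height_nonneg: "height i \<ge> 0"
  by (simp add: height_def)

lemma height_div_2: "height (i div 2) \<le> height i"
  unfolding height_def by presburger

lemma height_div_2_less: "i \<noteq> 0 \<Longrightarrow> i \<noteq> - 1 \<Longrightarrow> height (i div 2) < height i"
  unfolding height_def by presburger

text \<open>The labels of the tiling of the plane whose four quadrants are the infinite-order supertiles
  pointing away from the origin; the tile \<open>(i, j)\<close> has its lower left corner at \<open>(i, j)\<close>.\<close>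

function chair :: "int \<Rightarrow> int \<Rightarrow> arrow" where
  "chair i j =
     (if (i = 0 \<or> i = - 1) \<and> (j = 0 \<or> j = - 1)
      then (if i = 0 then (if j = 0 then NE else SE) else (if j = 0 then NW else SW))
      else child (chair (i div 2) (j div 2)) (i mod 2) (j mod 2))"
  by auto
termination
proof (relation "Wellfounded.measure (\<lambda>(i, j). nat (height i + height j))")
  fix i j :: int
  assume "\<not> ((i = 0 \<or> i = - 1) \<and> (j = 0 \<or> j = - 1))"
  then have "height (i div 2) + height (j div 2) < height i + height j"
    using height_div_2[of i] height_div_2[of j] height_div_2_less[of i] height_div_2_less[of j]
    by linarith
  then show "((i div 2, j div 2), i, j) \<in> Wellfounded.measure (\<lambda>(i, j). nat (height i + height j))"
    using height_nonneg[of "i div 2"] height_nonneg[of "j div 2"] by simp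
qed simp

declare chair.simps [simp del]

lemma chair_seed: "chair 0 0 = NE" "chair (- 1) 0 = NW" "chair (- 1) (- 1) = SW" "chair 0 (- 1) = SE"
  by (subst chair.simps, simp)+

text \<open>Each of the four seeds reproduces its own arrow in the child that touches the origin, so
  the recursion extends to the seeds and the labelling is a fixed point of the substitution.\<close>

lemma chair_rec: "chair i j = child (chair (i div 2) (j div 2)) (i mod 2) (j mod 2)"
proof (cases "(i = 0 \<or> i = - 1) \<and> (j = 0 \<or> j = - 1)")
  case True then show ?thesis by (auto simp: chair_seed child_def)
next
  case False then show ?thesis by (subst chair.simps) (simp only: if_False)
qed

lemma mod_2_int: "i mod (2::int) \<in> {0, 1}"
  by auto

lemma chair_induct [case_names seed step]:
  fixes i j :: int
  assumes "\<And>i j. (i = 0 \<or> i = - 1) \<Longrightarrow> (j = 0 \<or> j = - 1) \<Longrightarrow> P i j"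
    and "\<And>i j. \<not> ((i = 0 \<or> i = - 1) \<and> (j = 0 \<or> j = - 1)) \<Longrightarrow> P (i div 2) (j div 2) \<Longrightarrow> P i j"
  shows "P i j"
  using assms by (induction i j rule: chair.induct) blast

lemma chair_swap: "chair j i = swp (chair i j)"
proof (induction i j rule: chair_induct)
  case (seed i j) then show ?case by (auto simp: chair_seed)
next
  case (step i j)
  then show ?case using swp_child[OF mod_2_int mod_2_int] chair_rec by metis
qed

lemma chair_parity: "chair i j \<in> {NE, SW} \<longleftrightarrow> even (i - j)"
  by (subst chair_rec) (auto simp: child_def; presburger)

lemma chair_diag: "chair i i = (if i \<ge> 0 then NE else SW)"
proof -
  have "i = j \<Longrightarrow> chair i j = (if i \<ge> 0 then NE else SW)" for i j
  proof (induction i j rule: chair_induct)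
    case (seed i j) then show ?case by (auto simp: chair_seed)
  next
    case (step i j)
    then have "chair (i div 2) (i div 2) = (if i \<ge> 0 then NE else SW)" by simp
    moreover have "i mod 2 = 0 \<or> i mod 2 = 1" by auto
    ultimately show ?case using step.prems by (subst chair_rec) (auto simp: child_def)
  qed
  then show ?thesis by blast
qed

lemma chair_above_diag: "chair i (i + 1) = (if i = - 1 then NW else SE)"
proof -
  have "j = i + 1 \<Longrightarrow> chair i j = (if i = - 1 then NW else SE)" for i j
  proof (induction i j rule: chair_induct)
    case (seed i j) then show ?case by (auto simp: chair_seed)
  next
    case (step i j)
    show ?case
    proof (cases "even i")
      case True
      then have "j div 2 = i div 2" "i mod 2 = 0" "j mod 2 = 1" "i \<noteq> - 1" using step.prems by presburger+
      then show ?thesis by (subst chair_rec) (simp add: child_def chair_diag)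
    next
      case False
      then have "j div 2 = i div 2 + 1" "i mod 2 = 1" "j mod 2 = 0" using step.prems by presburger+
      moreover have "i \<noteq> - 1" "i div 2 \<noteq> - 1" using step.hyps step.prems False by presburger+
      ultimately show ?thesis using step.IH by (subst chair_rec) (simp add: child_def)
    qed
  qed
  then show ?thesis by blast
qed

text \<open>The parent of \<open>(i, i + 2)\<close> sits next to the diagonal and carries NW or SE;
  the diagonal children of such a tile reveal their corner, NE at the lower left and SW at the upper
  right. Both diagonal children of NE are NE and those of SW are SW, so each further doubling passes
  the digit on.\<close>

lemma chair_bit: "chair i (i + 2 ^ Suc k) = (if odd (i div 2 ^ k) then SW else NE)"
proof (induction k arbitrary: i)
  case 0
  have "chair (i div 2) (i div 2 + 1) \<notin> {NE, SW}" by (subst chair_parity) simp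
  moreover have "(i + 2) div 2 = i div 2 + 1" "(i + 2) mod 2 = i mod 2" by simp_all
  ultimately show ?case
    by (subst chair_rec) (auto simp: child_def odd_iff_mod_2_eq_one)
next
  case (Suc k)
  have e: "(i + 2 ^ Suc (Suc k)) div 2 = i div 2 + 2 ^ Suc k" "(i + 2 ^ Suc (Suc k)) mod 2 = i mod 2"
    by (simp_all add: mod_add_eq[symmetric] flip: mult.assoc)
  have d: "i div 2 div 2 ^ k = i div 2 ^ Suc k" by (simp add: zdiv_zmult2_eq)
  have m: "i mod 2 = 0 \<or> i mod 2 = 1" by auto
  have "chair i (i + 2 ^ Suc (Suc k)) = child (chair (i div 2) (i div 2 + 2 ^ Suc k)) (i mod 2) (i mod 2)"
    by (subst chair_rec) (simp only: e)
  also have "\<dots> = child (if odd (i div 2 ^ Suc k) then SW else NE) (i mod 2) (i mod 2)"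
    by (simp only: Suc d)
  finally show ?case using m by (auto simp: child_def)
qed

text \<open>The arrow at \<open>(i, j)\<close> inside an order-\<open>n\<close> supertile of type
  \<open>b\<close>; only the last \<open>n\<close> binary digits of the coordinates enter.\<close>

fun descendant :: "nat \<Rightarrow> arrow \<Rightarrow> int \<Rightarrow> int \<Rightarrow> arrow" where
  "descendant 0 b i j = b"
| "descendant (Suc n) b i j = child (descendant n b (i div 2) (j div 2)) (i mod 2) (j mod 2)"

lemma chair_descendant: "chair i j = descendant n (chair (i div 2 ^ n) (j div 2 ^ n)) i j"
proof (induction n arbitrary: i j)
  case (Suc n)
  have "a div 2 div 2 ^ n = a div 2 ^ Suc n" for a :: int by (simp add: zdiv_zmult2_eq)
  then show ?case using Suc[of "i div 2" "j div 2"] by (subst chair_rec) simp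
qed simp

lemma descendant_periodic: "descendant n b (i + 2 ^ n * k) (j + 2 ^ n * l) = descendant n b i j"
proof (induction n arbitrary: i j)
  case (Suc n)
  have "(a + 2 ^ Suc n * k) div 2 = a div 2 + 2 ^ n * k" "(a + 2 ^ Suc n * k) mod 2 = a mod 2" for a k :: int
  proof -
    have "(a + 2 * m) div 2 = a div 2 + m" "(a + 2 * m) mod 2 = a mod 2" for m :: int
      by simp_all
    from this[of "2 ^ n * k"]
    show "(a + 2 ^ Suc n * k) div 2 = a div 2 + 2 ^ n * k" "(a + 2 ^ Suc n * k) mod 2 = a mod 2"
      by (simp_all only: power_Suc mult.assoc)
  qed
  then show ?case using Suc by simp
qed simp

lemma div_close:
  fixes i j d :: int
  assumes "\<bar>i - j\<bar> \<le> d" "d > 0" shows "\<bar>i div d - j div d\<bar> \<le> 1"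
proof -
  have "i div d \<le> j div d + 1"
  proof -
    have "i div d \<le> (j + d) div d" using assms by (intro zdiv_mono1) auto
    then show ?thesis using assms by simp
  qed
  moreover have "j div d \<le> i div d + 1"
  proof -
    have "j div d \<le> (i + d) div d" using assms by (intro zdiv_mono1) auto
    then show ?thesis using assms by simp
  qed
  ultimately show ?thesis by linarith
qed

lemma chair_near_diag_nonneg:
  assumes "P \<ge> 0" "Q \<ge> 0" "\<bar>P - Q\<bar> \<le> 1"
  shows "chair P Q = (if P = Q then NE else if P < Q then SE else NW)"
proof -
  consider "P = Q" | "Q = P + 1" | "P = Q + 1" using assms(3) by linarith
  then show ?thesis
    using chair_above_diag[of P] chair_above_diag[of Q] chair_swap[of P Q] chair_diag[of P] assms
    by cases auto
qed

lemma chair_near_diag_neg: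
  assumes "P < 0" "Q < 0" "\<bar>P - Q\<bar> \<le> 1"
  shows "chair P Q = (if P = Q then SW else if P < Q then SE else NW)"
proof -
  consider "P = Q" | "Q = P + 1" | "P = Q + 1" using assms(3) by linarith
  then show ?thesis
    using chair_above_diag[of P] chair_above_diag[of Q] chair_swap[of P Q] chair_diag[of P] assms
    by cases auto
qed

text \<open>Within distance 2^n of the diagonal the order-\<open>n\<close> supertiles involved lie
  on the diagonal or next to it. Away from the origin their arrows depend only on the side of the
  diagonal and on the sign, so a shift by a multiple of 2^n that keeps the sign changes
  nothing.\<close>

lemma chair_periodic:
  assumes near: "\<bar>i - j\<bar> \<le> 2 ^ n"
    and sgn: "(i \<ge> 0 \<and> j \<ge> 0 \<and> i + 2 ^ n * k \<ge> 0 \<and> j + 2 ^ n * k \<ge> 0) \<or>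
      (i < 0 \<and> j < 0 \<and> i + 2 ^ n * k < 0 \<and> j + 2 ^ n * k < 0)"
  shows "chair (i + 2 ^ n * k) (j + 2 ^ n * k) = chair i j"
proof -
  define P Q where "P = i div 2 ^ n" and "Q = j div 2 ^ n"
  have PQ': "(i + 2 ^ n * k) div 2 ^ n = P + k" "(j + 2 ^ n * k) div 2 ^ n = Q + k"
    by (simp_all add: P_def Q_def)
  have PQ: "\<bar>P - Q\<bar> \<le> 1" unfolding P_def Q_def by (rule div_close[OF near]) simp
  have "(P \<ge> 0 \<and> Q \<ge> 0 \<and> P + k \<ge> 0 \<and> Q + k \<ge> 0) \<or> (P < 0 \<and> Q < 0 \<and> P + k < 0 \<and> Q + k < 0)"
  proof -
    have sg: "a div 2 ^ n \<ge> 0 \<longleftrightarrow> a \<ge> 0" "a div 2 ^ n < 0 \<longleftrightarrow> a < 0" for a :: int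
      by (simp_all add: pos_imp_zdiv_nonneg_iff pos_imp_zdiv_neg_iff)
    show ?thesis
      using sgn sg[of i] sg[of j] sg[of "i + 2 ^ n * k"] sg[of "j + 2 ^ n * k"]
      by (simp only: PQ' P_def[symmetric] Q_def[symmetric])
  qed
  then have "chair (P + k) (Q + k) = chair P Q"
    using PQ chair_near_diag_nonneg[of P Q] chair_near_diag_neg[of P Q]
      chair_near_diag_nonneg[of "P + k" "Q + k"] chair_near_diag_neg[of "P + k" "Q + k"] by auto
  then show ?thesis
    unfolding chair_descendant[of "i + 2 ^ n * k" "j + 2 ^ n * k" n] chair_descendant[of i j n] PQ'
    by (simp add: descendant_periodic P_def Q_def)
qed

section \<open>Blocks of four tiles and symmetric patches\<close>

definition block :: "int \<Rightarrow> int \<Rightarrow> arrow list" where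
  "block P Q = [chair P Q, chair (P + 1) Q, chair P (Q + 1), chair (P + 1) (Q + 1)]"

definition child_block :: "arrow \<Rightarrow> arrow list" where
  "child_block b = [child b 0 0, child b 1 0, child b 0 1, child b 1 1]"

lemma block_even: "block (2 * p) (2 * q) = child_block (chair p q)"
  unfolding block_def child_block_def
  by (subst (1 2 3 4) chair_rec) (simp add: add.commute[of _ 1])

lemma block_odd: "block (2 * p - 1) (2 * q - 1) =
  [child (chair (p - 1) (q - 1)) 1 1, child (chair p (q - 1)) 0 1,
   child (chair (p - 1) q) 1 0, child (chair p q) 0 0]"
proof -
  have "(2 * p - 1) div 2 = p - 1" "(2 * p - 1) mod 2 = 1" for p :: int by presburger+
  then show ?thesis
    unfolding block_def by (subst (1 2 3 4) chair_rec) simp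
qed

text \<open>At even coordinates the block is a doubled tile. At odd coordinates it meets four
  parents: if those on its diagonal carry NE or SW, it repeats the block of the parents and
  induction applies; otherwise all four arrows point away from the centre.\<close>

lemma block_cases:
  assumes "even (P - Q)"
  shows "block P Q = [SW, SE, NW, NE] \<or> (\<exists>b. block P Q = child_block b)"
  using assms
proof (induction P Q rule: chair_induct)
  case (seed P Q)
  then have "(P = 0 \<and> Q = 0) \<or> (P = -1 \<and> Q = -1)" by auto
  then show ?case
  proof
    assume "P = 0 \<and> Q = 0" then show ?thesis using block_even[of 0 0] by auto
  next
    assume "P = -1 \<and> Q = -1" then show ?thesis by (simp add: block_def chair_seed)
  qed
next
  case (step P Q)
  show ?case
  proof (cases "even P")
    case True
    then obtain p where p: "P = 2 * p" by blast
    have "even Q" using True step.prems by simp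
    then obtain q where q: "Q = 2 * q" by blast
    then show ?thesis using block_even p q by blast
  next
    case False
    then have "P = 2 * ((P + 1) div 2) - 1" by presburger
    then obtain p where p: "P = 2 * p - 1" by blast
    have "odd Q" using False step.prems by simp
    then have "Q = 2 * ((Q + 1) div 2) - 1" by presburger
    then obtain q where q: "Q = 2 * q - 1" by blast
    have d: "P div 2 = p - 1" "Q div 2 = q - 1" using p q by presburger+
    show ?thesis
    proof (cases "even (p - q)")
      case True
      then have "block (p - 1) (q - 1) = [SW, SE, NW, NE] \<or> (\<exists>b. block (p - 1) (q - 1) = child_block b)"
        using step.IH unfolding d by simp
      moreover have "block P Q = block (p - 1) (q - 1)"
      proof -
        have "chair (p - 1) (q - 1) \<in> {NE, SW}" "chair p q \<in> {NE, SW}"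
          using True by (subst chair_parity; simp)+
        moreover have "chair p (q - 1) \<notin> {NE, SW}" "chair (p - 1) q \<notin> {NE, SW}"
          using True by (subst chair_parity; simp)+
        ultimately show ?thesis
          unfolding p q block_odd unfolding block_def
          by (cases "chair (p - 1) (q - 1)"; cases "chair p q"; cases "chair p (q - 1)"; cases "chair (p - 1) q")
            (simp_all add: child_def)
      qed
      ultimately show ?thesis by simp
    next
      case False
      have "chair (p - 1) (q - 1) \<notin> {NE, SW}" "chair p q \<notin> {NE, SW}"
        using False by (subst chair_parity; simp)+
      moreover have "chair p (q - 1) \<in> {NE, SW}" "chair (p - 1) q \<in> {NE, SW}"
        using False by (subst chair_parity; simp)+
      ultimately have "block P Q = [SW, SE, NW, NE]"
        unfolding p q block_odd by (auto simp: child_def)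
      then show ?thesis ..
    qed
  qed
qed

text \<open>Among the doubled tiles the reflection leaves only NE and SW. These two and the outward
  block all occur on the diagonal, at 0, -2 and -1.\<close>

lemma symmetric_block:
  assumes "even (P - Q)" and sym: "chair (P + 1) Q = swp (chair P (Q + 1))"
  shows "\<exists>t. block P Q = block t t"
proof -
  have "block 0 0 = child_block NE" "block (- 2) (- 2) = child_block SW"
    using block_even[of 0 0] block_even[of "- 1" "- 1"] by (simp_all add: chair_seed)
  moreover have "block (- 1) (- 1) = [SW, SE, NW, NE]" by (simp add: block_def chair_seed)
  moreover have "b = NE \<or> b = SW" if "block P Q = child_block b" for b
    using that sym by (cases b) (auto simp: block_def child_block_def child_def)
  ultimately show ?thesis using block_cases[OF assms(1)] by metis
qed

text \<open>Taking parents \<open>m\<close> times reduces a symmetric patch to a symmetric block of four tiles.\<close>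

lemma symmetric_patch:
  fixes p q :: int
  assumes "\<And>i j. i \<in> {1 - 2 ^ (m + 1)..2 ^ (m + 2) - 1} \<Longrightarrow> j \<in> {1 - 2 ^ (m + 1)..2 ^ (m + 2) - 1} \<Longrightarrow>
    chair (p + j) (q + i) = swp (chair (p + i) (q + j))"
  shows "\<exists>t. \<forall>i\<in>{0..2 ^ m}. \<forall>j\<in>{0..2 ^ m}. chair (p + i) (q + j) = chair (t + i) (t + j)"
  using assms
proof (induction m arbitrary: p q)
  case 0
  have "chair p q = swp (chair p q)" using "0"[of 0 0] by simp
  then have "chair p q \<in> {NE, SW}" by (cases "chair p q") auto
  then have "even (p - q)" by (simp only: chair_parity)
  moreover have "chair (p + 1) q = swp (chair p (q + 1))" using "0"[of 0 1] by simp
  ultimately obtain t where "block p q = block t t" using symmetric_block by blast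
  moreover have "i \<in> {0..2 ^ 0} \<longleftrightarrow> i = 0 \<or> i = 1" for i :: int by auto
  ultimately show ?case by (auto simp: block_def intro!: exI[of _ t])
next
  case (Suc m)
  have "(1::int) \<le> 2 ^ m" by simp
  then have "(1::int) \<le> 4 * 2 ^ m" by linarith
  \<comment> \<open>Symmetry at the corner forces NE or SW there; hence \<open>p\<close> and
    \<open>q\<close> have equal parity and one offset \<open>e\<close> aligns both coordinates with
    the parents.\<close>
  then have "chair p q = swp (chair p q)" using Suc.prems[of 0 0] by simp
  then have "chair p q \<in> {NE, SW}" by (cases "chair p q") auto
  then have even: "even (p - q)" by (simp only: chair_parity)
  define e p' q' where "e = p mod 2" and "p' = p div 2" and "q' = q div 2"
  have e: "e = 0 \<or> e = 1" unfolding e_def by auto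
  have pq: "p = 2 * p' + e" "q = 2 * q' + e" using even unfolding e_def p'_def q'_def by presburger+
  have dm: "(2 * a + e + i) div 2 = a + (e + i) div 2" "(2 * a + e + i) mod 2 = (e + i) mod 2" for a i :: int
    by presburger+
  have parent: "chair (2 * a + e + i) (2 * b + e + j) = child (chair (a + (e + i) div 2) (b + (e + j) div 2)) ((e + i) mod 2) ((e + j) mod 2)"
    for a b i j
    by (subst chair_rec) (simp only: dm)
  have "\<exists>t. \<forall>i\<in>{0..2 ^ m}. \<forall>j\<in>{0..2 ^ m}. chair (p' + i) (q' + j) = chair (t + i) (t + j)"
  proof (rule Suc.IH)
    fix i j :: int
    assume i: "i \<in> {1 - 2 ^ (m + 1)..2 ^ (m + 2) - 1}" and j: "j \<in> {1 - 2 ^ (m + 1)..2 ^ (m + 2) - 1}"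
    show "chair (p' + j) (q' + i) = swp (chair (p' + i) (q' + j))"
    proof (rule child_inj)
      fix x y :: int assume xy: "x \<in> {0, 1}" "y \<in> {0, 1}"
      \<comment> \<open>The positions, relative to \<open>p\<close> and \<open>q\<close>, of a child
        of the parent tile. The window bounds are made for this step: 2 (1 - 2^(m+1)) - 1 = 1 -
        2^(m+2) and 2 (2^(m+2) - 1) + 1 = 2^(m+3) - 1.\<close>
      define i1 j1 where "i1 = 2 * i - e + y" and "j1 = 2 * j - e + x"
      have in1: "i1 \<in> {1 - 2 ^ (Suc m + 1)..2 ^ (Suc m + 2) - 1}" "j1 \<in> {1 - 2 ^ (Suc m + 1)..2 ^ (Suc m + 2) - 1}"
        using i j e xy by (auto simp: i1_def j1_def)
      have d: "(e + i1) div 2 = i" "(e + i1) mod 2 = y" "(e + j1) div 2 = j" "(e + j1) mod 2 = x"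
        using xy by (auto simp: i1_def j1_def)
      have "child (chair (p' + j) (q' + i)) x y = chair (p + j1) (q + i1)"
        unfolding pq parent d ..
      also have "\<dots> = swp (chair (p + i1) (q + j1))" using Suc.prems[OF in1] .
      also have "\<dots> = swp (child (chair (p' + i) (q' + j)) y x)" unfolding pq parent d ..
      also have "\<dots> = child (swp (chair (p' + i) (q' + j))) x y" using xy by (simp add: swp_child)
      finally show "child (chair (p' + j) (q' + i)) x y = child (swp (chair (p' + i) (q' + j))) x y" .
    qed
  qed
  then obtain t where t: "\<forall>i\<in>{0..2 ^ m}. \<forall>j\<in>{0..2 ^ m}. chair (p' + i) (q' + j) = chair (t + i) (t + j)" by blast
  show ?case
  proof (intro exI[of _ "2 * t + e"] ballI)
    fix i j :: int assume ij: "i \<in> {0..2 ^ Suc m}" "j \<in> {0..2 ^ Suc m}"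
    have b: "(e + i) div 2 \<in> {0..2 ^ m}" if "i \<in> {0..2 ^ Suc m}" for i using that e by auto
    show "chair (p + i) (q + j) = chair (2 * t + e + i) (2 * t + e + j)"
      unfolding pq parent using t b ij by metis
  qed
qed

section \<open>Recovering a diagonal position from a window\<close>

lemma mod_eq_of_bits:
  fixes s t :: int
  assumes "\<And>k. k < m \<Longrightarrow> odd (s div 2 ^ k) = odd (t div 2 ^ k)"
  shows "2 ^ m dvd s - t"
proof -
  have "s mod 2 ^ m = t mod 2 ^ m" using assms
  proof (induction m)
    case (Suc m)
    have "a mod 2 ^ Suc m = 2 ^ m * (a div 2 ^ m mod 2) + a mod 2 ^ m" for a :: int
      using zmod_zmult2_eq[of 2 a "2 ^ m"] by (simp add: mult.commute)
    moreover have "s div 2 ^ m mod 2 = t div 2 ^ m mod 2"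
      using Suc.prems[of m] by (simp add: mod_2_eq_odd)
    ultimately show ?case using Suc by simp
  qed simp
  then show ?thesis by (simp add: mod_eq_dvd_iff)
qed

text \<open>The arrows at distances 2, 4, ..., 2^m above the centre show its \<open>m\<close> lowest
  binary digits by \<open>chair_bit\<close>; the arrows on the diagonal show on which side of the
  origin each of its tiles lies.\<close>

lemma chair_recognize:
  fixes s t :: int
  assumes agree: "\<And>i j. \<bar>i\<bar> \<le> 2 ^ m \<Longrightarrow> \<bar>j\<bar> \<le> 2 ^ m \<Longrightarrow> chair (s + i) (s + j) = chair (t + i) (t + j)"
  shows "s = t \<or> (2 ^ m dvd s - t \<and> (s \<ge> 2 ^ m \<and> t \<ge> 2 ^ m \<or> s < - (2 ^ m) \<and> t < - (2 ^ m)))"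
proof (cases "s = t")
  case False
  have dvd: "2 ^ m dvd s - t"
  proof (rule mod_eq_of_bits)
    fix k assume "k < m"
    then have "(2::int) ^ Suc k \<le> 2 ^ m" by (intro power_increasing) auto
    then have "chair s (s + 2 ^ Suc k) = chair t (t + 2 ^ Suc k)"
      using agree[of 0 "2 ^ Suc k"] by simp
    then show "odd (s div 2 ^ k) = odd (t div 2 ^ k)" unfolding chair_bit by (auto split: if_splits)
  qed
  have sgn: "s + i \<ge> 0 \<longleftrightarrow> t + i \<ge> 0" if "\<bar>i\<bar> \<le> 2 ^ m" for i
    using agree[OF that that] unfolding chair_diag by (auto split: if_splits)
  have one: "(1::int) \<le> 2 ^ m" by simp
  \<comment> \<open>If \<open>- s\<close> and \<open>- s - 1\<close> are both admissible offsets,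
    the window contains the change from SW to NE, which locates the origin and forces
    \<open>s = t\<close>. Requiring both gives the asymmetric bounds.\<close>
  have S: "s \<ge> 2 ^ m \<or> s < - (2 ^ m)"
    using sgn[of "- s"] sgn[of "- s - 1"] False one by linarith
  have T: "t \<ge> 2 ^ m \<or> t < - (2 ^ m)"
    using sgn[of "- t"] sgn[of "- t - 1"] False one by linarith
  show ?thesis using dvd S T sgn[of 0] one by auto
qed simp

section \<open>Legal patches\<close>

declare subst_tile.simps [simp del]

definition chair_tile :: "int \<Rightarrow> int \<Rightarrow> tile" where
  "chair_tile i j = ((of_int i + 1/2, of_int j + 1/2), chair i j)"

definition chair_plane :: "tile set" where
  "chair_plane = {chair_tile i j | i j. True}"

lemma translate_translate: "translate v (translate w P) = translate (v + w) P"
  by (auto simp: translate_def image_image case_prod_beta add.commute add.left_commute)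

lemma translate_0 [simp]: "translate 0 P = P"
  by (simp add: translate_def)

lemma translate_mono: "P \<subseteq> Q \<Longrightarrow> translate v P \<subseteq> translate v Q"
  unfolding translate_def by (rule image_mono)

lemma in_translate: "(c, a) \<in> translate v P \<longleftrightarrow> (c - v, a) \<in> P"
  by (force simp: translate_def)

text \<open>The link between the substitution, defined through the action of \<open>O2Z\<close>, and
  the integer function \<open>child\<close>; subtracting \<open>1/2\<close> measures the child from
  the centre of the doubled square.\<close>

lemma subst_tile_child:
  "subst_tile (c, a) = {(2 *\<^sub>R c + (of_int x - 1/2, of_int y - 1/2), child a x y) | x y. x \<in> {0, 1} \<and> y \<in> {0, 1}}"
proof -
  have "{(2 *\<^sub>R c + (of_int x - 1/2, of_int y - 1/2), child a x y) | x y. x \<in> {0, 1} \<and> y \<in> {0, 1}} =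
    {(2 *\<^sub>R c + (- 1/2, - 1/2), child a 0 0), (2 *\<^sub>R c + (- 1/2, 1/2), child a 0 1),
     (2 *\<^sub>R c + (1/2, - 1/2), child a 1 0), (2 *\<^sub>R c + (1/2, 1/2), child a 1 1)}" (is "?L = ?R")
  proof
    show "?L \<subseteq> ?R" by auto
    have in_L: "(2 *\<^sub>R c + (of_int x - 1/2, of_int y - 1/2), child a x y) \<in> ?L" if "x \<in> {0, 1}" "y \<in> {0, 1}" for x y
      using that by blast
    show "?R \<subseteq> ?L" using in_L[of 0 0] in_L[of 0 1] in_L[of 1 0] in_L[of 1 1] by simp
  qed
  then show ?thesis
    by (cases a) (auto simp: subst_tile_simps translate_def child_def add.commute)
qed

lemma subst_tile_translate: "subst_tile (c + v, a) = translate (2 *\<^sub>R v) (subst_tile (c, a))"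
proof -
  have "(e, b) \<in> subst_tile (c + v, a) \<longleftrightarrow> (e - 2 *\<^sub>R v, b) \<in> subst_tile (c, a)" for e b
    unfolding subst_tile_child by (auto simp: algebra_simps)
  then show ?thesis by (auto simp: in_translate)
qed

lemma chair_subst_translate: "chair_subst (translate v P) = translate (2 *\<^sub>R v) (chair_subst P)"
proof -
  have "chair_subst (translate v P) = (\<Union>u\<in>P. subst_tile (fst u + v, snd u))"
    by (simp add: chair_subst_def translate_def case_prod_beta)
  also have "\<dots> = (\<Union>u\<in>P. translate (2 *\<^sub>R v) (subst_tile u))"
    by (simp add: subst_tile_translate)
  also have "\<dots> = translate (2 *\<^sub>R v) (chair_subst P)"
    by (simp add: translate_def chair_subst_def image_UN)
  finally show ?thesis .
qed

lemma chair_subst_iter_translate: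
  "(chair_subst ^^ n) (translate v P) = translate (2 ^ n *\<^sub>R v) ((chair_subst ^^ n) P)"
  by (induction n) (simp_all add: chair_subst_translate)

lemma subst_chair_tile:
  "subst_tile (chair_tile i j) = {chair_tile k l | k l. k div 2 = i \<and> l div 2 = j}"
proof
  show "subst_tile (chair_tile i j) \<subseteq> {chair_tile k l | k l. k div 2 = i \<and> l div 2 = j}"
  proof
    fix u assume "u \<in> subst_tile (chair_tile i j)"
    then obtain x y :: int where xy: "x \<in> {0, 1}" "y \<in> {0, 1}"
      and u: "u = (2 *\<^sub>R (of_int i + 1/2, of_int j + 1/2) + (of_int x - 1/2, of_int y - 1/2), child (chair i j) x y)"
      unfolding chair_tile_def subst_tile_child by blast
    have "(2 * i + x) div 2 = i" "(2 * i + x) mod 2 = x" "(2 * j + y) div 2 = j" "(2 * j + y) mod 2 = y"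
      using xy by auto
    then have "u = chair_tile (2 * i + x) (2 * j + y)" "(2 * i + x) div 2 = i" "(2 * j + y) div 2 = j"
      unfolding chair_tile_def chair_rec[of "2 * i + x"] u by simp_all
    then show "u \<in> {chair_tile k l | k l. k div 2 = i \<and> l div 2 = j}" by blast
  qed
  show "{chair_tile k l | k l. k div 2 = i \<and> l div 2 = j} \<subseteq> subst_tile (chair_tile i j)"
  proof
    fix u assume "u \<in> {chair_tile k l | k l. k div 2 = i \<and> l div 2 = j}"
    then obtain k l where u: "u = chair_tile k l" "k div 2 = i" "l div 2 = j" by blast
    define x y where "x = k mod 2" and "y = l mod 2"
    have "k = 2 * i + x" "l = 2 * j + y" using u by (auto simp: x_def y_def)
    then have "u = (2 *\<^sub>R (of_int i + 1/2, of_int j + 1/2) + (of_int x - 1/2, of_int y - 1/2), child (chair i j) x y)"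
      using u chair_rec[of k l] by (simp add: chair_tile_def x_def y_def)
    moreover have "x \<in> {0, 1}" "y \<in> {0, 1}" by (auto simp: x_def y_def)
    ultimately show "u \<in> subst_tile (chair_tile i j)"
      unfolding chair_tile_def subst_tile_child by blast
  qed
qed

lemma supertile:
  "(chair_subst ^^ n) {chair_tile P Q} = {chair_tile i j | i j. i div 2 ^ n = P \<and> j div 2 ^ n = Q}"
proof (induction n)
  case (Suc n)
  have d: "i div 2 ^ Suc n = i div 2 div 2 ^ n" for i :: int by (simp add: zdiv_zmult2_eq)
  have "(chair_subst ^^ Suc n) {chair_tile P Q} =
      (\<Union>u\<in>{chair_tile i j | i j. i div 2 ^ n = P \<and> j div 2 ^ n = Q}. subst_tile u)"
    unfolding funpow.simps o_def Suc by (rule chair_subst_def)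
  also have "\<dots> = {chair_tile i j | i j. i div 2 ^ Suc n = P \<and> j div 2 ^ Suc n = Q}"
  proof -
    have mem: "u \<in> subst_tile (chair_tile i j) \<longleftrightarrow> (\<exists>k l. u = chair_tile k l \<and> k div 2 = i \<and> l div 2 = j)" for u i j
      unfolding subst_chair_tile by blast
    have "(\<Union>u\<in>{chair_tile i j | i j. i div 2 ^ n = P \<and> j div 2 ^ n = Q}. subst_tile u) =
        {u. \<exists>i j. i div 2 ^ n = P \<and> j div 2 ^ n = Q \<and> u \<in> subst_tile (chair_tile i j)}" by blast
    then show ?thesis unfolding mem d by blast
  qed
  finally show ?case .
qed auto

text \<open>The tiles at (1, 3), (2, 3), (1, 4), (2, 4) carry the arrows of the four seeds in the
  same arrangement. Hence the order-\<open>n\<close> supertiles around the point (2, 4), scaled by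
  2^n, copy those around the origin, and every patch at the origin recurs inside the first
  quadrant.\<close>

lemma chair_self_similar:
  assumes "i \<in> {- (2 ^ n)..<2 ^ n}" "j \<in> {- (2 ^ n)..<2 ^ n}"
  shows "chair (i + 2 ^ n * 2) (j + 2 ^ n * 4) = chair i j"
proof -
  define P Q where "P = i div 2 ^ n" and "Q = j div 2 ^ n"
  have PQ': "(i + 2 ^ n * 2) div 2 ^ n = P + 2" "(j + 2 ^ n * 4) div 2 ^ n = Q + 4"
    unfolding P_def Q_def by (subst div_mult_self2; simp)+
  have r: "a div 2 ^ n = 0 \<or> a div 2 ^ n = - 1" if "a \<in> {- (2 ^ n)..<2 ^ n}" for a :: int
  proof (cases "a \<ge> 0")
    case True then show ?thesis using that by simp
  next
    case False
    then have "(a + 2 ^ n) div 2 ^ n = 0" using that by (intro div_pos_pos_trivial) auto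
    moreover have "(a + 2 ^ n) div 2 ^ n = a div 2 ^ n + 1" by simp
    ultimately show ?thesis by linarith
  qed
  have "chair 1 3 = SW" "chair 1 4 = NW" "chair 2 3 = SE" "chair 2 4 = NE"
    by (simp_all add: chair_rec[of 1 3] chair_rec[of 1 4] chair_rec[of 2 3] chair_rec[of 2 4]
        chair_rec[of 0 1] chair_rec[of 0 2] chair_rec[of 1 1] chair_rec[of 1 2] chair_seed child_def)
  then have "chair (P + 2) (Q + 4) = chair P Q"
    using r[OF assms(1)] r[OF assms(2)] unfolding P_def[symmetric] Q_def[symmetric]
    by (auto simp: chair_seed)
  then show ?thesis
    unfolding chair_descendant[of "i + 2 ^ n * 2" "j + 2 ^ n * 4" n] chair_descendant[of i j n] PQ' descendant_periodic
    by (simp add: P_def Q_def)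
qed

text \<open>All four arrows occur in the plane, so any supertile is a translated piece of
  \<open>chair_plane\<close>. Conversely \<open>chair_self_similar\<close> moves a finite patch into
  the first quadrant, which is exhausted by the supertiles of one NE tile.\<close>

lemma legal_patch_iff:
  assumes fin: "finite P"
  shows "(\<exists>v t n. P \<subseteq> translate v ((chair_subst ^^ n) {t})) \<longleftrightarrow> (\<exists>v. P \<subseteq> translate v chair_plane)"
proof
  assume "\<exists>v t n. P \<subseteq> translate v ((chair_subst ^^ n) {t})"
  then obtain v c a n where P: "P \<subseteq> translate v ((chair_subst ^^ n) {(c, a)})" by auto
  obtain i j where ij: "chair i j = a" using chair_seed by (cases a) blast+
  define w where "w = c - (of_int i + 1/2, of_int j + 1/2)"
  have "{(c, a)} = translate w {chair_tile i j}"
    using ij by (simp add: translate_def chair_tile_def w_def)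
  then have "P \<subseteq> translate (v + 2 ^ n *\<^sub>R w) ((chair_subst ^^ n) {chair_tile i j})"
    using P by (simp only: chair_subst_iter_translate translate_translate)
  also have "\<dots> \<subseteq> translate (v + 2 ^ n *\<^sub>R w) chair_plane"
    unfolding supertile by (rule translate_mono) (auto simp: chair_plane_def)
  finally show "\<exists>v. P \<subseteq> translate v chair_plane" ..
next
  assume "\<exists>v. P \<subseteq> translate v chair_plane"
  then obtain v where P: "P \<subseteq> translate v chair_plane" ..
  \<comment> \<open>A crude integer bound for the distance of a tile from the centre of the plane.
    The sum over the patch bounds all its tiles at once, and \<open>n < 2 ^ n\<close> turns the
    bound into a supertile size.\<close>
  define f where "f = (\<lambda>u::tile. nat \<lceil>\<bar>fst (fst u - v)\<bar>\<rceil> + nat \<lceil>\<bar>snd (fst u - v)\<bar>\<rceil>)"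
  define n where "n = Suc (sum f P)"
  have "P \<subseteq> translate (v - (of_int (2 ^ n * 2), of_int (2 ^ n * 4))) ((chair_subst ^^ (n + 3)) {chair_tile 0 0})"
  proof
    fix u assume u: "u \<in> P"
    obtain c a where ca: "u = (c, a)" by (cases u)
    obtain i j where ij: "(c - v, a) = chair_tile i j"
    proof -
      have "(c - v, a) \<in> chair_plane" using subsetD[OF P u] unfolding ca in_translate .
      then show thesis using that unfolding chair_plane_def by blast
    qed
    have "f u \<le> sum f P" using u fin by (intro member_le_sum) auto
    then have "int (f u) \<le> int (sum f P)" by (simp only: of_nat_le_iff)
    then have fu: "int (f u) + 1 \<le> int n" by (simp only: n_def of_nat_Suc)
    have "int n < 2 ^ n" by (metis of_nat_less_two_power)
    moreover have "\<bar>i\<bar> \<le> int (f u) + 1" "\<bar>j\<bar> \<le> int (f u) + 1"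
    proof -
      have "fst (c - v) = of_int i + 1/2" "snd (c - v) = of_int j + 1/2"
        using ij by (simp_all add: chair_tile_def)
      then show "\<bar>i\<bar> \<le> int (f u) + 1" "\<bar>j\<bar> \<le> int (f u) + 1"
        unfolding f_def ca by simp_all linarith+
    qed
    ultimately have "- (2 ^ n) \<le> i" "i < 2 ^ n" "- (2 ^ n) \<le> j" "j < 2 ^ n" using fu by linarith+
    then have r: "i \<in> {- (2 ^ n)..<2 ^ n}" "j \<in> {- (2 ^ n)..<2 ^ n}" by simp_all
    define k l where "k = i + 2 ^ n * 2" and "l = j + 2 ^ n * 4"
    \<comment> \<open>After the shift both coordinates lie between 0 and 5 * 2^n, below the side
      2^(n+3) of the supertile.\<close>
    have kl: "k div 2 ^ (n + 3) = 0" "l div 2 ^ (n + 3) = 0"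
      using r by (auto simp: k_def l_def power_add intro!: div_pos_pos_trivial)
    have "chair_tile k l \<in> (chair_subst ^^ (n + 3)) {chair_tile 0 0}"
      unfolding supertile using kl by blast
    moreover have "(c - (v - (of_int (2 ^ n * 2), of_int (2 ^ n * 4))), a) = chair_tile k l"
      using ij chair_self_similar[OF r] by (auto simp: chair_tile_def k_def l_def algebra_simps prod_eq_iff)
    ultimately show "u \<in> translate (v - (of_int (2 ^ n * 2), of_int (2 ^ n * 4))) ((chair_subst ^^ (n + 3)) {chair_tile 0 0})"
      unfolding ca in_translate by simp
  qed
  then show "\<exists>v t n. P \<subseteq> translate v ((chair_subst ^^ n) {t})" by blast
qed

lemma chair_tilings_iff:
  "T \<in> chair_tilings \<longleftrightarrow> is_tiling T \<and> (\<forall>P. finite P \<and> P \<subseteq> T \<longrightarrow> (\<exists>v. P \<subseteq> translate v chair_plane))"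
  unfolding chair_tilings_def mem_Collect_eq using legal_patch_iff by metis

section \<open>The tilings symmetric about the diagonal\<close>

text \<open>The sign makes \<open>t\<close> the point of the diagonal that moves to the
  origin.\<close>

definition shifted_plane :: "real \<Rightarrow> tile set" where
  "shifted_plane t = translate (- t, - t) chair_plane"

lemma in_shifted_plane:
  "((c, d), a) \<in> shifted_plane t \<longleftrightarrow> (\<exists>i j. c = of_int i + 1/2 - t \<and> d = of_int j + 1/2 - t \<and> a = chair i j)"
  by (auto simp: shifted_plane_def in_translate chair_plane_def chair_tile_def algebra_simps prod_eq_iff)

text \<open>Comparing centres in a box, rather than squares meeting a ball, makes the relation easy
  to restrict and to compose; \<open>tilings_close_if_agree\<close> converts it.\<close>

definition agree_within :: "real \<Rightarrow> tile set \<Rightarrow> tile set \<Rightarrow> bool" where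
  "agree_within B T T' \<longleftrightarrow> (\<forall>c d a. \<bar>c\<bar> \<le> B \<longrightarrow> \<bar>d\<bar> \<le> B \<longrightarrow> ((c, d), a) \<in> T \<longleftrightarrow> ((c, d), a) \<in> T')"

lemma agree_within_sym: "agree_within B T T' \<Longrightarrow> agree_within B T' T"
  by (simp add: agree_within_def)

lemma agree_within_trans: "agree_within B T T' \<Longrightarrow> agree_within B T' T'' \<Longrightarrow> agree_within B T T''"
  by (simp add: agree_within_def)

lemma agree_within_mono: "agree_within B T T' \<Longrightarrow> B' \<le> B \<Longrightarrow> agree_within B' T T'"
  by (simp add: agree_within_def)

lemma agree_within_eq:
  assumes "\<And>n::nat. \<exists>B. real n \<le> B \<and> agree_within B T T'" shows "T = T'"
proof -
  have "((c, d), a) \<in> T \<longleftrightarrow> ((c, d), a) \<in> T'" for c d a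
  proof -
    obtain n :: nat where "max \<bar>c\<bar> \<bar>d\<bar> \<le> real n" using real_arch_simple by blast
    moreover obtain B where "real n \<le> B" "agree_within B T T'" using assms by blast
    ultimately show ?thesis by (simp add: agree_within_def)
  qed
  then show ?thesis by auto
qed

text \<open>This is \<open>chair_periodic\<close> seen from the origin. Centres within
  \<open>B - 1\<close> have indices on one side of the origin of the chair plane and at most 2^n
  apart; the unit given up covers the half tile between centre and corner.\<close>

lemma shifted_plane_agree:
  assumes k: "t' = t + 2 ^ n * of_int k" and B: "2 * B \<le> 2 ^ n"
    and sgn: "B \<le> t \<and> B \<le> t' \<or> t \<le> - B \<and> t' \<le> - B"
  shows "agree_within (B - 1) (shifted_plane t) (shifted_plane t')"
proof -
  have sub: "((c, d), a) \<in> shifted_plane t'"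
    if a: "((c, d), a) \<in> shifted_plane t" and k: "t' = t + 2 ^ n * of_int k"
      and sgn: "B \<le> t \<and> B \<le> t' \<or> t \<le> - B \<and> t' \<le> - B"
      and cd: "\<bar>c\<bar> \<le> B - 1" "\<bar>d\<bar> \<le> B - 1" for c d a t t' k
  proof -
    obtain i j where ij: "c = of_int i + 1/2 - t" "d = of_int j + 1/2 - t" "a = chair i j"
      using a unfolding in_shifted_plane by blast
    define i' j' where "i' = i + 2 ^ n * k" and "j' = j + 2 ^ n * k"
    have ij': "c = of_int i' + 1/2 - t'" "d = of_int j' + 1/2 - t'"
      using ij k by (simp_all add: i'_def j'_def)
    have "real_of_int \<bar>i - j\<bar> \<le> real_of_int (2 ^ n)" using cd B unfolding ij by simp
    then have near: "\<bar>i - j\<bar> \<le> 2 ^ n" by (simp only: of_int_le_iff)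
    have "(i \<ge> 0 \<and> j \<ge> 0 \<and> i' \<ge> 0 \<and> j' \<ge> 0) \<or> (i < 0 \<and> j < 0 \<and> i' < 0 \<and> j' < 0)"
      using sgn
    proof
      assume "B \<le> t \<and> B \<le> t'"
      then have "of_int i > (-1::real)" "of_int j > (-1::real)" "of_int i' > (-1::real)" "of_int j' > (-1::real)"
        using cd ij ij' by (simp_all add: abs_le_iff)
      then show ?thesis by linarith
    next
      assume "t \<le> - B \<and> t' \<le> - B"
      then have "of_int i < (0::real)" "of_int j < (0::real)" "of_int i' < (0::real)" "of_int j' < (0::real)"
        using cd ij ij' by (simp_all add: abs_le_iff)
      then show ?thesis by linarith
    qed
    then have "chair i' j' = chair i j"
      using chair_periodic[OF near, of k] by (simp add: i'_def j'_def)
    then show ?thesis unfolding in_shifted_plane using ij' ij(3) by auto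
  qed
  have k': "t = t' + 2 ^ n * of_int (- k)" using k by simp
  show ?thesis
    unfolding agree_within_def using sub[OF _ k sgn] sub[OF _ k'] sgn by blast
qed

text \<open>The identification that turns the line into the dumbbell with circles of length \<open>2 ^ n\<close>; the threads
  below are the points of the inverse limit of these dumbbells, with arbitrary representatives.\<close>

definition glued_real :: "nat \<Rightarrow> real \<Rightarrow> real \<Rightarrow> bool" where
  "glued_real n s t \<longleftrightarrow> s = t \<or>
     ((\<exists>k::int. t = s + 2 ^ n * of_int k) \<and> (2 ^ n \<le> s \<and> 2 ^ n \<le> t \<or> s \<le> - (2 ^ n) \<and> t \<le> - (2 ^ n)))"

lemma glued_real_refl [simp]: "glued_real n t t"
  by (simp add: glued_real_def)

lemma glued_real_sym: "glued_real n s t \<Longrightarrow> glued_real n t s"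
proof -
  have "\<exists>k::int. s = t + 2 ^ n * of_int k" if "t = s + 2 ^ n * of_int k" for k :: int
    using that by (intro exI[of _ "- k"]) simp
  then show "glued_real n s t \<Longrightarrow> glued_real n t s" by (auto simp: glued_real_def)
qed

lemma glued_real_trans:
  assumes "glued_real n s t" "glued_real n t u" shows "glued_real n s u"
proof (cases "s = t \<or> t = u")
  case False
  then obtain k l :: int where kl: "t = s + 2 ^ n * of_int k" "u = t + 2 ^ n * of_int l"
    using assms by (auto simp: glued_real_def)
  then have "u = s + 2 ^ n * of_int (k + l)" by (simp add: algebra_simps)
  moreover have "(0::real) < 2 ^ n" by simp
  then have "2 ^ n \<le> s \<and> 2 ^ n \<le> u \<or> s \<le> - (2 ^ n) \<and> u \<le> - (2 ^ n)"
    using assms False unfolding glued_real_def by linarith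
  ultimately show ?thesis unfolding glued_real_def by blast
qed (use assms in auto)

lemma glued_real_le:
  assumes "glued_real m s t" "n \<le> m" shows "glued_real n s t"
proof (cases "s = t")
  case False
  then obtain k :: int where k: "t = s + 2 ^ m * of_int k"
    and s: "2 ^ m \<le> s \<and> 2 ^ m \<le> t \<or> s \<le> - (2 ^ m) \<and> t \<le> - (2 ^ m)"
    using assms(1) by (auto simp: glued_real_def)
  have "(2::real) ^ m = 2 ^ n * 2 ^ (m - n)" using assms(2) by (simp flip: power_add)
  then have "t = s + 2 ^ n * of_int (2 ^ (m - n) * k)" using k by simp
  moreover have "(2::real) ^ n \<le> 2 ^ m" using assms(2) by (intro power_increasing) auto
  then have "2 ^ n \<le> s \<and> 2 ^ n \<le> t \<or> s \<le> - (2 ^ n) \<and> t \<le> - (2 ^ n)" using s by linarith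
  ultimately show ?thesis unfolding glued_real_def by blast
qed simp

lemma glued_real_agree:
  assumes "glued_real n s t"
  shows "agree_within (2 ^ n / 2 - 1) (shifted_plane s) (shifted_plane t)"
proof (cases "s = t")
  case False
  then obtain k :: int where k: "t = s + 2 ^ n * of_int k"
    and s: "2 ^ n \<le> s \<and> 2 ^ n \<le> t \<or> s \<le> - (2 ^ n) \<and> t \<le> - (2 ^ n)"
    using assms by (auto simp: glued_real_def)
  have "(0::real) < 2 ^ n" by simp
  then have "2 ^ n / 2 \<le> s \<and> 2 ^ n / 2 \<le> t \<or> s \<le> - (2 ^ n / 2) \<and> t \<le> - (2 ^ n / 2)" using s by linarith
  then show ?thesis using shifted_plane_agree[OF k] by simp
qed (simp add: agree_within_def)

section \<open>Threads and their tilings\<close>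

definition threads :: "(nat \<Rightarrow> real) set" where
  "threads = {x. \<forall>n. glued_real n (x n) (x (Suc n))}"

lemma threads_glued:
  assumes "x \<in> threads" "n \<le> m" shows "glued_real n (x n) (x m)"
  using assms(2)
proof (induction m rule: dec_induct)
  case (step m)
  have "glued_real n (x m) (x (Suc m))"
    using assms(1) step.hyps glued_real_le unfolding threads_def by blast
  then show ?case using step.IH glued_real_trans by blast
qed simp

lemma const_thread: "(\<lambda>_. t) \<in> threads"
  by (simp add: threads_def)

text \<open>Eventual membership is a pointwise limit: by \<open>limit_tiling_agree\<close> the
  tiling of level \<open>n\<close> is already correct on a box that grows with
  \<open>n\<close>.\<close>

definition limit_tiling :: "(nat \<Rightarrow> real) \<Rightarrow> tile set" where
  "limit_tiling x = {u. \<exists>N. \<forall>n\<ge>N. u \<in> shifted_plane (x n)}"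

lemma limit_tiling_const: "limit_tiling (\<lambda>_. t) = shifted_plane t"
  by (auto simp: limit_tiling_def)

lemma limit_tiling_agree:
  assumes "x \<in> threads" shows "agree_within (2 ^ n / 2 - 1) (limit_tiling x) (shifted_plane (x n))"
proof -
  have "((c, d), a) \<in> limit_tiling x \<longleftrightarrow> ((c, d), a) \<in> shifted_plane (x n)"
    if cd: "\<bar>c\<bar> \<le> 2 ^ n / 2 - 1" "\<bar>d\<bar> \<le> 2 ^ n / 2 - 1" for c d a
  proof -
    have m: "((c, d), a) \<in> shifted_plane (x m) \<longleftrightarrow> ((c, d), a) \<in> shifted_plane (x n)" if "n \<le> m" for m
      using glued_real_agree[OF threads_glued[OF assms that]] cd by (simp add: agree_within_def)
    show ?thesis
    proof
      assume "((c, d), a) \<in> limit_tiling x"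
      then obtain N where "\<forall>m\<ge>N. ((c, d), a) \<in> shifted_plane (x m)" by (auto simp: limit_tiling_def)
      then show "((c, d), a) \<in> shifted_plane (x n)" using m[of "max n N"] by simp
    next
      assume "((c, d), a) \<in> shifted_plane (x n)"
      then have "\<forall>k\<ge>n. ((c, d), a) \<in> shifted_plane (x k)" using m by blast
      then show "((c, d), a) \<in> limit_tiling x" unfolding limit_tiling_def by blast
    qed
  qed
  then show ?thesis by (simp add: agree_within_def)
qed

lemma exists_level: "\<exists>n. B \<le> 2 ^ n / 2 - (1::real)"
proof -
  obtain n where "2 * (B + 1) < 2 ^ n" using real_arch_pow[of 2 "2 * (B + 1)"] by auto
  then show ?thesis by (intro exI[of _ n]) simp
qed

section \<open>Geometry of unit squares on a lattice, and legality of limit tilings\<close>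

lemma square_eq: "square ((c, d), a) = cbox (c - 1/2) (c + 1/2) \<times> cbox (d - 1/2) (d + 1/2)"
  by (simp add: cbox_Pair_eq)

lemma in_square: "p \<in> square ((c, d), a) \<longleftrightarrow> \<bar>fst p - c\<bar> \<le> 1/2 \<and> \<bar>snd p - d\<bar> \<le> 1/2"
proof -
  have "x \<in> cbox (e - 1/2) (e + 1/2) \<longleftrightarrow> \<bar>x - e\<bar> \<le> 1/2" for x e :: real
    unfolding cbox_interval atLeastAtMost_iff abs_le_iff by (intro iffI conjI; elim conjE; linarith)
  then show ?thesis by (cases p) (simp only: square_eq mem_Times_iff)
qed

lemma interval_face:
  fixes c :: real
  shows "cbox (c - 1/2) (c + 1/2) \<inter> cbox (c + of_int k - 1/2) (c + of_int k + 1/2) face_of cbox (c - 1/2) (c + 1/2)"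
proof -
  have ext: "{x} face_of {a..b}" if "x = a \<or> x = b" "a \<le> b" for x a b :: real
  proof -
    have "x extreme_point_of {a..b}"
      using that by (auto simp: extreme_point_of_def open_segment_eq_real_ivl split: if_splits)
    then show ?thesis by (simp add: face_of_singleton)
  qed
  consider "k = 0" | "k = 1" | "k = -1" | "k \<ge> 2" | "k \<le> -2" by linarith
  then show ?thesis
  proof cases
    case 1 then show ?thesis by (simp add: face_of_refl)
  next
    case 2
    then have "cbox (c - 1/2) (c + 1/2) \<inter> cbox (c + of_int k - 1/2) (c + of_int k + 1/2) = {c + 1/2}" by auto
    then show ?thesis using ext[of "c + 1/2"] by simp
  next
    case 3
    then have "cbox (c - 1/2) (c + 1/2) \<inter> cbox (c + of_int k - 1/2) (c + of_int k + 1/2) = {c - 1/2}" by auto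
    then show ?thesis using ext[of "c - 1/2"] by simp
  next
    case 4
    then have "real_of_int k \<ge> 2" by linarith
    then have "cbox (c - 1/2) (c + 1/2) \<inter> cbox (c + of_int k - 1/2) (c + of_int k + 1/2) = {}" by auto
    then show ?thesis by simp
  next
    case 5
    then have "real_of_int k \<le> -2" by linarith
    then have "cbox (c - 1/2) (c + 1/2) \<inter> cbox (c + of_int k - 1/2) (c + of_int k + 1/2) = {}" by auto
    then show ?thesis by simp
  qed
qed

lemma lattice_tiles:
  assumes "c' = c + of_int k" "d' = d + of_int l" "(c, d) \<noteq> (c', d')"
  shows "interior (square ((c, d), a)) \<inter> interior (square ((c', d'), a')) = {}"
    and "(square ((c, d), a) \<inter> square ((c', d'), a')) face_of square ((c, d), a)"
proof -
  have "interior (square ((c, d), a)) = {c - 1/2<..<c + 1/2} \<times> {d - 1/2<..<d + 1/2}" for c d a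
    unfolding square_eq interior_Times by simp
  moreover have "k \<noteq> 0 \<or> l \<noteq> 0" using assms by auto
  then have "real_of_int k \<ge> 1 \<or> real_of_int k \<le> -1 \<or> real_of_int l \<ge> 1 \<or> real_of_int l \<le> -1" by linarith
  ultimately show "interior (square ((c, d), a)) \<inter> interior (square ((c', d'), a')) = {}"
    unfolding assms(1,2) by auto
  show "(square ((c, d), a) \<inter> square ((c', d'), a')) face_of square ((c, d), a)"
    unfolding square_eq Times_Int_Times assms(1,2) by (intro face_of_Times interval_face)
qed

lemma limit_tiling_patch:
  assumes x: "x \<in> threads" and fin: "finite P" "P \<subseteq> limit_tiling x"
  shows "\<exists>n. P \<subseteq> shifted_plane (x n)"
proof -
  define B where "B = (\<Sum>u\<in>P. \<bar>fst (fst u)\<bar> + \<bar>snd (fst u)\<bar>)"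
  obtain n where n: "B \<le> 2 ^ n / 2 - 1" using exists_level by blast
  have "u \<in> shifted_plane (x n)" if u: "u \<in> P" for u
  proof -
    obtain c d a where cda: "u = ((c, d), a)" by (metis prod.exhaust)
    have "\<bar>c\<bar> + \<bar>d\<bar> \<le> B"
      unfolding B_def using member_le_sum[OF u, of "\<lambda>u. \<bar>fst (fst u)\<bar> + \<bar>snd (fst u)\<bar>"] fin cda by simp
    then show ?thesis
      using limit_tiling_agree[OF x, of n] n u fin(2) by (auto simp: agree_within_def cda)
  qed
  then show ?thesis by blast
qed

text \<open>Covering a point, the position of two tiles and the legality of a patch all concern
  bounded regions, so each is checked in a single \<open>shifted_plane (x n)\<close>.\<close>

lemma limit_tiling_in_chair_tilings:
  assumes x: "x \<in> threads" shows "limit_tiling x \<in> chair_tilings"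
  unfolding chair_tilings_iff is_tiling_def
proof (intro conjI allI impI ballI)
  have "p \<in> (\<Union>t\<in>limit_tiling x. square t)" for p :: plane
  proof -
    obtain c d where p: "p = (c, d)" by (cases p)
    obtain n where n: "max \<bar>c\<bar> \<bar>d\<bar> + 1 \<le> 2 ^ n / 2 - 1" using exists_level by blast
    define i j where "i = \<lfloor>c + x n\<rfloor>" and "j = \<lfloor>d + x n\<rfloor>"
    define c' d' where "c' = of_int i + 1/2 - x n" and "d' = of_int j + 1/2 - x n"
    have cd: "\<bar>c - c'\<bar> \<le> 1/2" "\<bar>d - d'\<bar> \<le> 1/2" unfolding c'_def d'_def i_def j_def by linarith+
    have "((c', d'), chair i j) \<in> shifted_plane (x n)"
      unfolding in_shifted_plane c'_def d'_def by blast
    moreover have "\<bar>c'\<bar> \<le> 2 ^ n / 2 - 1" "\<bar>d'\<bar> \<le> 2 ^ n / 2 - 1" using cd n by linarith+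
    ultimately have "((c', d'), chair i j) \<in> limit_tiling x"
      using limit_tiling_agree[OF x, of n] by (simp add: agree_within_def)
    moreover have "p \<in> square ((c', d'), chair i j)" unfolding in_square p using cd by simp
    ultimately show ?thesis by blast
  qed
  then show "(\<Union>t\<in>limit_tiling x. square t) = UNIV" by blast
  {
    fix u u' assume u: "u \<in> limit_tiling x" "u' \<in> limit_tiling x" "u \<noteq> u'"
    obtain c d a c' d' a' where cd: "u = ((c, d), a)" "u' = ((c', d'), a')" by (metis prod.exhaust)
    obtain n where "u \<in> shifted_plane (x n)" "u' \<in> shifted_plane (x n)"
      using limit_tiling_patch[OF x, of "{u, u'}"] u by auto
    then obtain i j i' j' where ij: "c = of_int i + 1/2 - x n" "d = of_int j + 1/2 - x n" "a = chair i j"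
      "c' = of_int i' + 1/2 - x n" "d' = of_int j' + 1/2 - x n" "a' = chair i' j'"
      unfolding cd in_shifted_plane by blast
    have *: "c' = c + of_int (i' - i)" "d' = d + of_int (j' - j)" using ij by simp_all
    have "(c, d) \<noteq> (c', d')" using u(3) cd ij by auto
    note lattice_tiles[OF * this]
    then show "interior (square u) \<inter> interior (square u') = {}" "(square u \<inter> square u') face_of square u"
      unfolding cd by blast+
  }
  fix P assume P: "finite P \<and> P \<subseteq> limit_tiling x"
  then obtain n where "P \<subseteq> shifted_plane (x n)" using limit_tiling_patch[OF x] by blast
  then show "\<exists>v. P \<subseteq> translate v chair_plane" unfolding shifted_plane_def by blast
qed

lemma arrow_act_reflect_diag: "arrow_act reflect_diag a = swp a"
  by (cases a) (auto intro!: arrow_act_eqI simp: reflect_diag_def)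

text \<open>One inclusion suffices since the reflection is an involution.\<close>

lemma reflect_diag_fixed_iff:
  "act reflect_diag T = T \<longleftrightarrow> (\<forall>c d a. ((c, d), a) \<in> T \<longrightarrow> ((d, c), swp a) \<in> T)"
proof -
  have a: "((c, d), a) \<in> act reflect_diag T \<longleftrightarrow> ((d, c), swp a) \<in> T" for c d a
    unfolding act_def arrow_act_reflect_diag by (force simp: reflect_diag_def image_iff)
  show ?thesis
  proof
    assume "act reflect_diag T = T"
    then show "\<forall>c d a. ((c, d), a) \<in> T \<longrightarrow> ((d, c), swp a) \<in> T" using a by blast
  next
    assume b: "\<forall>c d a. ((c, d), a) \<in> T \<longrightarrow> ((d, c), swp a) \<in> T"
    have "((c, d), a) \<in> act reflect_diag T \<longleftrightarrow> ((c, d), a) \<in> T" for c d a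
      unfolding a using b swp_swp by metis
    then show "act reflect_diag T = T" by auto
  qed
qed

lemma limit_tiling_symmetric: "act reflect_diag (limit_tiling x) = limit_tiling x"
proof -
  have "((d, c), swp a) \<in> shifted_plane t" if "((c, d), a) \<in> shifted_plane t" for c d a t
    using that chair_swap unfolding in_shifted_plane by metis
  then show ?thesis unfolding reflect_diag_fixed_iff limit_tiling_def by blast
qed

text \<open>All centres lie in one translate of the integer lattice, with the same offset in both
  coordinates by symmetry. Every window of labels occurs in \<open>chair\<close>, by
  \<open>symmetric_patch\<close> even at a position \<open>\<tau> m\<close> on the diagonal. These
  positions are chosen independently; \<open>chair_recognize\<close> makes them a thread.\<close>

lemma symmetric_tiling_is_limit:
  assumes T: "T \<in> chair_tilings" and sym: "act reflect_diag T = T"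
  shows "\<exists>x\<in>threads. T = limit_tiling x"
proof -
  have patch: "\<exists>v. P \<subseteq> translate v chair_plane" if "finite P" "P \<subseteq> T" for P
    using T that unfolding chair_tilings_iff by blast
  have refl: "((d, c), swp a) \<in> T" if "((c, d), a) \<in> T" for c d a
    using sym that unfolding reflect_diag_fixed_iff by blast
  have plane: "\<exists>i j. c - fst v = of_int i + 1/2 \<and> d - snd v = of_int j + 1/2 \<and> a = chair i j"
    if "((c, d), a) \<in> translate v chair_plane" for c d a v
    using that by (auto simp: in_translate chair_plane_def chair_tile_def prod_eq_iff)
  have diff: "c' - c \<in> \<int>" "d' - d \<in> \<int>" "c = c' \<Longrightarrow> d = d' \<Longrightarrow> a = a'"
    if cd: "((c, d), a) \<in> T" "((c', d'), a') \<in> T" for c d a c' d' a'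
  proof -
    obtain v where "{((c, d), a), ((c', d'), a')} \<subseteq> translate v chair_plane"
      using patch[of "{((c, d), a), ((c', d'), a')}"] cd by blast
    then obtain i j i' j' where "c - fst v = of_int i + 1/2" "d - snd v = of_int j + 1/2" "a = chair i j"
      "c' - fst v = of_int i' + 1/2" "d' - snd v = of_int j' + 1/2" "a' = chair i' j'"
      using plane[of c d a v] plane[of c' d' a' v] by blast
    then have "c' - c = of_int (i' - i)" "d' - d = of_int (j' - j)" and a: "a = chair i j" "a' = chair i' j'" by simp_all
    then show "c' - c \<in> \<int>" "d' - d \<in> \<int>" by (metis Ints_of_int)+
    show "a = a'" if "c = c'" "d = d'"
      using \<open>c' - c = of_int (i' - i)\<close> \<open>d' - d = of_int (j' - j)\<close> a that by simp
  qed
  have cover: "(\<Union>t\<in>T. square t) = UNIV" using T unfolding chair_tilings_iff is_tiling_def by blast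
  then obtain s s' a0 where s: "((s, s'), a0) \<in> T" by fastforce
  \<comment> \<open>The offset in \<open>[0, 1)\<close> for which \<open>s\<close> is an integer
    plus \<open>1/2 - t0\<close>.\<close>
  define t0 where "t0 = frac (1/2 - s)"
  have t0: "0 \<le> t0" "t0 < 1" unfolding t0_def by (simp_all add: frac_lt_1)
  have st0: "of_int m + 1/2 - t0 - s = of_int (m + \<lfloor>1/2 - s\<rfloor>)" for m
    by (simp add: t0_def frac_def)
  have lattice: "c - s \<in> \<int>" "d - s \<in> \<int>" if "((c, d), a) \<in> T" for c d a
    using diff[OF s that] diff[OF s refl[OF that]] by auto
  \<comment> \<open>The tile that covers a lattice point has its centre at an integer distance less
    than 1 in each coordinate, hence at that point.\<close>
  have "\<exists>a. ((of_int i + 1/2 - t0, of_int j + 1/2 - t0), a) \<in> T" for i j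
  proof -
    let ?c = "of_int i + 1/2 - t0" and ?d = "of_int j + 1/2 - t0"
    obtain c d a where cda: "((c, d), a) \<in> T" "(?c, ?d) \<in> square ((c, d), a)"
      using cover by (metis UNIV_I UN_E prod.exhaust)
    have "?c - s \<in> \<int>" "?d - s \<in> \<int>" unfolding st0 by simp_all
    then have "(?c - s) - (c - s) \<in> \<int>" "(?d - s) - (d - s) \<in> \<int>"
      using lattice[OF cda(1)] by (meson Ints_diff)+
    then have "?c - c \<in> \<int>" "?d - d \<in> \<int>" by (simp_all add: algebra_simps)
    moreover have "\<bar>?c - c\<bar> < 1" "\<bar>?d - d\<bar> < 1" using cda(2) unfolding in_square by auto
    ultimately have "?c - c = 0" "?d - d = 0" by (metis Ints_nonzero_abs_less1)+
    then show ?thesis using cda(1) by auto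
  qed
  then obtain A where A: "\<And>i j. ((of_int i + 1/2 - t0, of_int j + 1/2 - t0), A i j) \<in> T" by metis
  have T_ex: "\<exists>i j. c = of_int i + 1/2 - t0 \<and> d = of_int j + 1/2 - t0 \<and> a = A i j" if "((c, d), a) \<in> T" for c d a
  proof -
    have "c - s \<in> \<int>" "d - s \<in> \<int>" using lattice[OF that] .
    then obtain k l where kl: "c - s = of_int k" "d - s = of_int l" by (auto elim!: Ints_cases)
    define i j where "i = k - \<lfloor>1/2 - s\<rfloor>" and "j = l - \<lfloor>1/2 - s\<rfloor>"
    have "c = of_int i + 1/2 - t0" "d = of_int j + 1/2 - t0"
      using kl st0[of i] st0[of j] by (simp_all add: i_def j_def)
    then show ?thesis using diff(3)[OF that A] by blast
  qed
  have A_sym: "A j i = swp (A i j)" for i j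
    using diff(3)[OF refl[OF A[of i j]] A[of j i]] by simp
  have A_patch: "\<exists>p q. \<forall>i\<in>{- N..N}. \<forall>j\<in>{- N..N}. A i j = chair (p + i) (q + j)" for N
  proof -
    define P where "P = (\<lambda>(i, j). ((of_int i + 1/2 - t0, of_int j + 1/2 - t0), A i j)) ` ({- N..N} \<times> {- N..N})"
    have "finite P" "P \<subseteq> T" using A by (auto simp: P_def)
    then obtain v where v: "P \<subseteq> translate v chair_plane" using patch by blast
    have inP: "\<exists>k l. of_int i + 1/2 - t0 - fst v = of_int k + 1/2 \<and> of_int j + 1/2 - t0 - snd v = of_int l + 1/2 \<and> A i j = chair k l"
      if "i \<in> {- N..N}" "j \<in> {- N..N}" for i j
      by (rule plane, rule subsetD[OF v]) (use that in \<open>auto simp: P_def\<close>)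
    show ?thesis
    proof (cases "N \<ge> 0")
      case True
      then obtain p q where pq: "1/2 - t0 - fst v = of_int p + 1/2" "1/2 - t0 - snd v = of_int q + 1/2"
        using inP[of 0 0] by auto
      have "A i j = chair (p + i) (q + j)" if "i \<in> {- N..N}" "j \<in> {- N..N}" for i j
      proof -
        note ij = inP[OF that]
        obtain k l where kl: "of_int i + 1/2 - t0 - fst v = of_int k + 1/2"
          "of_int j + 1/2 - t0 - snd v = of_int l + 1/2" "A i j = chair k l"
          using ij by blast
        have "real_of_int k = of_int (p + i)" "real_of_int l = of_int (q + j)"
          using kl(1,2) pq by simp_all
        then have "k = p + i" "l = q + j" by (simp_all only: of_int_eq_iff)
        then show ?thesis using kl by simp
      qed
      then show ?thesis by blast
    qed auto
  qed
  have "\<exists>t. \<forall>i j. \<bar>i\<bar> \<le> 2 ^ m \<longrightarrow> \<bar>j\<bar> \<le> 2 ^ m \<longrightarrow> A i j = chair (t + i) (t + j)" for m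
  proof -
    \<comment> \<open>\<open>symmetric_patch\<close> controls offsets from 0 to 2^(m+1), so it is
      applied at the corner \<open>(p - 2 ^ m, q - 2 ^ m)\<close> to obtain a window centred at
      index (0, 0). The radius 2^(m+4) contains the larger region on which it demands
      symmetry.\<close>
    obtain p q where pq: "\<forall>i\<in>{- (2 ^ (m + 4))..2 ^ (m + 4)}. \<forall>j\<in>{- (2 ^ (m + 4))..2 ^ (m + 4)}. A i j = chair (p + i) (q + j)"
      using A_patch by blast
    let ?W = "{1 - 2 ^ (m + 1 + 1)..2 ^ (m + 1 + 2) - 1 :: int}"
    have one: "(1::int) \<le> 2 ^ m" by simp
    have shift: "i - 2 ^ m \<in> {- (2 ^ (m + 4))..2 ^ (m + 4)}" if "i \<in> ?W" for i :: int
      using that one by (simp add: power_add)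
    have ch: "chair (p - 2 ^ m + i) (q - 2 ^ m + j) = A (i - 2 ^ m) (j - 2 ^ m)"
      if "i \<in> ?W" "j \<in> ?W" for i j
      using pq shift[OF that(1)] shift[OF that(2)] by (simp add: algebra_simps)
    obtain t where t: "\<forall>i\<in>{0..2 ^ (m + 1)}. \<forall>j\<in>{0..2 ^ (m + 1)}. chair (p - 2 ^ m + i) (q - 2 ^ m + j) = chair (t + i) (t + j)"
      using symmetric_patch[of "m + 1" "p - 2 ^ m" "q - 2 ^ m"] ch A_sym by metis
    show ?thesis
    proof (intro exI[of _ "t + 2 ^ m"] allI impI)
      fix i j :: int assume ij: "\<bar>i\<bar> \<le> 2 ^ m" "\<bar>j\<bar> \<le> 2 ^ m"
      have w: "i + 2 ^ m \<in> {0..2 ^ (m + 1)}" "j + 2 ^ m \<in> {0..2 ^ (m + 1)}" using ij by auto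
      have w': "k \<in> ?W" if "k \<in> {0..2 ^ (m + 1)}" for k :: int
      proof -
        have "0 \<le> k" "k \<le> 2 * 2 ^ m" using that by (simp_all add: power_add)
        then have "1 - 4 * 2 ^ m \<le> k" "k \<le> 8 * 2 ^ m - 1" using one by linarith+
        then show ?thesis by (simp add: power_add)
      qed
      show "A i j = chair (t + 2 ^ m + i) (t + 2 ^ m + j)"
      proof -
        have "A i j = chair (p - 2 ^ m + (i + 2 ^ m)) (q - 2 ^ m + (j + 2 ^ m))"
          using ch[OF w'[OF w(1)] w'[OF w(2)]] by simp
        also have "\<dots> = chair (t + (i + 2 ^ m)) (t + (j + 2 ^ m))" using t w by blast
        finally show ?thesis by (simp add: algebra_simps)
      qed
    qed
  qed
  then obtain \<tau> where \<tau>: "\<And>m i j. \<bar>i\<bar> \<le> 2 ^ m \<Longrightarrow> \<bar>j\<bar> \<le> 2 ^ m \<Longrightarrow> A i j = chair (\<tau> m + i) (\<tau> m + j)" by metis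
  define x where "x = (\<lambda>m. t0 + of_int (\<tau> m))"
  have "glued_real m (x m) (x (Suc m))" for m
  proof -
    have "chair (\<tau> m + i) (\<tau> m + j) = chair (\<tau> (Suc m) + i) (\<tau> (Suc m) + j)" if "\<bar>i\<bar> \<le> 2 ^ m" "\<bar>j\<bar> \<le> 2 ^ m" for i j
      using \<tau>[OF that] \<tau>[of i "Suc m" j] that by simp
    from chair_recognize[OF this] show ?thesis
    proof
      assume r: "2 ^ m dvd \<tau> m - \<tau> (Suc m) \<and> (\<tau> m \<ge> 2 ^ m \<and> \<tau> (Suc m) \<ge> 2 ^ m \<or> \<tau> m < - (2 ^ m) \<and> \<tau> (Suc m) < - (2 ^ m))"
      then obtain k where "\<tau> m - \<tau> (Suc m) = 2 ^ m * k" by blast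
      then have k: "\<tau> (Suc m) = \<tau> m + 2 ^ m * (- k)" by simp
      have "x (Suc m) = x m + 2 ^ m * of_int (- k)" unfolding x_def k by simp
      moreover have "2 ^ m \<le> x m \<and> 2 ^ m \<le> x (Suc m) \<or> x m \<le> - (2 ^ m) \<and> x (Suc m) \<le> - (2 ^ m)"
      proof -
        have up: "2 ^ m \<le> t0 + of_int a" if "a \<ge> 2 ^ m" for a
        proof -
          have "real_of_int (2 ^ m) \<le> of_int a" using that by (simp only: of_int_le_iff)
          then have "2 ^ m \<le> real_of_int a" unfolding of_int_power of_int_numeral .
          then show ?thesis using t0 by linarith
        qed
        \<comment> \<open>The strict integer bound leaves the unit that \<open>t0 < 1\<close> may
          use up.\<close>
        have down: "t0 + of_int a \<le> - (2 ^ m)" if "a < - (2 ^ m)" for a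
        proof -
          have "a + 1 \<le> - (2 ^ m)" using that by simp
          then have "real_of_int (a + 1) \<le> of_int (- (2 ^ m))" by (simp only: of_int_le_iff)
          then have "real_of_int a + 1 \<le> - (2 ^ m)"
            unfolding of_int_add of_int_minus of_int_power of_int_numeral of_int_1 .
          then show ?thesis using t0 by linarith
        qed
        show ?thesis unfolding x_def using r up down by blast
      qed
      ultimately show ?thesis unfolding glued_real_def by blast
    next
      assume "\<tau> m = \<tau> (Suc m)"
      then have "x m = x (Suc m)" by (simp only: x_def)
      then show ?thesis using glued_real_refl[of m "x m"] by simp
    qed
  qed
  then have x: "x \<in> threads" by (simp add: threads_def)
  have T_agree: "agree_within (2 ^ m - 1) T (shifted_plane (x m))" for m
    unfolding agree_within_def
  proof (intro allI impI)
    fix c d :: real and a assume cd: "\<bar>c\<bar> \<le> 2 ^ m - 1" "\<bar>d\<bar> \<le> 2 ^ m - 1"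
    have small: "\<bar>i\<bar> \<le> 2 ^ m" if "\<bar>of_int i + 1/2 - t0\<bar> \<le> 2 ^ m - 1" for i
    proof -
      have "real_of_int \<bar>i\<bar> \<le> real_of_int (2 ^ m)" using that t0 by simp
      then show ?thesis by (simp only: of_int_le_iff)
    qed
    show "((c, d), a) \<in> T \<longleftrightarrow> ((c, d), a) \<in> shifted_plane (x m)"
    proof
      assume "((c, d), a) \<in> T"
      then obtain i j where ij: "c = of_int i + 1/2 - t0" "d = of_int j + 1/2 - t0" "a = A i j" using T_ex by blast
      then have "a = chair (\<tau> m + i) (\<tau> m + j)" using \<tau> small cd by simp
      then show "((c, d), a) \<in> shifted_plane (x m)"
        unfolding in_shifted_plane x_def ij(1,2) by (intro exI[of _ "\<tau> m + i"] exI[of _ "\<tau> m + j"]) simp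
    next
      assume "((c, d), a) \<in> shifted_plane (x m)"
      then obtain k l where kl: "c = of_int k + 1/2 - x m" "d = of_int l + 1/2 - x m" "a = chair k l"
        unfolding in_shifted_plane by blast
      define i j where "i = k - \<tau> m" and "j = l - \<tau> m"
      have ij: "c = of_int i + 1/2 - t0" "d = of_int j + 1/2 - t0" using kl by (simp_all add: i_def j_def x_def)
      then have "A i j = chair (\<tau> m + i) (\<tau> m + j)" using \<tau> small cd by simp
      then have "A i j = a" using kl by (simp add: i_def j_def)
      then show "((c, d), a) \<in> T" using A[of i j] ij by simp
    qed
  qed
  have "T = limit_tiling x"
  proof (rule agree_within_eq)
    fix n :: nat
    obtain m where m: "real n \<le> 2 ^ m / 2 - 1" using exists_level by blast
    have "agree_within (2 ^ m / 2 - 1) T (shifted_plane (x m))"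
      by (rule agree_within_mono[OF T_agree]) simp
    then have "agree_within (2 ^ m / 2 - 1) T (limit_tiling x)"
      using agree_within_trans agree_within_sym[OF limit_tiling_agree[OF x]] by blast
    then show "\<exists>B. real n \<le> B \<and> agree_within B T (limit_tiling x)" using m by blast
  qed
  then show ?thesis using x by blast
qed

lemma act_id [simp]: "act id T = T"
proof -
  have "arrow_act id a = a" for a by (rule arrow_act_eqI) simp
  then show ?thesis by (simp add: act_def)
qed

theorem fixed_H7: "{T \<in> chair_tilings. \<forall>h\<in>H7. act h T = T} = limit_tiling ` threads"
  unfolding H7_eq
  using symmetric_tiling_is_limit limit_tiling_in_chair_tilings limit_tiling_symmetric by auto

section \<open>The topology of the fixed space\<close>

declare square.simps [simp del]

lemma agree_on_iff: "agree_on B T T' \<longleftrightarrow> (\<forall>u. square u \<inter> B \<noteq> {} \<longrightarrow> u \<in> T \<longleftrightarrow> u \<in> T')"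
  unfolding agree_on_def by blast

lemma in_square_translate: "p \<in> square (c + v, a) \<longleftrightarrow> p - v \<in> square (c, a)"
proof -
  obtain c1 c2 v1 v2 where "c = (c1, c2)" "v = (v1, v2)" by (cases c; cases v)
  then show ?thesis by (simp add: in_square algebra_simps)
qed

lemma agree_on_translate:
  assumes "agree_on B T T'" shows "agree_on ((+) u ` B) (translate u T) (translate u T')"
  unfolding agree_on_iff
proof (intro allI impI)
  fix t assume ne: "square t \<inter> (+) u ` B \<noteq> {}"
  obtain c a where t: "t = (c, a)" by (cases t)
  obtain p where p: "p \<in> B" "u + p \<in> square (c, a)" using ne t by blast
  then have "p \<in> square (c - u, a)" using in_square_translate[of "u + p" "c - u" u a] by simp
  then have "square (c - u, a) \<inter> B \<noteq> {}" using p by blast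
  then show "t \<in> translate u T \<longleftrightarrow> t \<in> translate u T'"
    using assms unfolding agree_on_iff t in_translate by blast
qed

text \<open>The first pair is moved by \<open>v' - w\<close>, of length at most
  \<open>\<eta> / 2\<close>, to match the translations of the middle tiling. Agreement at scale
  \<open>\<eta> / 4\<close> reaches radius \<open>4 / \<eta>\<close>, so radius
  \<open>1 / \<eta>\<close> survives the move.\<close>

lemma tilings_close_trans:
  assumes \<eta>: "0 < \<eta>" "\<eta> \<le> 1"
    and c: "tilings_close (\<eta> / 4) T1 T2" "tilings_close (\<eta> / 4) T2 T3"
  shows "tilings_close \<eta> T1 T3"
proof -
  obtain v w where vw: "norm v \<le> \<eta> / 4" "norm w \<le> \<eta> / 4"
    "agree_on (cball 0 (1 / (\<eta> / 4))) (translate v T1) (translate w T2)"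
    using c(1) unfolding tilings_close_def by blast
  obtain v' w' where vw': "norm v' \<le> \<eta> / 4" "norm w' \<le> \<eta> / 4"
    "agree_on (cball 0 (1 / (\<eta> / 4))) (translate v' T2) (translate w' T3)"
    using c(2) unfolding tilings_close_def by blast
  define u where "u = v' - w"
  have u: "norm u \<le> \<eta> / 2" using vw(2) vw'(1) norm_triangle_ineq4[of v' w] by (simp add: u_def)
  have a: "agree_on ((+) u ` cball 0 (1 / (\<eta> / 4))) (translate (u + v) T1) (translate v' T2)"
    using agree_on_translate[OF vw(3), of u] by (simp add: translate_translate u_def)
  define q where "q = 1 / \<eta>"
  have "q \<ge> 1" using \<eta> by (simp add: q_def)
  then have "q + \<eta> / 2 \<le> 4 * q" "q \<le> 4 * q" using \<eta> by linarith+
  moreover have "1 / (\<eta> / 4) = 4 * q" by (simp add: q_def)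
  ultimately have r: "1 / \<eta> + \<eta> / 2 \<le> 1 / (\<eta> / 4)" "1 / \<eta> \<le> 1 / (\<eta> / 4)"
    by (simp_all only: q_def[symmetric])
  have sub: "cball 0 (1 / \<eta>) \<subseteq> (+) u ` cball 0 (1 / (\<eta> / 4))"
  proof
    fix p :: plane assume "p \<in> cball 0 (1 / \<eta>)"
    then have "norm (p - u) \<le> 1 / \<eta> + \<eta> / 2" using norm_triangle_ineq4[of p u] u by simp
    then have "p - u \<in> cball 0 (1 / (\<eta> / 4))" using r by simp
    then show "p \<in> (+) u ` cball 0 (1 / (\<eta> / 4))" by (rule rev_image_eqI) simp
  qed
  have sub': "cball (0::plane) (1 / \<eta>) \<subseteq> cball 0 (1 / (\<eta> / 4))" using r by (intro subset_cball)
  have "agree_on (cball 0 (1 / \<eta>)) (translate (u + v) T1) (translate w' T3)"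
    using a vw'(3) sub sub' unfolding agree_on_iff by blast
  moreover have "norm (u + v) \<le> \<eta>" using u vw(1) \<eta> norm_triangle_ineq[of u v] by simp
  moreover have "norm w' \<le> \<eta>" using vw'(2) \<eta> by simp
  ultimately show ?thesis unfolding tilings_close_def by blast
qed

lemma tilings_close_refl: "0 \<le> \<epsilon> \<Longrightarrow> tilings_close \<epsilon> T T"
  unfolding tilings_close_def agree_on_def by (intro exI[of _ 0]) simp

abbreviation fixed_tilings where
  "fixed_tilings H \<equiv> {T \<in> chair_tilings. \<forall>h\<in>H. act h T = T}"

text \<open>Closeness is handled as transitive only up to a change of scale, so a subspace
  neighbourhood is extended by hand: \<open>V\<close> collects the tilings for which all
  sufficiently close fixed tilings lie in \<open>W\<close>, and is open by
  \<open>tilings_close_trans\<close>.\<close>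

lemma openin_fixed_space:
  "openin (fixed_space H) W \<longleftrightarrow> W \<subseteq> fixed_tilings H \<and>
     (\<forall>T\<in>W. \<exists>\<epsilon>>0. \<forall>T'\<in>fixed_tilings H. tilings_close \<epsilon> T T' \<longrightarrow> T' \<in> W)" (is "?L \<longleftrightarrow> ?R")
proof
  assume ?L
  then obtain V where "openin chair_space V" "W = V \<inter> fixed_tilings H"
    unfolding fixed_space_def openin_subtopology by blast
  then show ?R unfolding openin_chair_space by blast
next
  assume R: ?R
  define V where "V = {S \<in> chair_tilings. \<exists>\<epsilon>>0. \<forall>T'\<in>fixed_tilings H. tilings_close \<epsilon> S T' \<longrightarrow> T' \<in> W}"
  have "openin chair_space V"
    unfolding openin_chair_space
  proof (intro conjI ballI)
    show "V \<subseteq> chair_tilings" by (auto simp: V_def)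
    fix S assume "S \<in> V"
    then obtain \<epsilon> where \<epsilon>: "\<epsilon> > 0" "\<forall>T'\<in>fixed_tilings H. tilings_close \<epsilon> S T' \<longrightarrow> T' \<in> W"
      by (auto simp: V_def)
    define \<eta> where "\<eta> = min \<epsilon> 1"
    have \<eta>: "0 < \<eta>" "\<eta> \<le> 1" "\<eta> \<le> \<epsilon>" using \<epsilon> by (auto simp: \<eta>_def)
    show "\<exists>\<delta>>0. \<forall>S'\<in>chair_tilings. tilings_close \<delta> S S' \<longrightarrow> S' \<in> V"
    proof (intro exI[of _ "\<eta> / 4"] conjI ballI impI)
      fix S' assume S': "S' \<in> chair_tilings" "tilings_close (\<eta> / 4) S S'"
      have "T' \<in> W" if T': "T' \<in> fixed_tilings H" "tilings_close (\<eta> / 4) S' T'" for T'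
      proof -
        have "tilings_close \<epsilon> S T'"
          using tilings_close_mono[OF tilings_close_trans[OF \<eta>(1,2) S'(2) T'(2)] \<eta>(1,3)] .
        then show ?thesis using \<epsilon>(2) T'(1) by blast
      qed
      then show "S' \<in> V" using S'(1) \<eta>(1) unfolding V_def by (auto intro!: exI[of _ "\<eta> / 4"])
    qed (use \<eta> in simp)
  qed
  moreover have "W = V \<inter> fixed_tilings H"
  proof
    show "W \<subseteq> V \<inter> fixed_tilings H" using R unfolding V_def by blast
    show "V \<inter> fixed_tilings H \<subseteq> W"
    proof
      fix T assume T: "T \<in> V \<inter> fixed_tilings H"
      then obtain \<epsilon> where "\<epsilon> > 0" "\<forall>T'\<in>fixed_tilings H. tilings_close \<epsilon> T T' \<longrightarrow> T' \<in> W"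
        unfolding V_def by blast
      then show "T \<in> W" using tilings_close_refl[of \<epsilon> T] T by auto
    qed
  qed
  ultimately show ?L unfolding fixed_space_def openin_subtopology by blast
qed

lemma topspace_fixed_space: "topspace (fixed_space H) = fixed_tilings H"
  by (auto simp: fixed_space_def topspace_chair_space)

lemma square_near: "p \<in> square ((c, d), a) \<Longrightarrow> norm p \<le> r \<Longrightarrow> \<bar>c\<bar> \<le> r + 1/2 \<and> \<bar>d\<bar> \<le> r + 1/2"
proof -
  assume "p \<in> square ((c, d), a)" and r: "norm p \<le> r"
  then have "\<bar>fst p - c\<bar> \<le> 1/2" "\<bar>snd p - d\<bar> \<le> 1/2" unfolding in_square by auto
  moreover have "\<bar>fst p\<bar> \<le> r" "\<bar>snd p\<bar> \<le> r"
    using r norm_fst_le[of "fst p" "snd p"] norm_snd_le[of "snd p" "fst p"] by simp_all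
  ultimately show ?thesis by linarith
qed

text \<open>A square meeting the ball has its centre within \<open>1 / \<epsilon> + 1/2\<close> in
  each coordinate, hence the margin in \<open>B\<close>. Only one tiling is moved, and
  \<open>2 * \<bar>d\<bar>\<close> dominates the norm of \<open>(d, d)\<close>.\<close>

lemma tilings_close_if_agree:
  assumes a: "agree_within B T (translate (d, d) T')" and \<epsilon>: "0 < \<epsilon>" "1 / \<epsilon> + 1 \<le> B" "2 * \<bar>d\<bar> \<le> \<epsilon>"
  shows "tilings_close \<epsilon> T T'"
proof -
  have "agree_on (cball 0 (1 / \<epsilon>)) (translate 0 T) (translate (d, d) T')"
    unfolding agree_on_iff
  proof (intro allI impI)
    fix u assume "square u \<inter> cball 0 (1 / \<epsilon>) \<noteq> {}"
    moreover obtain c e b where u: "u = ((c, e), b)" by (metis prod.exhaust)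
    ultimately obtain p where "p \<in> square ((c, e), b)" "norm p \<le> 1 / \<epsilon>" by auto
    from square_near[OF this] have "\<bar>c\<bar> \<le> B" "\<bar>e\<bar> \<le> B" using \<epsilon>(2) by auto
    then show "u \<in> translate 0 T \<longleftrightarrow> u \<in> translate (d, d) T'"
      using a by (simp add: agree_within_def u)
  qed
  moreover have "norm (d, d) \<le> \<epsilon>" using norm_Pair_le[of d d] \<epsilon>(3) by simp
  ultimately show ?thesis unfolding tilings_close_def using \<epsilon>(1) by (metis norm_zero order_less_imp_le)
qed

lemma translate_shifted_plane: "translate (d, d) (shifted_plane t) = shifted_plane (t - d)"
  by (simp add: shifted_plane_def translate_translate)

lemma agree_within_translate:
  assumes "agree_within B T T'" "\<bar>d\<bar> \<le> e"
  shows "agree_within (B - e) (translate (d, d) T) (translate (d, d) T')"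
proof -
  have "\<bar>c - d\<bar> \<le> B" if "\<bar>c\<bar> \<le> B - e" for c using that assms(2) by linarith
  then show ?thesis using assms(1) unfolding agree_within_def in_translate by simp
qed

text \<open>Matching one tile shows that the relative translation differs from the difference of the
  diagonal positions by an integer \<open>m\<close>, the same in both coordinates. Matching the
  window around it lets \<open>chair_recognize\<close> identify the shift by \<open>m\<close> as a
  gluing; what remains is the relative translation.\<close>

lemma close_limit_tilings:
  assumes x: "x \<in> threads" and y: "y \<in> threads"
    and a: "agree_on (cball 0 R) (translate v (limit_tiling x)) (translate w (limit_tiling y))"
    and R: "R \<ge> 2 * (2 ^ (n + 1) + 2)" and small: "norm v \<le> 1/8" "norm w \<le> 1/8"
  shows "\<exists>s t. glued_real n (x n) s \<and> glued_real n (y n) t \<and> \<bar>t - s\<bar> = \<bar>fst w - fst v\<bar>"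
proof -
  obtain v1 v2 where v: "v = (v1, v2)" by (cases v)
  obtain w1 w2 where w: "w = (w1, w2)" by (cases w)
  have vs: "\<bar>v1\<bar> \<le> 1/8" "\<bar>v2\<bar> \<le> 1/8" "\<bar>w1\<bar> \<le> 1/8" "\<bar>w2\<bar> \<le> 1/8"
    using small norm_fst_le[of v1 v2] norm_snd_le[of v2 v1] norm_fst_le[of w1 w2] norm_snd_le[of w2 w1]
    by (simp_all add: v w)
  \<comment> \<open>A level whose representatives describe both tilings on a box with room for the
    ball of radius \<open>R\<close> and the small translations.\<close>
  obtain N0 where N0: "R + 1 \<le> 2 ^ N0 / 2 - 1" using exists_level by blast
  define N where "N = max N0 n"
  have "(2::real) ^ N0 \<le> 2 ^ N" unfolding N_def by (intro power_increasing) auto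
  then have N: "R + 1 \<le> 2 ^ N / 2 - 1" using N0 by linarith
  have nN: "n \<le> N" by (simp add: N_def)
  define s t where "s = x N" and "t = y N"
  define K :: real where "K = 2 ^ (n + 1) + 2"
  have "(1::real) \<le> 2 ^ (n + 1)" by (rule one_le_power) simp
  then have K: "2 * K \<le> R" "K \<ge> 3" using R unfolding K_def by linarith+
  have transfer: "((c - v1, d - v2), b) \<in> shifted_plane s \<longleftrightarrow> ((c - w1, d - w2), b) \<in> shifted_plane t"
    if cd: "\<bar>c\<bar> \<le> K" "\<bar>d\<bar> \<le> K" for c d b
  proof -
    have "norm (c, d) \<le> R" using norm_Pair_le[of c d] cd K by simp
    moreover have "(c, d) \<in> square ((c, d), b)" unfolding in_square by simp
    ultimately have "square ((c, d), b) \<inter> cball 0 R \<noteq> {}" by auto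
    then have "((c, d), b) \<in> translate v (limit_tiling x) \<longleftrightarrow> ((c, d), b) \<in> translate w (limit_tiling y)"
      using a unfolding agree_on_iff by blast
    then have "((c - v1, d - v2), b) \<in> limit_tiling x \<longleftrightarrow> ((c - w1, d - w2), b) \<in> limit_tiling y"
      by (simp add: in_translate v w)
    moreover have "\<bar>c - v1\<bar> \<le> 2 ^ N / 2 - 1" "\<bar>d - v2\<bar> \<le> 2 ^ N / 2 - 1"
      "\<bar>c - w1\<bar> \<le> 2 ^ N / 2 - 1" "\<bar>d - w2\<bar> \<le> 2 ^ N / 2 - 1"
      using cd vs N K by linarith+
    ultimately show ?thesis
      using limit_tiling_agree[OF x, of N] limit_tiling_agree[OF y, of N]
      unfolding agree_within_def s_def t_def by blast
  qed
  define \<sigma> where "\<sigma> = \<lfloor>s\<rfloor>"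
  have \<sigma>: "of_int \<sigma> \<le> s" "s < of_int \<sigma> + 1" unfolding \<sigma>_def by linarith+
  have index: "\<exists>k l. of_int k = of_int (\<sigma> + i) - s + v1 - w1 + t \<and> of_int l = of_int (\<sigma> + j) - s + v2 - w2 + t
      \<and> chair (\<sigma> + i) (\<sigma> + j) = chair k l"
    if ij: "\<bar>i\<bar> \<le> 2 ^ (n + 1)" "\<bar>j\<bar> \<le> 2 ^ (n + 1)" for i j
  proof -
    define c d where "c = of_int (\<sigma> + i) + 1/2 - s + v1" and "d = of_int (\<sigma> + j) + 1/2 - s + v2"
    have r: "\<bar>real_of_int i\<bar> \<le> 2 ^ (n + 1)" if "\<bar>i\<bar> \<le> 2 ^ (n + 1)" for i
    proof -
      have "real_of_int \<bar>i\<bar> \<le> of_int (2 ^ (n + 1))" using that by (simp only: of_int_le_iff)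
      then show ?thesis unfolding of_int_power of_int_numeral of_int_abs .
    qed
    have "\<bar>c\<bar> \<le> K" "\<bar>d\<bar> \<le> K"
      using r[OF ij(1)] r[OF ij(2)] \<sigma> vs unfolding c_def d_def K_def of_int_add by linarith+
    note tr = transfer[OF this, of "chair (\<sigma> + i) (\<sigma> + j)"]
    have "((c - v1, d - v2), chair (\<sigma> + i) (\<sigma> + j)) \<in> shifted_plane s"
      unfolding in_shifted_plane c_def d_def by (intro exI[of _ "\<sigma> + i"] exI[of _ "\<sigma> + j"]) simp
    then have "((c - w1, d - w2), chair (\<sigma> + i) (\<sigma> + j)) \<in> shifted_plane t" using tr by blast
    then obtain k l where "c - w1 = of_int k + 1/2 - t" "d - w2 = of_int l + 1/2 - t" "chair (\<sigma> + i) (\<sigma> + j) = chair k l"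
      unfolding in_shifted_plane by blast
    then show ?thesis unfolding c_def d_def by (intro exI[of _ k] exI[of _ l]) auto
  qed
  obtain k l where kl: "of_int k = of_int \<sigma> - s + v1 - w1 + t" "of_int l = of_int \<sigma> - s + v2 - w2 + t"
    using index[of 0 0] by auto
  \<comment> \<open>The components of \<open>v\<close> and \<open>w\<close> are at most 1/8, so the
    horizontal and the vertical integer shift differ by at most 1/2 and coincide.\<close>
  have "\<bar>real_of_int k - of_int l\<bar> < 1" using kl vs by linarith
  then have "k = l" by linarith
  define m where "m = k - \<sigma>"
  have m: "of_int m = t - s - (w1 - v1)" "of_int m = t - s - (w2 - v2)"
    using kl \<open>k = l\<close> by (simp_all add: m_def)
  have shift: "chair (\<sigma> + i) (\<sigma> + j) = chair (\<sigma> + m + i) (\<sigma> + m + j)"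
    if ij: "\<bar>i\<bar> \<le> 2 ^ (n + 1)" "\<bar>j\<bar> \<le> 2 ^ (n + 1)" for i j
  proof -
    obtain k' l' where kl': "real_of_int k' = of_int (\<sigma> + i) - s + v1 - w1 + t"
      "real_of_int l' = of_int (\<sigma> + j) - s + v2 - w2 + t" "chair (\<sigma> + i) (\<sigma> + j) = chair k' l'"
      using index[OF ij] by blast
    have "real_of_int k' = of_int (\<sigma> + m + i)" "real_of_int l' = of_int (\<sigma> + m + j)"
      using kl' m by simp_all
    then have "k' = \<sigma> + m + i" "l' = \<sigma> + m + j" by (simp_all only: of_int_eq_iff)
    then show ?thesis using kl' by simp
  qed
  have "\<sigma> = \<sigma> + m \<or> (2 ^ (n + 1) dvd \<sigma> - (\<sigma> + m) \<and>
      (\<sigma> \<ge> 2 ^ (n + 1) \<and> \<sigma> + m \<ge> 2 ^ (n + 1) \<or> \<sigma> < - (2 ^ (n + 1)) \<and> \<sigma> + m < - (2 ^ (n + 1))))"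
    by (rule chair_recognize[OF shift])
  then have rec: "m = 0 \<or> (2 ^ (n + 1) dvd m \<and> (\<sigma> \<ge> 2 ^ (n + 1) \<and> \<sigma> + m \<ge> 2 ^ (n + 1) \<or> \<sigma> < - (2 ^ (n + 1)) \<and> \<sigma> + m < - (2 ^ (n + 1))))"
    by auto
  have "glued_real n s (s + of_int m)"
  proof (cases "m = 0")
    case False
    then obtain q where q: "m = 2 ^ (n + 1) * q" using rec by auto
    have "s + of_int m = s + 2 ^ n * of_int (2 * q)" by (simp add: q)
    moreover have "2 ^ n \<le> s \<and> 2 ^ n \<le> s + of_int m \<or> s \<le> - (2 ^ n) \<and> s + of_int m \<le> - (2 ^ n)"
    proof -
      have p: "(2::real) ^ (n + 1) \<ge> 2 ^ n" by simp
      have up: "2 ^ n \<le> real_of_int a" if "a \<ge> 2 ^ (n + 1)" for a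
      proof -
        have "real_of_int (2 ^ (n + 1)) \<le> of_int a" using that by (simp only: of_int_le_iff)
        then show ?thesis using p unfolding of_int_power of_int_numeral by linarith
      qed
      have down: "real_of_int a + 1 \<le> - (2 ^ n)" if "a < - (2 ^ (n + 1))" for a
      proof -
        have "a + 1 \<le> - (2 ^ (n + 1))" using that by simp
        then have "real_of_int (a + 1) \<le> of_int (- (2 ^ (n + 1)))" by (simp only: of_int_le_iff)
        then show ?thesis
          using p unfolding of_int_add of_int_minus of_int_power of_int_numeral of_int_1 by linarith
      qed
      from rec False consider "\<sigma> \<ge> 2 ^ (n + 1)" "\<sigma> + m \<ge> 2 ^ (n + 1)"
        | "\<sigma> < - (2 ^ (n + 1))" "\<sigma> + m < - (2 ^ (n + 1))" by blast
      then show ?thesis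
      proof cases
        case 1
        from up[OF 1(1)] up[OF 1(2)] \<sigma> show ?thesis
          unfolding of_int_add by (intro disjI1 conjI; linarith)
      next
        case 2
        from down[OF 2(1)] down[OF 2(2)] \<sigma> show ?thesis
          unfolding of_int_add by (intro disjI2 conjI; linarith)
      qed
    qed
    ultimately show ?thesis unfolding glued_real_def by blast
  qed simp
  then have "glued_real n (x n) (s + of_int m)"
    using threads_glued[OF x nN] glued_real_trans unfolding s_def by blast
  moreover have "glued_real n (y n) t" using threads_glued[OF y nN] unfolding t_def .
  moreover have "\<bar>t - (s + of_int m)\<bar> = \<bar>fst w - fst v\<bar>" using m by (simp add: v w)
  ultimately show ?thesis by blast
qed

text \<open>The case \<open>v = w = 0\<close> of \<open>close_limit_tilings\<close>. It makes
  membership in a cell readable from any thread of the tiling.\<close>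

lemma limit_tiling_glued:
  assumes "x \<in> threads" "y \<in> threads" "limit_tiling x = limit_tiling y"
  shows "glued_real n (x n) (y n)"
proof -
  have "agree_on (cball 0 (2 * (2 ^ (n + 1) + 2))) (translate 0 (limit_tiling x)) (translate 0 (limit_tiling y))"
    by (simp add: assms(3) agree_on_def)
  from close_limit_tilings[OF assms(1,2) this, of n] obtain s t where
    "glued_real n (x n) s" "glued_real n (y n) t" "s = t" by auto
  then show ?thesis using glued_real_trans glued_real_sym by blast
qed

text \<open>In units of the mesh a shift by 2^n is a shift by 4^n, an integer, and therefore
  commutes with floor and ceiling.\<close>

lemma glued_floor:
  assumes "glued_real n s t"
  shows "glued (4 ^ n) \<lfloor>s * 2 ^ n\<rfloor> \<lfloor>t * 2 ^ n\<rfloor>" "glued (4 ^ n) \<lceil>s * 2 ^ n\<rceil> \<lceil>t * 2 ^ n\<rceil>"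
proof -
  have "glued (4 ^ n) \<lfloor>s * 2 ^ n\<rfloor> \<lfloor>t * 2 ^ n\<rfloor> \<and> glued (4 ^ n) \<lceil>s * 2 ^ n\<rceil> \<lceil>t * 2 ^ n\<rceil>"
  proof (cases "s = t")
    case False
    then obtain k :: int where k: "t = s + 2 ^ n * of_int k"
      and sgn: "2 ^ n \<le> s \<and> 2 ^ n \<le> t \<or> s \<le> - (2 ^ n) \<and> t \<le> - (2 ^ n)"
      using assms by (auto simp: glued_real_def)
    have four: "(4::real) ^ n = 2 ^ n * 2 ^ n" by (simp flip: power_mult_distrib)
    have e: "t * 2 ^ n = s * 2 ^ n + of_int (4 ^ n * k)" using k by (simp add: algebra_simps four)
    have fc: "\<lfloor>t * 2 ^ n\<rfloor> = \<lfloor>s * 2 ^ n\<rfloor> + 4 ^ n * k" "\<lceil>t * 2 ^ n\<rceil> = \<lceil>s * 2 ^ n\<rceil> + 4 ^ n * k"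
      unfolding e floor_add_int[symmetric] ceiling_add_of_int by simp_all
    have up: "4 ^ n \<le> \<lfloor>r * 2 ^ n\<rfloor> \<and> 4 ^ n \<le> \<lceil>r * 2 ^ n\<rceil>" if "2 ^ n \<le> r" for r :: real
    proof -
      have "2 ^ n * 2 ^ n \<le> r * 2 ^ n" using that by (intro mult_right_mono) auto
      then have "of_int (4 ^ n) \<le> r * 2 ^ n" by (simp add: four)
      then have "4 ^ n \<le> \<lfloor>r * 2 ^ n\<rfloor>" by (simp only: le_floor_iff)
      then show ?thesis using floor_le_ceiling order_trans by blast
    qed
    have down: "\<lfloor>r * 2 ^ n\<rfloor> \<le> - (4 ^ n) \<and> \<lceil>r * 2 ^ n\<rceil> \<le> - (4 ^ n)" if "r \<le> - (2 ^ n)" for r :: real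
    proof -
      have "r * 2 ^ n \<le> - (2 ^ n) * 2 ^ n" using that by (intro mult_right_mono) auto
      then have "r * 2 ^ n \<le> of_int (- (4 ^ n))" by (simp add: four)
      then have "\<lceil>r * 2 ^ n\<rceil> \<le> - (4 ^ n)" by (simp only: ceiling_le_iff)
      then show ?thesis using floor_le_ceiling order_trans by blast
    qed
    show ?thesis
      using sgn up[of s] up[of t] down[of s] down[of t] fc unfolding glued_def by auto
  qed simp
  then show "glued (4 ^ n) \<lfloor>s * 2 ^ n\<rfloor> \<lfloor>t * 2 ^ n\<rfloor>" "glued (4 ^ n) \<lceil>s * 2 ^ n\<rceil> \<lceil>t * 2 ^ n\<rceil>" by auto
qed

text \<open>Floor and ceiling are the ends of the mesh edge through \<open>s\<close>. They coincide
  when \<open>s\<close> is itself a vertex, so a vertex lies in its own star only and the stars are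
  open.\<close>

definition near_vertex :: "nat \<Rightarrow> int \<Rightarrow> real \<Rightarrow> bool" where
  "near_vertex n j s \<longleftrightarrow> glued (4 ^ n) j \<lfloor>s * 2 ^ n\<rfloor> \<or> glued (4 ^ n) j \<lceil>s * 2 ^ n\<rceil>"

text \<open>The open star of the vertex \<open>j\<close> of the dumbbell with mesh \<open>1 / 2 ^ n\<close>.\<close>

definition cell :: "nat \<Rightarrow> int \<Rightarrow> tile set set" where
  "cell n j = limit_tiling ` {x \<in> threads. near_vertex n j (x n)}"

lemma near_vertex_glued:
  assumes "near_vertex n j s" "glued_real n s t" shows "near_vertex n j t"
proof -
  have "(0::int) < 4 ^ n" by simp
  then show ?thesis using assms glued_floor[OF assms(2)] glued_trans unfolding near_vertex_def by blast
qed

lemma in_cell: "x \<in> threads \<Longrightarrow> limit_tiling x \<in> cell n j \<longleftrightarrow> near_vertex n j (x n)"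
proof
  assume x: "x \<in> threads" and "limit_tiling x \<in> cell n j"
  then obtain y where "y \<in> threads" "limit_tiling x = limit_tiling y" "near_vertex n j (y n)"
    unfolding cell_def by blast
  then show "near_vertex n j (x n)"
    using near_vertex_glued limit_tiling_glued[of y x n] x by simp
qed (auto simp: cell_def)

lemma in_cell_const: "shifted_plane t \<in> cell n j \<longleftrightarrow> near_vertex n j t"
  using in_cell[OF const_thread[of t]] by (simp add: limit_tiling_const)

lemma cell_eq_iff: "cell n a = cell n b \<longleftrightarrow> glued (4 ^ n) a b"
proof
  assume eq: "cell n a = cell n b"
  \<comment> \<open>The vertex \<open>a\<close> lies only in the stars of labels glued to
    \<open>a\<close>, which tells the cells apart.\<close>
  have "near_vertex n a (of_int a / 2 ^ n)" by (simp add: near_vertex_def)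
  then have "near_vertex n b (of_int a / 2 ^ n)" using in_cell_const eq by blast
  then show "glued (4 ^ n) a b" by (auto simp: near_vertex_def glued_sym)
next
  assume g: "glued (4 ^ n) a b"
  have "(0::int) < 4 ^ n" by simp
  then have "near_vertex n a = near_vertex n b"
    using g glued_sym glued_trans unfolding near_vertex_def fun_eq_iff by meson
  then show "cell n a = cell n b" by (simp add: cell_def)
qed

lemma cell_refine: "cell (Suc n) a \<subseteq> cell n (a div 2)"
proof
  fix T assume "T \<in> cell (Suc n) a"
  then obtain x where x: "x \<in> threads" "T = limit_tiling x" and nv: "near_vertex (Suc n) a (x (Suc n))"
    by (auto simp: cell_def)
  define Y where "Y = x (Suc n) * 2 ^ Suc n"
  have Y: "x (Suc n) * 2 ^ n = Y / 2" by (simp add: Y_def)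
  \<comment> \<open>Halving respects floors exactly, while half a ceiling may round to either end of
    the coarser edge.\<close>
  have "\<lfloor>Y\<rfloor> div 2 = \<lfloor>Y / 2\<rfloor>" by linarith
  moreover have "\<lceil>Y\<rceil> div 2 = \<lfloor>Y / 2\<rfloor> \<or> \<lceil>Y\<rceil> div 2 = \<lceil>Y / 2\<rceil>" by linarith
  ultimately have "near_vertex n (a div 2) (x (Suc n))"
    using nv glued_div_2 unfolding near_vertex_def Y Y_def[symmetric] by metis
  then have "near_vertex n (a div 2) (x n)"
    using near_vertex_glued glued_real_sym x(1) unfolding threads_def by blast
  then show "T \<in> cell n (a div 2)" using x in_cell by blast
qed

text \<open>Points near an integer keep it as one end of their edge and gain another end, so only an
  inclusion survives; it is the one that openness of the stars requires.\<close>

lemma floor_ceiling_stable: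
  fixes X :: real
  obtains \<delta> where "\<delta> > 0" "\<And>Y. \<bar>Y - X\<bar> < \<delta> \<Longrightarrow> {\<lfloor>X\<rfloor>, \<lceil>X\<rceil>} \<subseteq> {\<lfloor>Y\<rfloor>, \<lceil>Y\<rceil>}"
proof (cases "X = of_int \<lfloor>X\<rfloor>")
  case True
  then obtain k where k: "X = of_int k" by blast
  show ?thesis
  proof (rule that[of 1])
    fix Y assume "\<bar>Y - X\<bar> < 1"
    then have "\<lfloor>Y\<rfloor> = k \<or> \<lceil>Y\<rceil> = k" unfolding k by linarith
    then show "{\<lfloor>X\<rfloor>, \<lceil>X\<rceil>} \<subseteq> {\<lfloor>Y\<rfloor>, \<lceil>Y\<rceil>}" by (auto simp: k)
  qed simp
next
  case False
  show ?thesis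
  proof (rule that[of "min (X - of_int \<lfloor>X\<rfloor>) (of_int \<lfloor>X\<rfloor> + 1 - X)"])
    show "min (X - of_int \<lfloor>X\<rfloor>) (of_int \<lfloor>X\<rfloor> + 1 - X) > 0" using False by linarith
    fix Y assume "\<bar>Y - X\<bar> < min (X - of_int \<lfloor>X\<rfloor>) (of_int \<lfloor>X\<rfloor> + 1 - X)"
    then have "of_int \<lfloor>X\<rfloor> < Y" "Y < of_int \<lfloor>X\<rfloor> + 1" by linarith+
    then have "\<lfloor>Y\<rfloor> = \<lfloor>X\<rfloor>" "\<lceil>Y\<rceil> = \<lfloor>X\<rfloor> + 1" by linarith+
    moreover have "\<lceil>X\<rceil> = \<lfloor>X\<rfloor> + 1" using False by linarith
    ultimately show "{\<lfloor>X\<rfloor>, \<lceil>X\<rceil>} \<subseteq> {\<lfloor>Y\<rfloor>, \<lceil>Y\<rceil>}" by simp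
  qed
qed

lemma near_vertex_stable:
  obtains \<delta> where "\<delta> > 0"
    "\<And>s t. glued_real n r s \<Longrightarrow> \<bar>t - s\<bar> < \<delta> \<Longrightarrow> near_vertex n j r \<Longrightarrow> near_vertex n j t"
proof -
  obtain \<delta> where \<delta>: "\<delta> > 0" "\<And>Y. \<bar>Y - r * 2 ^ n\<bar> < \<delta> \<Longrightarrow> {\<lfloor>r * 2 ^ n\<rfloor>, \<lceil>r * 2 ^ n\<rceil>} \<subseteq> {\<lfloor>Y\<rfloor>, \<lceil>Y\<rceil>}"
    using floor_ceiling_stable by blast
  show thesis
  proof (rule that[of "\<delta> / 2 ^ n"])
    show "\<delta> / 2 ^ n > 0" using \<delta>(1) by simp
    fix s t assume g: "glued_real n r s" and ts: "\<bar>t - s\<bar> < \<delta> / 2 ^ n" and nv: "near_vertex n j r"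
    obtain k :: int where k: "s = r + 2 ^ n * of_int k"
    proof (cases "r = s")
      case True then show ?thesis using that[of 0] by simp
    next
      case False then show ?thesis using g that unfolding glued_real_def by blast
    qed
    have four: "(4::real) ^ n = 2 ^ n * 2 ^ n" by (simp flip: power_mult_distrib)
    have e: "s * 2 ^ n = r * 2 ^ n + of_int (4 ^ n * k)" using k by (simp add: algebra_simps four)
    \<comment> \<open>\<open>Y\<close> is \<open>t\<close> carried back along the gluing to the
      neighbourhood of \<open>r\<close>, in units of the mesh; thus a single \<open>\<delta>\<close>
      serves all glued copies of \<open>r\<close>.\<close>
    define Y where "Y = t * 2 ^ n - of_int (4 ^ n * k)"
    have "Y - r * 2 ^ n = (t - s) * 2 ^ n" unfolding Y_def using e by (simp add: algebra_simps)
    then have "\<bar>Y - r * 2 ^ n\<bar> = \<bar>t - s\<bar> * 2 ^ n" by (simp add: abs_mult)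
    also have "\<dots> < \<delta>" using ts by (simp add: field_simps)
    finally have sub: "{\<lfloor>r * 2 ^ n\<rfloor>, \<lceil>r * 2 ^ n\<rceil>} \<subseteq> {\<lfloor>Y\<rfloor>, \<lceil>Y\<rceil>}" by (rule \<delta>(2))
    have Y: "\<lfloor>t * 2 ^ n\<rfloor> = \<lfloor>Y\<rfloor> + 4 ^ n * k" "\<lceil>t * 2 ^ n\<rceil> = \<lceil>Y\<rceil> + 4 ^ n * k"
      "\<lfloor>s * 2 ^ n\<rfloor> = \<lfloor>r * 2 ^ n\<rfloor> + 4 ^ n * k" "\<lceil>s * 2 ^ n\<rceil> = \<lceil>r * 2 ^ n\<rceil> + 4 ^ n * k"
      unfolding Y_def e by (simp_all add: ceiling_diff_of_int floor_diff_of_int del: of_int_mult of_int_power)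
    have "near_vertex n j s" by (rule near_vertex_glued[OF nv g])
    then show "near_vertex n j t" using sub unfolding near_vertex_def Y by auto
  qed
qed

lemma openin_cell: "openin (fixed_space H7) (cell n j)"
  unfolding openin_fixed_space fixed_H7
proof (intro conjI ballI)
  show "cell n j \<subseteq> limit_tiling ` threads" by (auto simp: cell_def)
  fix T assume "T \<in> cell n j"
  then obtain x where x: "x \<in> threads" "T = limit_tiling x" "near_vertex n j (x n)"
    by (auto simp: cell_def)
  obtain \<delta> where \<delta>: "\<delta> > 0"
    "\<And>s t. glued_real n (x n) s \<Longrightarrow> \<bar>t - s\<bar> < \<delta> \<Longrightarrow> near_vertex n j (x n) \<Longrightarrow> near_vertex n j t"
    using near_vertex_stable by blast
  define R :: real where "R = 2 * (2 ^ (n + 1) + 2)"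
  have R: "R \<ge> 8" by (simp add: R_def)
  \<comment> \<open>\<open>1 / R\<close> grants the radius and the bound 1/8 for
    \<open>close_limit_tilings\<close>; \<open>\<delta> / 3\<close> keeps the two translations
    together below \<open>\<delta>\<close>.\<close>
  define \<epsilon> where "\<epsilon> = min (1 / R) (\<delta> / 3)"
  have \<epsilon>: "\<epsilon> > 0" "\<epsilon> \<le> 1 / R" "\<epsilon> \<le> \<delta> / 3" using \<delta>(1) R by (auto simp: \<epsilon>_def)
  have "1 / R \<le> 1 / 8" using R by (intro divide_left_mono) auto
  then have e8: "\<epsilon> \<le> 1 / 8" using \<epsilon>(2) by linarith
  have eR: "R \<le> 1 / \<epsilon>" using \<epsilon>(1,2) R by (simp add: field_simps)
  show "\<exists>\<epsilon>>0. \<forall>T'\<in>limit_tiling ` threads. tilings_close \<epsilon> T T' \<longrightarrow> T' \<in> cell n j"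
  proof (intro exI[of _ \<epsilon>] conjI ballI impI)
    fix T' assume "T' \<in> limit_tiling ` threads" and c: "tilings_close \<epsilon> T T'"
    then obtain y where y: "y \<in> threads" "T' = limit_tiling y" by blast
    obtain v w where vw: "norm v \<le> \<epsilon>" "norm w \<le> \<epsilon>"
      "agree_on (cball 0 (1 / \<epsilon>)) (translate v (limit_tiling x)) (translate w (limit_tiling y))"
      using c unfolding tilings_close_def x(2) y(2) by blast
    obtain s t where st: "glued_real n (x n) s" "glued_real n (y n) t" "\<bar>t - s\<bar> = \<bar>fst w - fst v\<bar>"
      using close_limit_tilings[OF x(1) y(1) vw(3), of n] eR e8 vw(1,2) unfolding R_def by auto
    have "\<bar>fst v\<bar> \<le> \<epsilon>" "\<bar>fst w\<bar> \<le> \<epsilon>"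
      using vw(1,2) norm_fst_le[of "fst v" "snd v"] norm_fst_le[of "fst w" "snd w"] by simp_all
    then have "\<bar>t - s\<bar> < \<delta>" using st(3) \<epsilon> \<delta>(1) by linarith
    then have "near_vertex n j t" by (rule \<delta>(2)[OF st(1) _ x(3)])
    then have "near_vertex n j (y n)" using near_vertex_glued glued_real_sym[OF st(2)] by blast
    then show "T' \<in> cell n j" using in_cell y by blast
  qed (rule \<epsilon>(1))
qed

text \<open>A thread in the cell may sit near a label \<open>c\<close> that is merely glued to
  \<open>j\<close>. Shifting by the corresponding multiple of 2^n brings it next to \<open>j\<close>
  itself, at the price of one unit of radius in \<open>shifted_plane_agree\<close>.\<close>

lemma cell_approx:
  assumes "T \<in> cell n j"
  shows "\<exists>s. \<bar>s * 2 ^ n - of_int j\<bar> < 1 \<and> agree_within (2 ^ n / 2 - 2) T (shifted_plane s)"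
proof -
  obtain x where x: "x \<in> threads" "T = limit_tiling x" "near_vertex n j (x n)"
    using assms by (auto simp: cell_def)
  define r where "r = x n"
  have T: "agree_within (2 ^ n / 2 - 2) T (shifted_plane r)"
    unfolding x(2) r_def by (rule agree_within_mono[OF limit_tiling_agree[OF x(1)]]) simp
  obtain c where c: "glued (4 ^ n) j c" "\<bar>r * 2 ^ n - of_int c\<bar> < 1"
  proof -
    have "\<bar>r * 2 ^ n - of_int \<lfloor>r * 2 ^ n\<rfloor>\<bar> < 1" "\<bar>r * 2 ^ n - of_int \<lceil>r * 2 ^ n\<rceil>\<bar> < 1" by linarith+
    then show thesis using x(3) that unfolding near_vertex_def r_def[symmetric] by blast
  qed
  show ?thesis
  proof (cases "j = c")
    case True then show ?thesis using T c by blast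
  next
    case False
    then obtain k where k: "j - c = 4 ^ n * k" using c(1) by (auto simp: glued_def)
    have four: "(4::real) ^ n = 2 ^ n * 2 ^ n" by (simp flip: power_mult_distrib)
    define s where "s = r + 2 ^ n * of_int k"
    have "j = c + 4 ^ n * k" using k by simp
    then have "real_of_int j = of_int (c + 4 ^ n * k)" by (simp only:)
    then have j: "real_of_int j = of_int c + 4 ^ n * of_int k"
      unfolding of_int_add of_int_mult of_int_power of_int_numeral .
    have "s * 2 ^ n = r * 2 ^ n + 4 ^ n * of_int k" by (simp add: s_def four algebra_simps)
    then have sj: "\<bar>s * 2 ^ n - of_int j\<bar> < 1" using c(2) j by simp
    have p: "(1::real) \<le> 2 ^ n" by simp
    \<comment> \<open>A position one mesh step short of label 4^n still exceeds 2^n - 1, which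
      absorbs the rounding near the start of a circle.\<close>
    have bound: "2 ^ n - 1 \<le> u" if "4 ^ n - 1 \<le> u * 2 ^ n" for u :: real
    proof -
      have "(2 ^ n - 1) * 2 ^ n = (4 ^ n - 2 ^ n :: real)" by (simp add: four algebra_simps)
      then have "(2 ^ n - 1) * 2 ^ n \<le> u * 2 ^ n" using that p by linarith
      then show ?thesis by (rule mult_right_le_imp_le) simp
    qed
    have half: "2 ^ n / 2 - 1 \<le> u" if "4 ^ n - 1 \<le> u * 2 ^ n" for u :: real
      using bound[OF that] p by linarith
    have "j \<ge> 4 ^ n \<and> c \<ge> 4 ^ n \<or> j \<le> - (4 ^ n) \<and> c \<le> - (4 ^ n)"
      using False c(1) by (auto simp: glued_def)
    then have sgn: "2 ^ n / 2 - 1 \<le> r \<and> 2 ^ n / 2 - 1 \<le> s \<or> r \<le> - (2 ^ n / 2 - 1) \<and> s \<le> - (2 ^ n / 2 - 1)"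
    proof
      assume "j \<ge> 4 ^ n \<and> c \<ge> 4 ^ n"
      then have "real_of_int (4 ^ n) \<le> of_int j" "real_of_int (4 ^ n) \<le> of_int c" by (simp_all only: of_int_le_iff)
      then have "4 ^ n \<le> real_of_int j" "4 ^ n \<le> real_of_int c" unfolding of_int_power of_int_numeral .
      then have "4 ^ n - 1 \<le> r * 2 ^ n" "4 ^ n - 1 \<le> s * 2 ^ n" using sj c(2) by linarith+
      then show ?thesis using half by blast
    next
      assume "j \<le> - (4 ^ n) \<and> c \<le> - (4 ^ n)"
      then have "real_of_int j \<le> of_int (- (4 ^ n))" "real_of_int c \<le> of_int (- (4 ^ n))" by (simp_all only: of_int_le_iff)
      then have "real_of_int j \<le> - (4 ^ n)" "real_of_int c \<le> - (4 ^ n)"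
        unfolding of_int_minus of_int_power of_int_numeral .
      then have "4 ^ n - 1 \<le> - r * 2 ^ n" "4 ^ n - 1 \<le> - s * 2 ^ n" using sj c(2) by linarith+
      then have "2 ^ n / 2 - 1 \<le> - r" "2 ^ n / 2 - 1 \<le> - s" using half by blast+
      then show ?thesis by linarith
    qed
    have "agree_within (2 ^ n / 2 - 1 - 1) (shifted_plane r) (shifted_plane s)"
      using shifted_plane_agree[OF s_def _ sgn] by simp
    then have "agree_within (2 ^ n / 2 - 2) (shifted_plane r) (shifted_plane s)" by simp
    then show ?thesis using sj agree_within_trans[OF T] by blast
  qed
qed

section \<open>Compactness of threads and cofinality of the cells\<close>

lemma glued_real_bounded: "\<exists>r. glued_real k s r \<and> \<bar>r\<bar> \<le> 2 ^ (k + 1)"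
proof -
  have p: "(0::real) < 2 ^ k" by simp
  consider "\<bar>s\<bar> < 2 ^ k" | "s \<ge> 2 ^ k" | "s \<le> - (2 ^ k)" by linarith
  then show ?thesis
  proof cases
    case 1
    then show ?thesis by (intro exI[of _ s]) simp
  next
    case 2
    define m where "m = \<lfloor>s / 2 ^ k\<rfloor> - 1"
    define r where "r = s + 2 ^ k * of_int (- m)"
    have "of_int (m + 1) * 2 ^ k \<le> s" "s < of_int (m + 2) * 2 ^ k"
      using floor_divide_lower[OF p, of s] floor_divide_upper[OF p, of s] by (simp_all add: m_def algebra_simps)
    then have r: "2 ^ k \<le> r" "r \<le> 2 ^ (k + 1)" by (simp_all add: r_def algebra_simps)
    then have "\<bar>r\<bar> \<le> 2 ^ (k + 1)" using p by linarith
    moreover have "glued_real k s r" unfolding glued_real_def using 2 r(1) r_def by blast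
    ultimately show ?thesis by blast
  next
    case 3
    define m where "m = \<lfloor>- s / 2 ^ k\<rfloor> - 1"
    define r where "r = s + 2 ^ k * of_int m"
    have "of_int (m + 1) * 2 ^ k \<le> - s" "- s < of_int (m + 2) * 2 ^ k"
      using floor_divide_lower[OF p, of "- s"] floor_divide_upper[OF p, of "- s"] by (simp_all add: m_def algebra_simps)
    then have r: "r \<le> - (2 ^ k)" "- r \<le> 2 ^ (k + 1)" by (simp_all add: r_def algebra_simps)
    then have "\<bar>r\<bar> \<le> 2 ^ (k + 1)" using p by linarith
    moreover have "glued_real k s r" unfolding glued_real_def using 3 r(1) r_def by blast
    ultimately show ?thesis by blast
  qed
qed

text \<open>Gluing is a closed relation: the diagonal together with an integrality condition, closed
  since the integers are, on two closed quadrants.\<close>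

lemma glued_real_limit:
  assumes u: "u \<longlonglongrightarrow> s" and w: "w \<longlonglongrightarrow> t" and g: "\<And>i. glued_real k (u i) (w i)"
  shows "glued_real k s t"
proof -
  define Q where "Q = {p :: real \<times> real. glued_real k (fst p) (snd p)}"
  have p: "(0::real) < 2 ^ k" by simp
  have ex: "(\<exists>m::int. b = a + 2 ^ k * of_int m) \<longleftrightarrow> (b - a) / 2 ^ k \<in> \<int>" for a b :: real
  proof
    assume "\<exists>m::int. b = a + 2 ^ k * of_int m" then show "(b - a) / 2 ^ k \<in> \<int>" by auto
  next
    assume "(b - a) / 2 ^ k \<in> \<int>"
    then obtain m where "(b - a) / 2 ^ k = of_int m" by (auto elim: Ints_cases)
    then show "\<exists>m::int. b = a + 2 ^ k * of_int m" by (intro exI[of _ m]) (simp add: field_simps)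
  qed
  have Q: "Q = {p. fst p = snd p} \<union>
      ((\<lambda>p. (snd p - fst p) / 2 ^ k) -` \<int> \<inter>
       ({p. 2 ^ k \<le> fst p} \<inter> {p. 2 ^ k \<le> snd p} \<union> {p. fst p \<le> - (2 ^ k)} \<inter> {p. snd p \<le> - (2 ^ k)}))"
    unfolding Q_def glued_real_def ex by auto
  have "closed Q"
    unfolding Q
    by (intro closed_Un closed_Int closed_Collect_eq closed_Collect_le closed_vimage closed_Ints continuous_intros) simp_all
  moreover have "(\<lambda>i. (u i, w i)) \<longlonglongrightarrow> (s, t)" by (intro tendsto_Pair u w)
  moreover have "(u i, w i) \<in> Q" for i using g by (simp add: Q_def)
  ultimately have "(s, t) \<in> Q" by (meson closed_sequentially)
  then show ?thesis by (simp add: Q_def)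
qed

text \<open>\<open>\<rho> n k\<close> is a bounded representative of \<open>s n\<close> at level
  \<open>k\<close>, so the sequences \<open>\<rho> n\<close> lie in a product of compact intervals;
  \<open>glued_real_limit\<close> makes the limit a thread.\<close>

lemma threads_compact:
  fixes s :: "nat \<Rightarrow> real"
  obtains \<rho> r y where "strict_mono (r :: nat \<Rightarrow> nat)" "y \<in> threads"
    "\<And>n k. glued_real k (s n) (\<rho> n k)" "\<And>k. (\<lambda>n. \<rho> (r n) k) \<longlonglongrightarrow> y k"
proof -
  define \<rho> where "\<rho> = (\<lambda>n k. SOME r. glued_real k (s n) r \<and> \<bar>r\<bar> \<le> 2 ^ (k + 1))"
  have \<rho>: "glued_real k (s n) (\<rho> n k)" "\<bar>\<rho> n k\<bar> \<le> 2 ^ (k + 1)" for n k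
    using someI_ex[OF glued_real_bounded[of k "s n"]] by (simp_all only: \<rho>_def)
  define C where "C = (\<Pi>\<^sub>E k\<in>UNIV. {- (2 ^ (k + 1))..2 ^ (k + 1) :: real})"
  have "compactin (product_topology (\<lambda>_. euclidean) UNIV) C"
    unfolding C_def compactin_PiE by simp
  then have "compact C"
    unfolding euclidean_product_topology by simp
  moreover have "\<forall>n. \<rho> n \<in> C" using \<rho>(2) by (auto simp: C_def abs_le_iff minus_le_iff)
  ultimately obtain y r where r: "strict_mono r" and y: "(\<rho> \<circ> r) \<longlonglongrightarrow> y"
    using compact_imp_seq_compact seq_compactE by metis
  have coord: "(\<lambda>n. \<rho> (r n) k) \<longlonglongrightarrow> y k" for k
  proof -
    have "continuous_on UNIV (\<lambda>x :: nat \<Rightarrow> real. x k)" by simp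
    then have "isCont (\<lambda>x. x k) y" by (simp only: continuous_on_eq_continuous_at[OF open_UNIV] ball_UNIV)
    from isCont_tendsto_compose[OF this y] show ?thesis by (simp add: o_def)
  qed
  have "glued_real k (y k) (y (Suc k))" for k
  proof (rule glued_real_limit[OF coord coord])
    fix n
    have "glued_real k (s (r n)) (\<rho> (r n) (Suc k))" using glued_real_le[OF \<rho>(1)[where k = "Suc k"]] by simp
    then show "glued_real k (\<rho> (r n) k) (\<rho> (r n) (Suc k))"
      using glued_real_trans[OF glued_real_sym[OF \<rho>(1)]] by blast
  qed
  then have "y \<in> threads" by (simp add: threads_def)
  then show thesis using that[OF r _ \<rho>(1) coord] by blast
qed

text \<open>If at every level some cell fits into no member of the cover, the vertices of these
  cells accumulate at a thread \<open>y\<close>; the member containing the tiling of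
  \<open>y\<close> then swallows one of them.\<close>

lemma cells_cofinal:
  assumes "\<W> \<in> open_covers (fixed_space H7)"
  shows "\<exists>n. refined_by \<W> (range (cell n))"
proof (rule ccontr)
  assume "\<not> ?thesis"
  then have "\<forall>n. \<exists>j. \<forall>W\<in>\<W>. \<not> cell n j \<subseteq> W" unfolding refined_by_def by fastforce
  then obtain j where j: "\<And>n W. W \<in> \<W> \<Longrightarrow> \<not> cell n (j n) \<subseteq> W" by metis
  define s where "s = (\<lambda>n. of_int (j n) / 2 ^ n :: real)"
  obtain \<rho> r y where r: "strict_mono r" and y: "y \<in> threads" and \<rho>: "\<And>n k. glued_real k (s n) (\<rho> n k)"
    and lim: "\<And>k. (\<lambda>n. \<rho> (r n) k) \<longlonglongrightarrow> y k"
    using threads_compact[of s] by metis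
  have "limit_tiling y \<in> topspace (fixed_space H7)" using y by (simp add: topspace_fixed_space fixed_H7)
  then obtain W where W: "W \<in> \<W>" "limit_tiling y \<in> W" "openin (fixed_space H7) W"
    using assms unfolding open_covers_def by blast
  have "\<forall>T\<in>W. \<exists>\<epsilon>>0. \<forall>T'\<in>limit_tiling ` threads. tilings_close \<epsilon> T T' \<longrightarrow> T' \<in> W"
    using W(3) unfolding openin_fixed_space fixed_H7 by (rule conjunct2)
  from bspec[OF this W(2)]
  obtain \<epsilon>0 where \<epsilon>0: "\<epsilon>0 > 0" "\<forall>T'\<in>limit_tiling ` threads. tilings_close \<epsilon>0 (limit_tiling y) T' \<longrightarrow> T' \<in> W"
    by blast
  define \<epsilon> where "\<epsilon> = min \<epsilon>0 1"
  have \<epsilon>: "0 < \<epsilon>" "\<epsilon> \<le> 1" "\<epsilon> \<le> \<epsilon>0" using \<epsilon>0 by (auto simp: \<epsilon>_def)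
  obtain k where k: "1 / \<epsilon> + 5 \<le> 2 ^ k / 2 - 1" using exists_level by blast
  obtain N1 where N1: "\<And>n. n \<ge> N1 \<Longrightarrow> \<bar>\<rho> (r n) k - y k\<bar> < \<epsilon> / 4"
    using LIMSEQ_D[OF lim[of k], of "\<epsilon> / 4"] \<epsilon>(1) by auto
  obtain N2 where N2: "inverse (real (Suc N2)) < \<epsilon> / 4" using reals_Archimedean[of "\<epsilon> / 4"] \<epsilon>(1) by auto
  define n where "n = max N1 (max k (Suc N2))"
  define N where "N = r n"
  have N: "N \<ge> k" "N \<ge> Suc N2"
    using seq_suble[OF r, of n] unfolding N_def n_def by linarith+
  have "1 / 2 ^ N \<le> \<epsilon> / 4"
  proof -
    have "real (Suc N2) \<le> 2 ^ N" using N(2) of_nat_less_two_power[of N, where 'a = real] by linarith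
    then have "1 / 2 ^ N \<le> inverse (real (Suc N2))" by (simp add: field_simps)
    then show ?thesis using N2 by linarith
  qed
  note mesh = this
  have "cell N (j N) \<subseteq> W"
  proof
    fix T assume T: "T \<in> cell N (j N)"
    then obtain t where t: "\<bar>t * 2 ^ N - of_int (j N)\<bar> < 1" "agree_within (2 ^ N / 2 - 2) T (shifted_plane t)"
      using cell_approx by blast
    have "t - s N = (t * 2 ^ N - of_int (j N)) / 2 ^ N" by (simp add: s_def field_simps)
    then have "\<bar>t - s N\<bar> = \<bar>t * 2 ^ N - of_int (j N)\<bar> / 2 ^ N" by (simp only: abs_divide) simp
    also have "\<dots> \<le> 1 / 2 ^ N" using t(1) by (intro divide_right_mono) auto
    finally have e2: "\<bar>t - s N\<bar> \<le> \<epsilon> / 4" using mesh by linarith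
    \<comment> \<open>\<open>d1\<close> separates the representative of the vertex from its limit,
      \<open>d2\<close> the tiling \<open>T\<close> from the vertex. Agreement runs from
      \<open>y k = \<rho> N k - d1\<close> over \<open>s N - d1\<close> to
      \<open>t - (d1 + d2)\<close>, so \<open>T\<close> is moved by \<open>d1 + d2\<close>.\<close>
    define d1 d2 where "d1 = \<rho> N k - y k" and "d2 = t - s N"
    have d1: "\<bar>d1\<bar> < \<epsilon> / 4" using N1[of n] by (simp add: d1_def N_def n_def)
    have d2: "\<bar>d2\<bar> \<le> \<epsilon> / 4" using e2 by (simp only: d2_def)
    define e where "e = \<bar>d1 + d2\<bar>"
    have "e \<le> \<epsilon> / 4 + \<epsilon> / 4"
      unfolding e_def by (rule order_trans[OF abs_triangle_ineq add_mono[OF less_imp_le[OF d1] d2]])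
    then have "e \<le> 1" "2 * e \<le> \<epsilon>" "\<bar>d1\<bar> \<le> 1" using d1 \<epsilon>(1,2) by linarith+
    then have d: "\<bar>d1\<bar> \<le> 1" "\<bar>d1 + d2\<bar> \<le> 1" "2 * \<bar>d1 + d2\<bar> \<le> \<epsilon>"
      by (simp_all only: e_def)
    define B :: real where "B = 2 ^ k / 2 - 3"
    have "(2::real) ^ k \<le> 2 ^ N" using N(1) by (intro power_increasing) auto
    then have BN: "B \<le> 2 ^ N / 2 - 2 - 1" by (simp add: B_def)
    have "agree_within B (limit_tiling y) (shifted_plane (y k))"
      by (rule agree_within_mono[OF limit_tiling_agree[OF y]]) (simp add: B_def)
    moreover have "agree_within B (shifted_plane (y k)) (shifted_plane (s N - d1))"
    proof -
      have "agree_within (2 ^ k / 2 - 1) (shifted_plane (\<rho> N k)) (shifted_plane (s N))"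
        by (rule agree_within_sym[OF glued_real_agree[OF \<rho>]])
      from agree_within_translate[OF this d(1)]
      have "agree_within (2 ^ k / 2 - 1 - 1) (shifted_plane (\<rho> N k - d1)) (shifted_plane (s N - d1))"
        by (simp only: translate_shifted_plane)
      then have "agree_within (2 ^ k / 2 - 1 - 1) (shifted_plane (y k)) (shifted_plane (s N - d1))"
        by (simp add: d1_def)
      then show ?thesis by (rule agree_within_mono) (simp add: B_def)
    qed
    moreover have "agree_within B (shifted_plane (s N - d1)) (translate (d1 + d2, d1 + d2) T)"
    proof -
      have "agree_within (2 ^ N / 2 - 2 - 1) (shifted_plane (t - (d1 + d2))) (translate (d1 + d2, d1 + d2) T)"
        using agree_within_translate[OF agree_within_sym[OF t(2)] d(2)] by (simp only: translate_shifted_plane)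
      moreover have "t - (d1 + d2) = s N - d1" by (simp add: d2_def)
      ultimately show ?thesis using agree_within_mono BN by metis
    qed
    ultimately have "agree_within B (limit_tiling y) (translate (d1 + d2, d1 + d2) T)"
      using agree_within_trans by blast
    then have "tilings_close \<epsilon> (limit_tiling y) T"
      by (rule tilings_close_if_agree[OF _ \<epsilon>(1) _ d(3)]) (use k in \<open>simp add: B_def\<close>)
    then have "tilings_close \<epsilon>0 (limit_tiling y) T" using tilings_close_mono \<epsilon> by blast
    moreover have "T \<in> limit_tiling ` threads" using T by (auto simp: cell_def)
    ultimately show "T \<in> W" using \<epsilon>0(2) by blast
  qed
  then show False using j W(1) by blast
qed

lemma dumbbell_cells: "dumbbell_covers (fixed_space H7) cell"
proof
  fix n a
  show "openin (fixed_space H7) (cell n a)" by (rule openin_cell)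
  show "cell (Suc n) a \<subseteq> cell n (a div 2)" by (rule cell_refine)
  \<comment> \<open>The midpoint of the edge from \<open>a\<close> to \<open>a + 1\<close> lies in
    both stars.\<close>
  define t where "t = (of_int a + 1/2) / (2 ^ n :: real)"
  have "t * 2 ^ n = of_int a + 1/2" by (simp add: t_def)
  then have "\<lfloor>t * 2 ^ n\<rfloor> = a" "\<lceil>t * 2 ^ n\<rceil> = a + 1" by linarith+
  then have "shifted_plane t \<in> cell n a \<inter> cell n (a + 1)"
    by (simp add: in_cell_const near_vertex_def)
  then show "cell n a \<inter> cell n (a + 1) \<noteq> {}" by blast
next
  fix n a b show "cell n a = cell n b \<longleftrightarrow> glued (4 ^ n) a b" by (rule cell_eq_iff)
next
  fix T n assume "T \<in> topspace (fixed_space H7)"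
  then obtain x where x: "x \<in> threads" "T = limit_tiling x" by (auto simp: topspace_fixed_space fixed_H7)
  define a where "a = \<lfloor>x n * 2 ^ n\<rfloor>"
  have c: "\<lceil>x n * 2 ^ n\<rceil> = a \<or> \<lceil>x n * 2 ^ n\<rceil> = a + 1" unfolding a_def by linarith
  have "T \<in> cell n a" using in_cell[OF x(1)] x(2) by (simp add: near_vertex_def a_def)
  moreover have "cell n b = cell n a \<or> cell n b = cell n (a + 1)" if "T \<in> cell n b" for b
    using that in_cell[OF x(1)] x(2) c unfolding cell_eq_iff near_vertex_def a_def by auto
  ultimately show "\<exists>a. T \<in> cell n a \<and> (\<forall>b. T \<in> cell n b \<longrightarrow> cell n b = cell n a \<or> cell n b = cell n (a + 1))"
    by blast
qed (rule cells_cofinal)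

section \<open>The two reflections are conjugate\<close>

text \<open>Conjugation by this rotation carries the reflection in y = x to that in y = -x. The
  inverse rotation gives the way back, so both are treated together as \<open>turns\<close>.\<close>

definition quarter_turn :: "plane \<Rightarrow> plane" where
  "quarter_turn p = (- snd p, fst p)"

definition quarter_turn_back :: "plane \<Rightarrow> plane" where
  "quarter_turn_back p = (snd p, - fst p)"

lemma arrow_act_turns:
  "arrow_act quarter_turn NE = NW" "arrow_act quarter_turn NW = SW"
  "arrow_act quarter_turn SW = SE" "arrow_act quarter_turn SE = NE"
  "arrow_act quarter_turn_back NE = SE" "arrow_act quarter_turn_back SE = SW"
  "arrow_act quarter_turn_back SW = NW" "arrow_act quarter_turn_back NW = NE"
  by (auto intro!: arrow_act_eqI simp: quarter_turn_def quarter_turn_back_def)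

lemma arrow_act_reflect_antidiag: "arrow_act reflect_antidiag NE = SW" "arrow_act reflect_antidiag SW = NE"
  "arrow_act reflect_antidiag NW = NW" "arrow_act reflect_antidiag SE = SE"
  by (auto intro!: arrow_act_eqI simp: reflect_antidiag_def)

abbreviation turns where "turns \<equiv> {quarter_turn, quarter_turn_back}"

lemma linear_turn: "g \<in> turns \<Longrightarrow> linear g"
  by (auto intro!: linearI simp: quarter_turn_def quarter_turn_back_def)

lemma norm_turn: "g \<in> turns \<Longrightarrow> norm (g p) = norm p"
  by (auto simp: quarter_turn_def quarter_turn_back_def norm_prod_def add.commute)

lemma turn_inverse:
  "quarter_turn (quarter_turn_back p) = p" "quarter_turn_back (quarter_turn p) = p"
  by (simp_all add: quarter_turn_def quarter_turn_back_def)

lemma inj_turn: "g \<in> turns \<Longrightarrow> inj g"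
  using inj_on_inverseI[of UNIV quarter_turn_back quarter_turn]
    inj_on_inverseI[of UNIV quarter_turn quarter_turn_back] turn_inverse by blast

lemma surj_turn: "g \<in> turns \<Longrightarrow> surj g"
  using surjI[of quarter_turn quarter_turn_back] surjI[of quarter_turn_back quarter_turn] turn_inverse by blast

lemma act_act_turn: "act quarter_turn (act quarter_turn_back T) = T" "act quarter_turn_back (act quarter_turn T) = T"
proof -
  have "arrow_act quarter_turn (arrow_act quarter_turn_back a) = a"
    "arrow_act quarter_turn_back (arrow_act quarter_turn a) = a" for a
    by (cases a; simp add: arrow_act_turns)+
  then show "act quarter_turn (act quarter_turn_back T) = T" "act quarter_turn_back (act quarter_turn T) = T"
    by (simp_all add: act_def image_image case_prod_beta turn_inverse)
qed

lemma act_translate: "linear g \<Longrightarrow> act g (translate v T) = translate (g v) (act g T)"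
  by (simp add: act_def translate_def image_image case_prod_beta linear_add)

lemma square_turn:
  assumes g: "g \<in> turns" shows "square (g c, b) = g ` square (c, a)"
proof -
  have p: "p \<in> square (c, a) \<longleftrightarrow> g p \<in> square (g c, b)" for p
  proof -
    obtain c1 c2 where c: "c = (c1, c2)" by (cases c)
    show ?thesis
      using g by (auto simp: c quarter_turn_def quarter_turn_back_def in_square abs_minus_commute)
  qed
  have "g ` square (c, a) \<subseteq> square (g c, b)" using p by blast
  moreover have "q \<in> g ` square (c, a)" if q: "q \<in> square (g c, b)" for q
  proof -
    obtain p where "q = g p" using surj_turn[OF g] by (rule surjE)
    then show ?thesis using p q by blast
  qed
  ultimately show ?thesis by blast
qed

lemma is_tiling_act:
  assumes g: "g \<in> turns" and T: "is_tiling T" shows "is_tiling (act g T)"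
proof -
  define G where "G = (\<lambda>(c, a). (g c, arrow_act g a))"
  have act: "act g T = G ` T" by (simp add: act_def G_def)
  have sq: "square (G u) = g ` square u" for u using square_turn[OF g] by (cases u) (simp add: G_def)
  have "(\<Union>u\<in>act g T. square u) = g ` (\<Union>u\<in>T. square u)" by (simp add: act sq image_UN)
  then have cover: "(\<Union>u\<in>act g T. square u) = UNIV"
    using T surj_turn[OF g] by (simp add: is_tiling_def)
  have "interior (square (G u)) \<inter> interior (square (G u')) = {} \<and>
      (square (G u) \<inter> square (G u')) face_of square (G u)" if "u \<in> T" "u' \<in> T" "G u \<noteq> G u'" for u u'
  proof -
    have "u \<noteq> u'" using that by auto
    then have h: "interior (square u) \<inter> interior (square u') = {}" "(square u \<inter> square u') face_of square u"
      using T that unfolding is_tiling_def by auto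
    have inj: "inj g" by (rule inj_turn[OF g])
    show ?thesis
      unfolding sq interior_injective_linear_image[OF linear_turn[OF g] inj]
        image_Int[OF inj, symmetric] face_of_linear_image[OF linear_turn[OF g] inj] h(1)
      using h(2) by simp
  qed
  then show ?thesis using cover unfolding is_tiling_def act by blast
qed

text \<open>The pictures for the four arrows are images of one picture under \<open>O2Z\<close>, so
  they rotate into each other; this is verified on the explicit lists of
  \<open>subst_tile_simps\<close>.\<close>

lemma subst_tile_turn:
  assumes g: "g \<in> turns" shows "subst_tile (g c, arrow_act g a) = act g (subst_tile (c, a))"
proof -
  obtain c1 c2 where c: "c = (c1, c2)" by (cases c)
  from g show ?thesis
    by (cases a)
      (auto simp: c subst_tile_simps arrow_act_turns act_def translate_def quarter_turn_def quarter_turn_back_def)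
qed

lemma chair_subst_turn:
  assumes g: "g \<in> turns" shows "chair_subst (act g P) = act g (chair_subst P)"
proof -
  have "chair_subst (act g P) = (\<Union>u\<in>P. subst_tile (g (fst u), arrow_act g (snd u)))"
    by (simp add: chair_subst_def act_def case_prod_beta)
  also have "\<dots> = (\<Union>u\<in>P. act g (subst_tile u))" by (simp add: subst_tile_turn[OF g])
  also have "\<dots> = act g (chair_subst P)" by (simp add: act_def chair_subst_def image_UN)
  finally show ?thesis .
qed

lemma act_chair_tilings:
  assumes g: "g \<in> turns" and T: "T \<in> chair_tilings" shows "act g T \<in> chair_tilings"
proof -
  have iter: "(chair_subst ^^ n) (act g P) = act g ((chair_subst ^^ n) P)" for n P
    by (induction n) (simp_all add: chair_subst_turn[OF g])
  have legal: "\<exists>v t n. P \<subseteq> translate v ((chair_subst ^^ n) {t})" if P: "finite P" "P \<subseteq> act g T" for P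
  proof -
    obtain P' where P': "P' \<subseteq> T" "finite P'" "P = act g P'"
      using finite_subset_image[OF P(1), of "\<lambda>(c, a). (g c, arrow_act g a)" T] P(2) unfolding act_def by blast
    then obtain v t n where "P' \<subseteq> translate v ((chair_subst ^^ n) {t})"
      using T unfolding chair_tilings_def by blast
    moreover obtain c a where "t = (c, a)" by (cases t)
    ultimately have "P' \<subseteq> translate v ((chair_subst ^^ n) {(c, a)})" by simp
    then have "P \<subseteq> act g (translate v ((chair_subst ^^ n) {(c, a)}))"
      unfolding P'(3) act_def by (rule image_mono)
    also have "\<dots> = translate (g v) ((chair_subst ^^ n) {(g c, arrow_act g a)})"
      unfolding act_translate[OF linear_turn[OF g]] iter[symmetric] by (simp add: act_def)
    finally show ?thesis by blast
  qed
  have "is_tiling T" using T by (simp add: chair_tilings_def)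
  show ?thesis
    unfolding chair_tilings_def
  proof (intro CollectI conjI allI impI)
    show "is_tiling (act g T)" by (rule is_tiling_act[OF g \<open>is_tiling T\<close>])
    fix P assume "finite P \<and> P \<subseteq> act g T"
    then show "\<exists>v t n. P \<subseteq> translate v ((chair_subst ^^ n) {t})" using legal by (elim conjE)
  qed
qed

lemma agree_on_act:
  assumes g: "g \<in> turns" and a: "agree_on (cball 0 r) T T'"
  shows "agree_on (cball 0 r) (act g T) (act g T')"
proof -
  have sub: "u \<in> act g T2" if u: "u \<in> act g T1" and ne: "square u \<inter> cball 0 r \<noteq> {}"
    and a: "agree_on (cball 0 r) T1 T2" for u T1 T2
  proof -
    obtain c b where cb: "(c, b) \<in> T1" "u = (g c, arrow_act g b)" using u by (auto simp: act_def)
    obtain p where p: "p \<in> square u" "norm p \<le> r" using ne by auto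
    have "p \<in> g ` square (c, b)" using p(1) unfolding cb(2) square_turn[OF g, of c _ b] .
    then have "square (c, b) \<inter> cball 0 r \<noteq> {}" using p(2) norm_turn[OF g] by auto
    then have "(c, b) \<in> T2" using a cb(1) unfolding agree_on_iff by blast
    then show ?thesis unfolding cb(2) act_def by force
  qed
  have "agree_on (cball 0 r) T' T" using a unfolding agree_on_def by simp
  then show ?thesis using sub a unfolding agree_on_iff by blast
qed

lemma tilings_close_act:
  assumes g: "g \<in> turns" and c: "tilings_close \<epsilon> T T'" shows "tilings_close \<epsilon> (act g T) (act g T')"
proof -
  obtain v w where vw: "norm v \<le> \<epsilon>" "norm w \<le> \<epsilon>" "agree_on (cball 0 (1 / \<epsilon>)) (translate v T) (translate w T')"
    using c unfolding tilings_close_def by blast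
  have "agree_on (cball 0 (1 / \<epsilon>)) (translate (g v) (act g T)) (translate (g w) (act g T'))"
    using agree_on_act[OF g vw(3)] by (simp only: act_translate[OF linear_turn[OF g]])
  then show ?thesis unfolding tilings_close_def using vw(1,2) norm_turn[OF g] by metis
qed

text \<open>A turn is an isometry fixing the origin, so it preserves \<open>tilings_close\<close>
  without a change of scale.\<close>

lemma continuous_map_act:
  assumes g: "g \<in> turns" and maps: "\<And>T. T \<in> fixed_tilings H \<Longrightarrow> act g T \<in> fixed_tilings H'"
  shows "continuous_map (fixed_space H) (fixed_space H') (act g)"
  unfolding continuous_map_def topspace_fixed_space
proof (intro conjI allI impI)
  show "act g \<in> fixed_tilings H \<rightarrow> fixed_tilings H'" using maps by blast
  fix W assume "openin (fixed_space H') W"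
  then have W: "\<And>T. T \<in> W \<Longrightarrow> \<exists>\<epsilon>>0. \<forall>T'\<in>fixed_tilings H'. tilings_close \<epsilon> T T' \<longrightarrow> T' \<in> W"
    unfolding openin_fixed_space by blast
  show "openin (fixed_space H) {T \<in> fixed_tilings H. act g T \<in> W}"
    unfolding openin_fixed_space
  proof (intro conjI ballI)
    show "{T \<in> fixed_tilings H. act g T \<in> W} \<subseteq> fixed_tilings H" by blast
    fix T assume "T \<in> {T \<in> fixed_tilings H. act g T \<in> W}"
    then obtain \<epsilon> where \<epsilon>: "\<epsilon> > 0" "\<And>T'. T' \<in> fixed_tilings H' \<Longrightarrow> tilings_close \<epsilon> (act g T) T' \<Longrightarrow> T' \<in> W"
      using W[of "act g T"] by blast
    then show "\<exists>\<epsilon>>0. \<forall>T'\<in>fixed_tilings H. tilings_close \<epsilon> T T' \<longrightarrow> T' \<in> {T \<in> fixed_tilings H. act g T \<in> W}"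
      using maps tilings_close_act[OF g] by blast
  qed
qed

lemma act_comp_eq:
  assumes "\<And>p. g (h p) = g' (h' p)" "\<And>a. arrow_act g (arrow_act h a) = arrow_act g' (arrow_act h' a)"
  shows "act g (act h T) = act g' (act h' T)"
  using assms by (simp add: act_def image_image case_prod_beta)

lemma fixed_H7_homeomorphic_H8: "fixed_space H7 homeomorphic_space fixed_space H8"
proof -
  have fwd: "act quarter_turn T \<in> fixed_tilings H8" if T: "T \<in> fixed_tilings H7" for T
  proof -
    have "act reflect_antidiag (act quarter_turn T) = act quarter_turn (act reflect_diag T)"
    proof (rule act_comp_eq)
      show "reflect_antidiag (quarter_turn p) = quarter_turn (reflect_diag p)" for p
        by (simp add: reflect_antidiag_def quarter_turn_def reflect_diag_def)
      show "arrow_act reflect_antidiag (arrow_act quarter_turn a) = arrow_act quarter_turn (arrow_act reflect_diag a)" for a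
        by (cases a) (simp_all add: arrow_act_turns arrow_act_reflect_diag arrow_act_reflect_antidiag)
    qed
    then show ?thesis using T act_chair_tilings by (simp add: H7_eq H8_eq)
  qed
  have bwd: "act quarter_turn_back T \<in> fixed_tilings H7" if T: "T \<in> fixed_tilings H8" for T
  proof -
    have "act reflect_diag (act quarter_turn_back T) = act quarter_turn_back (act reflect_antidiag T)"
    proof (rule act_comp_eq)
      show "reflect_diag (quarter_turn_back p) = quarter_turn_back (reflect_antidiag p)" for p
        by (simp add: reflect_antidiag_def quarter_turn_back_def reflect_diag_def)
      show "arrow_act reflect_diag (arrow_act quarter_turn_back a) = arrow_act quarter_turn_back (arrow_act reflect_antidiag a)" for a
        by (cases a) (simp_all add: arrow_act_turns arrow_act_reflect_diag arrow_act_reflect_antidiag)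
    qed
    then show ?thesis using T act_chair_tilings by (simp add: H7_eq H8_eq)
  qed
  have "continuous_map (fixed_space H7) (fixed_space H8) (act quarter_turn)"
    by (rule continuous_map_act[OF _ fwd]) simp
  moreover have "continuous_map (fixed_space H8) (fixed_space H7) (act quarter_turn_back)"
    by (rule continuous_map_act[OF _ bwd]) simp
  ultimately have "homeomorphic_maps (fixed_space H7) (fixed_space H8) (act quarter_turn) (act quarter_turn_back)"
    unfolding homeomorphic_maps_def by (simp add: act_act_turn)
  then show ?thesis unfolding homeomorphic_space_def by blast
qed

theorem mainTheorem3:
  shows "fixed_space H7 homeomorphic_space fixed_space H8 \<and>
         cech_cohomology 0 (fixed_space H7) \<cong> integer_group \<and>
         cech_cohomology 1 (fixed_space H7) \<cong> dyadic_group \<times>\<times> dyadic_group"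
  using fixed_H7_homeomorphic_H8 dumbbell_covers.cech_0[OF dumbbell_cells]
    dumbbell_covers.cech_1[OF dumbbell_cells] by blast

end
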